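(* Let $\lambda\in\mathbf R$. Assume $\boldsymbol\beta\in\mathbf B_{12}$ and $|\lambda|>\lambda_-$. Let $\hat u\in\mathcal B_0^*(\mathbf Z^3;\mathbf C^6)$ be such that $(\hat H^{D_p}-\lambda)\hat u=0$ on $\mathbf Z^3$ and $\hat u\ne0$. Then $\hat u$ is an eigenvector of $\hat H^{D_p}$ (as an operator on $\ell^2(\mathbf Z^3;\mathbf C^6)$) associated with the eigenvalue $\lambda$; that is, $\hat u\in\ell^2(\mathbf Z^3;\mathbf C^6)$.
   Context: Parameters: $\epsilon_1,\epsilon_2,\epsilon_3,\mu_1,\mu_2,\mu_3\in(0,\infty)$; $\boldsymbol\epsilon=\mathrm{diag}(\epsilon_1,\epsilon_2,\epsilon_3)$, $\boldsymbol\mu=\mathrm{diag}(\mu_1,\mu_2,\mu_3)$, also identified with vectors. $\boldsymbol\beta=(\beta_1,\beta_2,\beta_3)=\boldsymbol\epsilon\times\boldsymbol\mu$ (cross product), and $\alpha_i=(\epsilon_j\mu_k+\epsilon_k\mu_j)/2$ for $(i,j,k)$ a cyclic permutation of $(1,2,3)$. $\mathbf B_{12}=\{\boldsymbol\beta\in\mathbf R^3:\boldsymbol\beta\ne0,\ \beta_1\beta_2\beta_3=0\}$. For $z\in[0,\infty)^3$: $\Psi_0(z)=\sum_i\alpha_iz_i$, $K_0(z)=\frac14\sum_{i=1}^3(\beta_iz_i)^2-\frac12\sum_{i<j}\beta_i\beta_jz_iz_j$ (which is $\ge 0$ there), $\tau^\pm(z)=\Psi_0(z)\pm\sqrt{K_0(z)}\ge0$,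 and $\lambda_\pm=\max_{z\in[0,1]^3}\sqrt{\tau^\pm(z)}$. Operators: for sequences on $\mathbf Z^3$ let $(\hat y_j\hat u)(n)=\frac1{2i}(\hat u(n+e_j)-\hat u(n-e_j))$ (this is multiplication by $y_j=\sin x_j$ under the Fourier convention $u(x)=(2\pi)^{-3/2}\sum_n e^{-in\cdot x}\hat u(n)$). The isotropic discrete Maxwell operator $\hat H_0$ acts on sequences $\hat u:\mathbf Z^3\to\mathbf C^6$ as the block matrix $\begin{pmatrix}0&\tilde M\\-\tilde M&0\end{pmatrix}$, $\tilde M=\begin{pmatrix}0&-\hat y_3&\hat y_2\\ \hat y_3&0&-\hat y_1\\-\hat y_2&\hat y_1&0\end{pmatrix}$. Let $\hat D=\mathrm{diag}(\boldsymbol\epsilon,\boldsymbol\mu)$ (constant $6\times6$ matrix). The perturbed operator is $\hat H^{D_p}=\hat D_p\hat H_0$, where $\hat D_p$ is multiplication by the real diagonal matrix $\hat D_p(n)=\mathrm{diag}(\tilde\epsilon_1(n),\tilde\epsilon_2(n),\tilde\epsilon_3(n),\tilde\mu_1(n),\tilde\mu_2(n),\tilde\mu_3(n))$ with $\tilde\epsilon_j(n)>0,\tilde\mu_j(n)>0$ for all $j$ and $n\in\mathbf Z^3$, and $\hat D_p(n)=\hat D$ for all but finitely many $n$. For $n\in\mathbf Z^3$, $|n|=\sum_j|n_j|$. $\mathcal B_0^*(\mathbf Z^3;\mathbf C^6)=\{\hat u:\mathbf Z^3\to\mathbf C^6:\ \lim_{R\to\infty}\frac1R\sum_{|n|<R}|\hat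 u(n)|^2=0\}$. *)

theory Defs
  imports "HOL-Analysis.Analysis"
begin

text \<open>
  The lattice is \<open>int ^ 3\<close>, with standard basis vectors \<open>axis j 1\<close>. The target space of the
  fields is \<open>(complex ^ 3) \<times> (complex ^ 3)\<close>, i.e. six complex coordinates split according to
  the 2 by 2 block structure of the Maxwell operator; its library norm is the Euclidean
  norm of the six coordinates.
\<close>

type_synonym lattice = "int ^ 3"
type_synonym field6 = "(complex ^ 3) \<times> (complex ^ 3)"

definition l1norm :: "lattice \<Rightarrow> int" where
  "l1norm n = (\<Sum>j\<in>UNIV. \<bar>n $ j\<bar>)"

definition beta :: "real ^ 3 \<Rightarrow> real ^ 3 \<Rightarrow> real ^ 3" where
  "beta eps mu = cross3 eps mu"

text \<open>Addition in the index type \<open>3\<close> is modulo 3, so \<open>(i, i + 1, i + 2)\<close> runs through the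
  cyclic permutations of \<open>(1, 2, 3)\<close>.\<close>

definition alpha :: "real ^ 3 \<Rightarrow> real ^ 3 \<Rightarrow> real ^ 3" where
  "alpha eps mu = (\<chi> i. (eps $ (i + 1) * mu $ (i + 2) + eps $ (i + 2) * mu $ (i + 1)) / 2)"

lemma alpha_components:
  "alpha eps mu $ 1 = (eps $ 2 * mu $ 3 + eps $ 3 * mu $ 2) / 2"
  "alpha eps mu $ 2 = (eps $ 3 * mu $ 1 + eps $ 1 * mu $ 3) / 2"
  "alpha eps mu $ 3 = (eps $ 1 * mu $ 2 + eps $ 2 * mu $ 1) / 2"
proof -
  have e: "(1 + 1 :: 3) = 2" "(1 + 2 :: 3) = 3" "(2 + 1 :: 3) = 3" "(2 + 2 :: 3) = 1"
    "(3 + 1 :: 3) = 1" "(3 + 2 :: 3) = 2"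
    by simp_all
  show "alpha eps mu $ 1 = (eps $ 2 * mu $ 3 + eps $ 3 * mu $ 2) / 2"
    "alpha eps mu $ 2 = (eps $ 3 * mu $ 1 + eps $ 1 * mu $ 3) / 2"
    "alpha eps mu $ 3 = (eps $ 1 * mu $ 2 + eps $ 2 * mu $ 1) / 2"
    unfolding alpha_def vec_lambda_beta e by simp_all
qed

definition B12 :: "(real ^ 3) set" where
  "B12 = {b. b \<noteq> 0 \<and> b $ 1 * b $ 2 * b $ 3 = 0}"

definition Psi0 :: "real ^ 3 \<Rightarrow> real ^ 3 \<Rightarrow> real ^ 3 \<Rightarrow> real" where
  "Psi0 eps mu z = (\<Sum>i\<in>UNIV. alpha eps mu $ i * z $ i)"

definition K0 :: "real ^ 3 \<Rightarrow> real ^ 3 \<Rightarrow> real ^ 3 \<Rightarrow> real" where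
  "K0 eps mu z = (let b = beta eps mu in
     1 / 4 * (\<Sum>i\<in>UNIV. (b $ i * z $ i)\<^sup>2)
     - 1 / 2 * (b $ 1 * b $ 2 * z $ 1 * z $ 2 + b $ 1 * b $ 3 * z $ 1 * z $ 3
                + b $ 2 * b $ 3 * z $ 2 * z $ 3))"

definition tau_minus :: "real ^ 3 \<Rightarrow> real ^ 3 \<Rightarrow> real ^ 3 \<Rightarrow> real" where
  "tau_minus eps mu z = Psi0 eps mu z - sqrt (K0 eps mu z)"

definition unit_cube :: "(real ^ 3) set" where
  "unit_cube = {z. \<forall>i. 0 \<le> z $ i \<and> z $ i \<le> 1}"

text \<open>The supremum is a maximum, see \<open>lambda_minus_attained\<close> below.\<close>

definition lambda_minus :: "real ^ 3 \<Rightarrow> real ^ 3 \<Rightarrow> real" where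
  "lambda_minus eps mu = (SUP z\<in>unit_cube. sqrt (tau_minus eps mu z))"

lemma lambda_minus_attained:
  shows "\<exists>z\<in>unit_cube. lambda_minus eps mu = sqrt (tau_minus eps mu z)"
    and "z \<in> unit_cube \<Longrightarrow> sqrt (tau_minus eps mu z) \<le> lambda_minus eps mu"
proof -
  have cube: "unit_cube = cbox (0 :: real ^ 3) 1"
    by (simp add: unit_cube_def set_eq_iff mem_box_cart)
  have "compact unit_cube"
    unfolding cube by (rule compact_cbox)
  moreover have "0 \<in> unit_cube"
    by (simp add: unit_cube_def)
  then have "unit_cube \<noteq> {}"
    by blast
  moreover have "continuous_on unit_cube (\<lambda>z. sqrt (tau_minus eps mu z))"
    unfolding tau_minus_def Psi0_def K0_def Let_def by (intro continuous_intros)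
  ultimately obtain m where m: "m \<in> unit_cube"
    "\<And>z. z \<in> unit_cube \<Longrightarrow> sqrt (tau_minus eps mu z) \<le> sqrt (tau_minus eps mu m)"
    using continuous_attains_sup[of unit_cube "\<lambda>z. sqrt (tau_minus eps mu z)"] by metis
  have eq: "lambda_minus eps mu = sqrt (tau_minus eps mu m)"
    unfolding lambda_minus_def
  proof (rule cSup_eq_maximum)
    show "sqrt (tau_minus eps mu m) \<in> (\<lambda>z. sqrt (tau_minus eps mu z)) ` unit_cube"
      using m(1) by (rule imageI)
    fix x assume "x \<in> (\<lambda>z. sqrt (tau_minus eps mu z)) ` unit_cube"
    then obtain z where "z \<in> unit_cube" "x = sqrt (tau_minus eps mu z)"
      by (rule imageE)
    then show "x \<le> sqrt (tau_minus eps mu m)"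
      using m(2) by metis
  qed
  show "\<exists>z\<in>unit_cube. lambda_minus eps mu = sqrt (tau_minus eps mu z)"
    using eq m(1) by blast
  show "z \<in> unit_cube \<Longrightarrow> sqrt (tau_minus eps mu z) \<le> lambda_minus eps mu"
    unfolding eq by (rule m(2))
qed

definition yhat :: "3 \<Rightarrow> (lattice \<Rightarrow> complex) \<Rightarrow> lattice \<Rightarrow> complex" where
  "yhat j f n = (f (n + axis j 1) - f (n - axis j 1)) / (2 * \<i>)"

definition Mtilde :: "(lattice \<Rightarrow> complex ^ 3) \<Rightarrow> lattice \<Rightarrow> complex ^ 3" where
  "Mtilde f n =
     (let c = (\<lambda>k m. f m $ k) in
      vector [- yhat 3 (c 2) n + yhat 2 (c 3) n,
              yhat 3 (c 1) n - yhat 1 (c 3) n,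
              - yhat 2 (c 1) n + yhat 1 (c 2) n])"

definition H0 :: "(lattice \<Rightarrow> field6) \<Rightarrow> lattice \<Rightarrow> field6" where
  "H0 u n = (Mtilde (\<lambda>m. snd (u m)) n, - Mtilde (\<lambda>m. fst (u m)) n)"

definition diag_mult :: "real ^ 3 \<Rightarrow> complex ^ 3 \<Rightarrow> complex ^ 3" where
  "diag_mult d v = (\<chi> i. complex_of_real (d $ i) * v $ i)"

definition HDp ::
  "(lattice \<Rightarrow> real ^ 3) \<Rightarrow> (lattice \<Rightarrow> real ^ 3) \<Rightarrow> (lattice \<Rightarrow> field6) \<Rightarrow> lattice \<Rightarrow> field6" where
  "HDp epsp mup u n = (diag_mult (epsp n) (fst (H0 u n)), diag_mult (mup n) (snd (H0 u n)))"

definition B0star :: "(lattice \<Rightarrow> field6) set" where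
  "B0star = {u. ((\<lambda>R :: real. 1 / R * (\<Sum>n | real_of_int (l1norm n) < R. (norm (u n))\<^sup>2))
                 \<longlongrightarrow> 0) at_top}"

lemma finite_l1ball: "finite {n. real_of_int (l1norm n) < R}"
proof -
  define N where "N = \<lceil>R\<rceil>"
  have "n $ j \<in> {-N..N}" if "real_of_int (l1norm n) < R" for n j
  proof -
    have "\<bar>n $ j\<bar> \<le> l1norm n"
      unfolding l1norm_def by (rule member_le_sum) auto
    moreover have "l1norm n \<le> N"
      using that unfolding N_def by linarith
    ultimately show ?thesis by auto
  qed
  then have "{n. real_of_int (l1norm n) < R}
      \<subseteq> (\<lambda>(a, b, c). vector [a, b, c]) ` ({-N..N} \<times> {-N..N} \<times> {-N..N})"
  proof (intro subsetI)
    fix n :: lattice assume h: "\<And>n j. real_of_int (l1norm n) < R \<Longrightarrow> n $ j \<in> {-N..N}"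
      and n: "n \<in> {n. real_of_int (l1norm n) < R}"
    have "n = vector [n $ 1, n $ 2, n $ 3]"
      by (simp add: vec_eq_iff forall_3)
    moreover have "(n $ 1, n $ 2, n $ 3) \<in> {-N..N} \<times> {-N..N} \<times> {-N..N}"
      using h n by blast
    ultimately show "n \<in> (\<lambda>(a, b, c). vector [a, b, c]) ` ({-N..N} \<times> {-N..N} \<times> {-N..N})"
      by (intro image_eqI[where x = "(n $ 1, n $ 2, n $ 3)"]) simp_all
  qed
  then show ?thesis by (rule finite_subset) (intro finite_imageI finite_cartesian_product finite_atLeastAtMost_int)
qed

definition ell2 :: "(lattice \<Rightarrow> field6) set" where
  "ell2 = {u. (\<lambda>n. (norm (u n))\<^sup>2) summable_on UNIV}"

definition ell2_eigenvector ::
  "((lattice \<Rightarrow> field6) \<Rightarrow> lattice \<Rightarrow> field6) \<Rightarrow> real \<Rightarrow> (lattice \<Rightarrow> field6) \<Rightarrow> bool" where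
  "ell2_eigenvector T l u \<longleftrightarrow> u \<in> ell2 \<and> u \<noteq> (\<lambda>n. 0) \<and> (\<forall>n. T u n = l *\<^sub>R u n)"

end

theory Submission
  imports Defs "HOL-Library.Poly_Mapping"
begin

text \<open>
  Some \<open>\<beta>\<^sub>i\<close> vanishes. Along this axis the components \<open>e\<^sub>i\<close> and
  \<open>h\<^sub>i\<close> decouple, each solving a scalar equation \<open>\<lambda>\<^sup>2 v - \<Sum>j. c\<^sub>j y\<^sub>j\<^sup>2 v = g\<close> with \<open>g\<close> finitely
  supported. The other four components then satisfy \<open>\<lambda>\<^sup>2 v - \<alpha>\<^sub>i y\<^sub>i\<^sup>2 v \<in> \<ell>\<^sup>2\<close>, and \<open>|\<lambda>| > \<lambda>\<^sub>-\<close> puts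
  \<open>\<lambda>\<^sup>2\<close> above \<open>\<alpha>\<^sub>i\<close>, hence outside the spectrum of \<open>\<alpha>\<^sub>i y\<^sub>i\<^sup>2\<close>.

  The operator \<open>y\<^sub>j\<^sup>2\<close> moves by two steps, so the scalar equation is a nearest neighbour equation on each
  of the eight sublattices of step 2. Reading the first coordinate as a discrete time, it becomes
  \<open>v\<^sub>k\<^sub>+\<^sub>1 + v\<^sub>k\<^sub>-\<^sub>1 = H v\<^sub>k + g\<^sub>k\<close> with a self-adjoint operator \<open>H\<close> on the planar lattice.
  Solutions of the homogeneous equation are tested against the solutions \<open>Z\<^sub>k(H) a\<close>, where \<open>Z\<^sub>k\<close> solves the scalar
  recurrence \<open>Z\<^sub>k\<^sub>+\<^sub>1 + Z\<^sub>k\<^sub>-\<^sub>1 = t Z\<^sub>k\<close>: their Wronskian does not depend on \<open>k\<close>, while its average over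
  \<open>k \<in> [R, 2R]\<close> tends to zero if \<open>Z\<^sub>k\<close> is bounded with derivatives \<open>O(k)\<close>. Hence a homogeneous solution with
  vanishing averages is zero, and it suffices to find one square summable solution of the inhomogeneous equation.
  Inside the spectrum, the solution that vanishes for large \<open>k\<close> turns out to be finitely supported.
  At the top of the spectrum, a cut-off shows that the source has total mass zero, so that its convolution with the
  Green function of the random walk on the lattice is square summable. Above the top, \<open>\<lambda>\<^sup>2\<close> dominates the difference operator
  and no uniqueness is needed.
\<close>

section \<open>Trigonometric polynomials on the torus\<close>

text \<open>It is therefore merely paired with finitely supported sequences, and the functional
  calculus acts on those. The rate in \<open>B0star\<close> is what the Wronskian can bear: a window
  of R times carries o(R) of weighted mass, and a test solution of bounded weighted norm turns this
  into an average that tends to 0.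

  The energy decides the method. Below the top of the spectrum there is an open set of angles at
  which the recurrence oscillates, and a weight living there already determines a finitely supported
  sequence. At the top this set is empty, since the symbol touches the oscillating range only at its
  boundary. The random walk takes over: its transience in dimension three gives a finite Green
  function with square summable differences.

  The hypothesis on \<lambda> enters through one vertex of the cube. If \<beta>_i = 0, then
  \<open>K0\<close> vanishes at the i-th unit vector, so \<open>tau_minus\<close> equals \<alpha>_i
  there and \<open>lambda_minus\<close> is at least the square root of \<alpha>_i.\<close>

text \<open>Elements of the group algebra of the planar lattice are finitely supported sequences; multiplication is
  convolution, \<open>pair\<close> is the bilinear pairing with an arbitrary sequence, and \<open>ev\<close> is the Fourier transform.\<close>

definition pair :: "(int \<times> int \<Rightarrow> complex) \<Rightarrow> (int \<times> int \<Rightarrow>\<^sub>0 complex) \<Rightarrow> complex" where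
  "pair y a = (\<Sum>n\<in>Poly_Mapping.keys a. y n * Poly_Mapping.lookup a n)"

lemma pair_superset:
  assumes "finite S" "Poly_Mapping.keys a \<subseteq> S"
  shows "pair y a = (\<Sum>n\<in>S. y n * Poly_Mapping.lookup a n)"
  unfolding pair_def using assms
  by (intro sum.mono_neutral_left) (auto simp: in_keys_iff)

lemma pair_add_right: "pair y (a + b) = pair y a + pair y b"
proof -
  define S where "S = Poly_Mapping.keys a \<union> Poly_Mapping.keys b"
  have "finite S" by (simp add: S_def)
  moreover have "Poly_Mapping.keys (a + b) \<subseteq> S"
    unfolding S_def by (rule keys_add)
  moreover have "Poly_Mapping.keys a \<subseteq> S" "Poly_Mapping.keys b \<subseteq> S"
    by (auto simp: S_def)
  ultimately show ?thesis
    by (simp add: pair_superset[of S] lookup_add sum.distrib algebra_simps)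
qed

lemma pair_zero_right [simp]: "pair y 0 = 0"
  by (simp add: pair_def)

lemma pair_uminus_right: "pair y (- a) = - pair y a"
  using pair_add_right[of y a "- a"] by (simp add: eq_neg_iff_add_eq_0 add.commute)

lemma pair_diff_right: "pair y (a - b) = pair y a - pair y b"
  using pair_add_right[of y a "- b"] by (simp add: pair_uminus_right)

lemma pair_add_left: "pair (\<lambda>n. y n + z n) a = pair y a + pair z a"
  by (simp add: pair_def sum.distrib algebra_simps)

lemma pair_diff_left: "pair (\<lambda>n. y n - z n) a = pair y a - pair z a"
  by (simp add: pair_def sum_subtractf algebra_simps)

lemma pair_mult_left: "pair (\<lambda>n. c * y n) a = c * pair y a"
  by (simp add: pair_def sum_distrib_left algebra_simps)

lemma pair_single [simp]: "pair y (Poly_Mapping.single m c) = c * y m"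
  by (simp add: pair_def)

lemma update_eq_plus_single:
  assumes "k \<notin> Poly_Mapping.keys f"
  shows "Poly_Mapping.update k v f = Poly_Mapping.single k v + f"
  using assms by (intro poly_mapping_eqI) (auto simp: lookup_update lookup_add lookup_single in_keys_iff when_def)

lemma poly_mapping_sum_induct [case_names zero plus]:
  assumes "P 0" and "\<And>k v f. P f \<Longrightarrow> P (Poly_Mapping.single k v + f)"
  shows "P f"
  by (induction f rule: update_induct) (auto simp: update_eq_plus_single intro: assms)

lemma pair_single_times:
  "pair y (Poly_Mapping.single m c * a) = c * pair (\<lambda>n. y (m + n)) a"
proof (induction a rule: poly_mapping_sum_induct)
  case (plus k v f)
  then show ?case by (simp add: mult_single pair_add_right distrib_left)
qed simp

definition char :: "int \<times> int \<Rightarrow> real \<times> real \<Rightarrow> complex" where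
  "char n x = cis (of_int (fst n) * fst x + of_int (snd n) * snd x)"

definition ev :: "(int \<times> int \<Rightarrow>\<^sub>0 complex) \<Rightarrow> real \<times> real \<Rightarrow> complex" where
  "ev a x = pair (\<lambda>n. char n x) a"

lemma char_add: "char (m + n) x = char m x * char n x"
  by (simp add: char_def cis_mult algebra_simps)

lemma char_uminus: "char (- n) x = cnj (char n x)"
  by (simp add: char_def cis_cnj)

lemma char_zero [simp]: "char 0 x = 1"
  by (simp add: char_def)

lemma norm_char [simp]: "norm (char n x) = 1"
  by (simp add: char_def)

lemma char_mult_cnj: "char m x * cnj (char n x) = char (m - n) x"
  using char_add[of m "- n" x] by (simp add: char_uminus)

lemma ev_add: "ev (a + b) x = ev a x + ev b x"
  by (simp add: ev_def pair_add_right)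

lemma ev_diff: "ev (a - b) x = ev a x - ev b x"
  by (simp add: ev_def pair_diff_right)

lemma ev_zero [simp]: "ev 0 x = 0"
  by (simp add: ev_def)

lemma ev_single: "ev (Poly_Mapping.single m c) x = c * char m x"
  by (simp add: ev_def)

lemma ev_single_times: "ev (Poly_Mapping.single m c * a) x = c * char m x * ev a x"
  by (simp add: ev_def pair_single_times char_add pair_mult_left)

lemma ev_mult: "ev (a * b) x = ev a x * ev b x"
proof (induction a rule: poly_mapping_sum_induct)
  case (plus k v f)
  then show ?case by (simp add: ev_add ev_single ev_single_times distrib_right)
qed simp

lemma continuous_on_char [continuous_intros]:
  "continuous_on S (\<lambda>x. char n x)"
  unfolding char_def by (intro continuous_intros)

lemma continuous_on_ev [continuous_intros]: "continuous_on S (ev a)"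
  unfolding ev_def pair_def by (intro continuous_intros)

definition torus :: "(real \<times> real) set" where
  "torus = cbox (0, 0) (2 * pi, 2 * pi)"

definition mean :: "(real \<times> real \<Rightarrow> complex) \<Rightarrow> complex" where
  "mean F = integral torus F / of_real ((2 * pi)\<^sup>2)"

lemma integral_cis: "integral {0..2 * pi} (\<lambda>t. cis (of_int n * t)) = (if n = 0 then 2 * pi else 0)"
proof (cases "n = 0")
  case False
  have "((\<lambda>t. cis (of_int n * t)) has_integral
      (cis (of_int n * (2 * pi)) / (\<i> * of_int n) - cis (of_int n * 0) / (\<i> * of_int n))) {0..2 * pi}"
    using False by (intro fundamental_theorem_of_calculus)
      (auto simp: cis_conv_exp algebra_simps intro!: derivative_eq_intros has_vector_derivative_real_field)
  moreover have "cis (of_int n * (2 * pi)) = 1"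
    by (metis cis_multiple_2pi Ints_of_int mult.commute)
  ultimately show ?thesis
    using False by (simp add: integral_unique)
qed (simp add: scaleR_conv_of_real)

lemma mean_char: "mean (char n) = (if n = 0 then 1 else 0)"
proof -
  obtain a b where n: "n = (a, b)" by (cases n)
  have "integral torus (char n) =
      integral {0..2 * pi} (\<lambda>x. integral {0..2 * pi} (\<lambda>y. char n (x, y)))"
    unfolding torus_def
    by (subst integral_prod_continuous) (auto intro: continuous_on_char)
  also have "\<dots> = integral {0..2 * pi} (\<lambda>x. cis (of_int a * x) * integral {0..2 * pi} (\<lambda>y. cis (of_int b * y)))"
    by (simp add: n char_def flip: cis_mult)
  also have "\<dots> = (if n = 0 then (2 * pi)\<^sup>2 else 0)"
    by (auto simp: integral_cis n zero_prod_def power2_eq_square)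
  finally show ?thesis by (simp add: mean_def)
qed

lemma integrable_on_torus:
  fixes F :: "real \<times> real \<Rightarrow> 'a::banach"
  shows "continuous_on torus F \<Longrightarrow> F integrable_on torus"
  unfolding torus_def by (rule integrable_continuous)

lemma mean_sum:
  assumes "\<And>i. i \<in> S \<Longrightarrow> continuous_on torus (F i)"
  shows "mean (\<lambda>x. \<Sum>i\<in>S. F i x) = (\<Sum>i\<in>S. mean (F i))"
proof (cases "finite S")
  case True
  then show ?thesis
    unfolding mean_def using assms
    by (subst integral_sum) (auto intro: integrable_on_torus simp: sum_divide_distrib)
qed (simp add: mean_def)

lemma mean_mult_left: "mean (\<lambda>x. c * F x) = c * mean F"
  by (simp add: mean_def)

lemma mean_norm_le:
  assumes "continuous_on torus F" "\<And>x. norm (F x) \<le> C"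
  shows "norm (mean F) \<le> C"
proof -
  have "0 \<le> C" using assms(2)[of 0] norm_ge_zero order_trans by blast
  have "norm (integral torus F) \<le> C * measure lborel torus"
    unfolding torus_def using assms \<open>0 \<le> C\<close>
    by (intro integrable_bound) (auto simp: torus_def intro: integrable_continuous)
  also have "measure lborel torus = (2 * pi)\<^sup>2"
    by (simp add: torus_def content_Pair power2_eq_square)
  finally show ?thesis
    by (simp add: mean_def norm_divide norm_mult norm_power field_simps)
qed

text \<open>By orthogonality of the characters the left side is the mean of the squared modulus of
  the trigonometric polynomial, and a mean is at most the supremum.\<close>

lemma bessel_bound:
  assumes "finite S" "\<And>x. norm (\<Sum>n\<in>S. c n * char n x) \<le> C"
  shows "(\<Sum>n\<in>S. (norm (c n))\<^sup>2) \<le> C\<^sup>2"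
proof -
  define F where "F = (\<lambda>x. \<Sum>n\<in>S. c n * char n x)"
  have "mean (\<lambda>x. F x * cnj (F x)) = mean (\<lambda>x. \<Sum>n\<in>S. \<Sum>m\<in>S. c n * cnj (c m) * char (n - m) x)"
    by (simp add: F_def sum_product char_mult_cnj[symmetric] algebra_simps)
  also have "\<dots> = (\<Sum>n\<in>S. \<Sum>m\<in>S. c n * cnj (c m) * mean (char (n - m)))"
    by (simp add: mean_sum mean_mult_left continuous_intros)
  also have "\<dots> = (\<Sum>n\<in>S. c n * cnj (c n))"
    using assms(1) by (intro sum.cong refl) (simp add: mean_char if_distrib[of "\<lambda>z. _ * z"] cong: if_cong)
  also have "\<dots> = of_real (\<Sum>n\<in>S. (norm (c n))\<^sup>2)"
    by (simp add: complex_norm_square[symmetric])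
  finally have eq: "mean (\<lambda>x. F x * cnj (F x)) = of_real (\<Sum>n\<in>S. (norm (c n))\<^sup>2)" .
  have "norm (mean (\<lambda>x. F x * cnj (F x))) \<le> C\<^sup>2"
    using assms(2) unfolding power2_eq_square
    by (intro mean_norm_le)
      (auto simp: F_def norm_mult complex_mod_cnj simp del: cnj_sum
        intro!: continuous_intros mult_mono order_trans[OF norm_ge_zero])
  then show ?thesis unfolding eq norm_of_real by (simp add: sum_nonneg)
qed

section \<open>Gradients of trigonometric polynomials and weighted norms\<close>

definition grad1 :: "(int \<times> int \<Rightarrow>\<^sub>0 complex) \<Rightarrow> real \<times> real \<Rightarrow> complex" where
  "grad1 a x = pair (\<lambda>n. \<i> * of_int (fst n) * char n x) a"

definition grad2 :: "(int \<times> int \<Rightarrow>\<^sub>0 complex) \<Rightarrow> real \<times> real \<Rightarrow> complex" where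
  "grad2 a x = pair (\<lambda>n. \<i> * of_int (snd n) * char n x) a"

lemma ev_has_derivative1:
  "((\<lambda>t. ev a (t, s)) has_vector_derivative grad1 a (t, s)) (at t)"
proof -
  have "((\<lambda>u. char n (u, s) * c) has_vector_derivative \<i> * of_int (fst n) * char n (t, s) * c) (at t)" for n c
  proof -
    have "((\<lambda>z. exp (\<i> * (of_int (fst n) * z + of_int (snd n) * of_real s)) * c) has_field_derivative \<i> * of_int (fst n) * char n (t, s) * c) (at (of_real t))"
      unfolding char_def cis_conv_exp by (auto intro!: derivative_eq_intros simp: mult_ac)
    then show ?thesis
      using has_vector_derivative_real_field by (fastforce simp: char_def cis_conv_exp)
  qed
  then show ?thesis
    unfolding ev_def grad1_def pair_def by (intro has_vector_derivative_sum)
qed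

lemma ev_has_derivative2:
  "((\<lambda>s. ev a (t, s)) has_vector_derivative grad2 a (t, s)) (at s)"
proof -
  have "((\<lambda>u. char n (t, u) * c) has_vector_derivative \<i> * of_int (snd n) * char n (t, s) * c) (at s)" for n c
  proof -
    have "((\<lambda>z. exp (\<i> * (of_int (fst n) * of_real t + of_int (snd n) * z)) * c) has_field_derivative \<i> * of_int (snd n) * char n (t, s) * c) (at (of_real s))"
      unfolding char_def cis_conv_exp by (auto intro!: derivative_eq_intros simp: mult_ac)
    then show ?thesis
      using has_vector_derivative_real_field by (fastforce simp: char_def cis_conv_exp)
  qed
  then show ?thesis
    unfolding ev_def grad2_def pair_def by (intro has_vector_derivative_sum)
qed

text \<open>Multiplying a coefficient by its position differentiates the trigonometric polynomial,
  so this weight measures one derivative at the length scale \<open>r\<close>.\<close>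

definition weight :: "real \<Rightarrow> int \<times> int \<Rightarrow> real" where
  "weight r n = 1 + ((of_int (fst n))\<^sup>2 + (of_int (snd n))\<^sup>2) / r\<^sup>2"

lemma weight_pos: "weight r n > 0"
  unfolding weight_def by (smt (verit) divide_nonneg_nonneg zero_le_power2 add_nonneg_nonneg)

text \<open>\<open>bessel_bound\<close> applies three times: to the coefficients and to their
  products with each coordinate, which are the coefficients of \<open>grad1\<close> and
  \<open>grad2\<close>. A gradient of size \<open>D * r\<close> loses its factor \<open>r\<close> to
  the denominator of the weight; for \<open>r = 0\<close> that quotient is 0 by convention.\<close>

lemma weighted_bessel:
  assumes "\<And>x. norm (ev a x) \<le> C" "\<And>x. norm (grad1 a x) \<le> D * r" "\<And>x. norm (grad2 a x) \<le> D * r"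
  shows "(\<Sum>n\<in>Poly_Mapping.keys a. weight r n * (norm (Poly_Mapping.lookup a n))\<^sup>2) \<le> C\<^sup>2 + 2 * D\<^sup>2"
proof -
  define c where "c = Poly_Mapping.lookup a"
  define S where "S = Poly_Mapping.keys a"
  have 0: "(\<Sum>n\<in>S. (norm (c n))\<^sup>2) \<le> C\<^sup>2"
    using assms(1) by (intro bessel_bound) (auto simp: ev_def pair_def S_def c_def mult.commute)
  have 1: "(\<Sum>n\<in>S. (norm (\<i> * of_int (fst n) * c n))\<^sup>2) \<le> (D * r)\<^sup>2"
    using assms(2) by (intro bessel_bound) (auto simp: grad1_def pair_def S_def c_def mult_ac)
  have 2: "(\<Sum>n\<in>S. (norm (\<i> * of_int (snd n) * c n))\<^sup>2) \<le> (D * r)\<^sup>2"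
    using assms(3) by (intro bessel_bound) (auto simp: grad2_def pair_def S_def c_def mult_ac)
  have "(\<Sum>n\<in>S. weight r n * (norm (c n))\<^sup>2) =
      (\<Sum>n\<in>S. (norm (c n))\<^sup>2) + ((\<Sum>n\<in>S. (norm (\<i> * of_int (fst n) * c n))\<^sup>2)
        + (\<Sum>n\<in>S. (norm (\<i> * of_int (snd n) * c n))\<^sup>2)) / r\<^sup>2"
  proof -
    have "weight r n * (norm (c n))\<^sup>2 = (norm (c n))\<^sup>2 + ((norm (\<i> * of_int (fst n) * c n))\<^sup>2
        + (norm (\<i> * of_int (snd n) * c n))\<^sup>2) / r\<^sup>2" for n
      by (simp add: weight_def norm_mult power_mult_distrib distrib_right)
    then show ?thesis
      by (simp only: sum.distrib sum_divide_distrib add_divide_distrib)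
  qed
  also have "\<dots> \<le> C\<^sup>2 + ((D * r)\<^sup>2 + (D * r)\<^sup>2) / r\<^sup>2"
    using 0 1 2 by (intro add_mono divide_right_mono) auto
  also have "\<dots> \<le> C\<^sup>2 + 2 * D\<^sup>2"
    by (cases "r = 0") (auto simp: power_mult_distrib)
  finally show ?thesis by (simp add: S_def c_def)
qed

lemma pair_Cauchy_Schwarz:
  "(norm (pair y a))\<^sup>2 \<le> (\<Sum>n\<in>Poly_Mapping.keys a. (norm (y n))\<^sup>2 / weight r n) *
     (\<Sum>n\<in>Poly_Mapping.keys a. weight r n * (norm (Poly_Mapping.lookup a n))\<^sup>2)"
proof -
  define S where "S = Poly_Mapping.keys a"
  define w where "w n = sqrt (weight r n)" for n
  have w: "w n > 0" "(w n)\<^sup>2 = weight r n" for n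
    using weight_pos[of r n] by (auto simp: w_def)
  have "norm (pair y a) \<le> (\<Sum>n\<in>S. (norm (y n) / w n) * (w n * norm (Poly_Mapping.lookup a n)))"
    unfolding pair_def S_def[symmetric]
    using w(1) by (intro sum_norm_le) (simp add: norm_mult less_imp_neq[symmetric])
  then have "(norm (pair y a))\<^sup>2 \<le> (\<Sum>n\<in>S. (norm (y n) / w n) * (w n * norm (Poly_Mapping.lookup a n)))\<^sup>2"
    by (intro power_mono) auto
  also have "\<dots> \<le> (\<Sum>n\<in>S. (norm (y n) / w n)\<^sup>2) * (\<Sum>n\<in>S. (w n * norm (Poly_Mapping.lookup a n))\<^sup>2)"
    by (rule Cauchy_Schwarz_ineq_sum)
  finally show ?thesis
    by (simp add: power_divide power_mult_distrib w S_def)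
qed

text \<open>The weight compensates the growth \<open>O(k)\<close> of the derivatives for \<open>k\<close> of order \<open>R\<close>.\<close>

definition half_small :: "(nat \<Rightarrow> int \<times> int \<Rightarrow> complex) \<Rightarrow> bool" where
  "half_small y \<longleftrightarrow> (\<forall>\<epsilon>>0. \<exists>R0. \<forall>R\<ge>R0. \<forall>F. finite F \<longrightarrow>
     (\<Sum>k\<in>{R..2 * R}. \<Sum>n\<in>F. (norm (y k n))\<^sup>2 / weight (real R) n) \<le> \<epsilon> * real R)"

section \<open>The scalar recurrence with functional initial data and its stability\<close>

fun frec :: "(real \<Rightarrow> complex) \<Rightarrow> (real \<Rightarrow> complex) \<Rightarrow> nat \<Rightarrow> real \<Rightarrow> complex" where
  "frec f0 f1 0 t = f0 t"
| "frec f0 f1 (Suc 0) t = f1 t"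
| "frec f0 f1 (Suc (Suc k)) t = of_real t * frec f0 f1 (Suc k) t - frec f0 f1 k t"

text \<open>The recurrence of \<open>frec\<close> differentiated in \<open>t\<close>, with
  \<open>g0\<close> and \<open>g1\<close> in the place of the derivatives of \<open>f0\<close> and
  \<open>f1\<close>.\<close>

fun drec :: "(real \<Rightarrow> complex) \<Rightarrow> (real \<Rightarrow> complex) \<Rightarrow> (real \<Rightarrow> complex) \<Rightarrow> (real \<Rightarrow> complex)
    \<Rightarrow> nat \<Rightarrow> real \<Rightarrow> complex" where
  "drec f0 f1 g0 g1 0 t = g0 t"
| "drec f0 f1 g0 g1 (Suc 0) t = g1 t"
| "drec f0 f1 g0 g1 (Suc (Suc k)) t =
     frec f0 f1 (Suc k) t + of_real t * drec f0 f1 g0 g1 (Suc k) t - drec f0 f1 g0 g1 k t"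

lemma frec_has_derivative:
  assumes "(f0 has_vector_derivative g0 t) (at t)" "(f1 has_vector_derivative g1 t) (at t)"
  shows "(frec f0 f1 k has_vector_derivative drec f0 f1 g0 g1 k t) (at t)"
proof (induction k rule: induct_nat_012)
  case 0
  have "frec f0 f1 0 = f0" by auto
  then show ?case using assms by simp
next
  case 1
  have "frec f0 f1 (Suc 0) = f1" by auto
  then show ?case using assms by simp
next
  case (ge2 k)
  have eq: "frec f0 f1 (Suc (Suc k)) = (\<lambda>t. of_real t * frec f0 f1 (Suc k) t - frec f0 f1 k t)"
    by auto
  have "((\<lambda>t. of_real t * frec f0 f1 (Suc k) t - frec f0 f1 k t) has_vector_derivative
      (of_real t * drec f0 f1 g0 g1 (Suc k) t + of_real 1 * frec f0 f1 (Suc k) t) - drec f0 f1 g0 g1 k t) (at t)"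
    by (intro has_vector_derivative_diff has_vector_derivative_mult has_vector_derivative_of_real DERIV_ident ge2)
  then show ?case by (simp add: eq algebra_simps)
qed

text \<open>The error solves the same linear recurrence and grows by a factor of at most
  \<open>r + 2\<close> per step. Exponential growth is harmless, because the tolerance is fixed only
  after the number of steps.\<close>

lemma frec_close:
  fixes t r \<delta> :: real
  assumes t: "\<bar>t\<bar> \<le> r"
    and Z: "\<And>k. Z (Suc (Suc k)) = of_real t * Z (Suc k) - Z k"
    and "norm (f0 t - Z 0) \<le> \<delta>" "norm (f1 t - Z 1) \<le> \<delta>"
  shows "norm (frec f0 f1 k t - Z k) \<le> \<delta> * (r + 2) ^ k"
proof (induction k rule: induct_nat_012)
  case 0
  then show ?case using assms(3,4) by simp
next
  case 1
  have "0 \<le> \<delta>" using assms(3) norm_ge_zero order_trans by blast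
  then have "\<delta> * 1 \<le> \<delta> * (r + 2)" using t by (intro mult_left_mono) auto
  then show ?case using assms(3,4) by simp
next
  case (ge2 k)
  have \<delta>: "0 \<le> \<delta>" using assms(3) norm_ge_zero order_trans by blast
  have "frec f0 f1 (Suc (Suc k)) t - Z (Suc (Suc k)) =
      of_real t * (frec f0 f1 (Suc k) t - Z (Suc k)) - (frec f0 f1 k t - Z k)"
    by (simp add: Z algebra_simps)
  also have "norm \<dots> \<le> \<bar>t\<bar> * norm (frec f0 f1 (Suc k) t - Z (Suc k)) + norm (frec f0 f1 k t - Z k)"
    by (rule order_trans[OF norm_triangle_ineq4]) (simp add: norm_mult)
  also have "\<dots> \<le> r * (\<delta> * (r + 2) ^ Suc k) + \<delta> * (r + 2) ^ k"
    using t ge2 by (intro add_mono mult_mono) simp_all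
  also have "\<dots> \<le> r * (\<delta> * (r + 2) ^ Suc k) + 2 * (\<delta> * (r + 2) ^ Suc k)"
  proof -
    have "\<delta> * (r + 2) ^ k * 1 \<le> \<delta> * (r + 2) ^ k * (2 * (r + 2))"
      using \<delta> t by (intro mult_left_mono mult_nonneg_nonneg zero_le_power) auto
    then show ?thesis by (simp add: algebra_simps)
  qed
  finally show ?case by (simp add: algebra_simps)
qed

text \<open>The error of \<open>frec\<close> now acts as a source. The base \<open>r + 2\<close>
  leaves room for the factor \<open>r\<close> of the middle term, one unit for the source and one
  for the older term.\<close>

lemma drec_close:
  fixes t r \<delta> :: real
  assumes t: "\<bar>t\<bar> \<le> r"
    and Z: "\<And>k. Z (Suc (Suc k)) = of_real t * Z (Suc k) - Z k"
    and Z': "\<And>k. Z' (Suc (Suc k)) = Z (Suc k) + of_real t * Z' (Suc k) - Z' k"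
    and f: "norm (f0 t - Z 0) \<le> \<delta>" "norm (f1 t - Z 1) \<le> \<delta>"
    and g: "norm (g0 t - Z' 0) \<le> \<delta>" "norm (g1 t - Z' 1) \<le> \<delta>"
  shows "norm (drec f0 f1 g0 g1 k t - Z' k) \<le> \<delta> * (r + 2) ^ k"
proof (induction k rule: induct_nat_012)
  case 0
  then show ?case using g by simp
next
  case 1
  have "0 \<le> \<delta>" using f(1) norm_ge_zero order_trans by blast
  then have "\<delta> * 1 \<le> \<delta> * (r + 2)" using t by (intro mult_left_mono) auto
  then show ?case using g by simp
next
  case (ge2 k)
  have \<delta>: "0 \<le> \<delta>" using f(1) norm_ge_zero order_trans by blast
  have eq: "drec f0 f1 g0 g1 (Suc (Suc k)) t - Z' (Suc (Suc k)) =
      (frec f0 f1 (Suc k) t - Z (Suc k)) +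
      of_real t * (drec f0 f1 g0 g1 (Suc k) t - Z' (Suc k)) - (drec f0 f1 g0 g1 k t - Z' k)"
    by (simp add: Z' algebra_simps)
  have "norm (drec f0 f1 g0 g1 (Suc (Suc k)) t - Z' (Suc (Suc k))) \<le> norm (frec f0 f1 (Suc k) t - Z (Suc k)) +
      \<bar>t\<bar> * norm (drec f0 f1 g0 g1 (Suc k) t - Z' (Suc k)) + norm (drec f0 f1 g0 g1 k t - Z' k)"
  proof -
    have tri: "norm (a + b - c) \<le> norm a + norm b + norm c" for a b c :: complex
      using norm_triangle_ineq4[of "a + b" c] norm_triangle_ineq[of a b] by linarith
    show ?thesis
      unfolding eq by (rule order_trans[OF tri]) (simp only: norm_mult norm_of_real order_refl)
  qed
  also have "\<dots> \<le> \<delta> * (r + 2) ^ Suc k + r * (\<delta> * (r + 2) ^ Suc k) + \<delta> * (r + 2) ^ k"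
  proof -
    have "norm (frec f0 f1 (Suc k) t - Z (Suc k)) \<le> \<delta> * (r + 2) ^ Suc k"
      by (rule frec_close[where Z = Z]) (use t Z f in auto)
    moreover have "\<bar>t\<bar> * norm (drec f0 f1 g0 g1 (Suc k) t - Z' (Suc k)) \<le> r * (\<delta> * (r + 2) ^ Suc k)"
      by (rule mult_mono[OF t ge2(2)]) (use t in auto)
    ultimately show ?thesis
      using ge2(1) by linarith
  qed
  also have "\<dots> \<le> \<delta> * (r + 2) ^ Suc k + r * (\<delta> * (r + 2) ^ Suc k) + \<delta> * (r + 2) ^ Suc k"
  proof -
    have "\<delta> * (r + 2) ^ k * 1 \<le> \<delta> * (r + 2) ^ k * (r + 2)"
      using \<delta> t by (intro mult_left_mono mult_nonneg_nonneg zero_le_power) auto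
    then show ?thesis by (simp add: algebra_simps)
  qed
  finally show ?case by (simp add: algebra_simps)
qed

lemma ev_grad_bounded:
  obtains A where "A > 0" "\<And>x. norm (ev a x) \<le> A" "\<And>x. norm (grad1 a x) \<le> A" "\<And>x. norm (grad2 a x) \<le> A"
proof -
  define A where "A = 1 + (\<Sum>n\<in>Poly_Mapping.keys a.
    (1 + \<bar>of_int (fst n)\<bar> + \<bar>of_int (snd n)\<bar>) * norm (Poly_Mapping.lookup a n))"
  have *: "norm (pair (\<lambda>n. w n * char n x) a) \<le> A"
    if w: "\<And>n. norm (w n) \<le> 1 + \<bar>of_int (fst n)\<bar> + \<bar>of_int (snd n)\<bar>" for w x
  proof -
    have "norm (pair (\<lambda>n. w n * char n x) a) \<le> (\<Sum>n\<in>Poly_Mapping.keys a.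
      (1 + \<bar>of_int (fst n)\<bar> + \<bar>of_int (snd n)\<bar>) * norm (Poly_Mapping.lookup a n))"
      unfolding pair_def using w by (intro sum_norm_le) (simp add: norm_mult mult_right_mono)
    then show ?thesis by (simp add: A_def)
  qed
  show thesis
  proof (rule that[of A])
    show "A > 0" unfolding A_def by (intro add_pos_nonneg sum_nonneg) auto
    show "norm (ev a x) \<le> A" for x
      using *[of "\<lambda>_. 1" x] by (simp add: ev_def)
    show "norm (grad1 a x) \<le> A" for x
      using *[of "\<lambda>n. \<i> * of_int (fst n)" x] by (simp add: grad1_def norm_mult)
    show "norm (grad2 a x) \<le> A" for x
      using *[of "\<lambda>n. \<i> * of_int (snd n)" x] by (simp add: grad2_def norm_mult)
  qed
qed

section \<open>Wronskians with solutions given by functional calculus\<close>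

text \<open>The planar operator H of the time recurrence. It appears as \<open>hop\<close> on
  arbitrary sequences, as multiplication by \<open>symp\<close> on finitely supported ones, and as
  the multiplier \<open>symb\<close> on the torus.\<close>

locale lattice_symbol =
  fixes E p q :: real
begin

definition symb :: "real \<times> real \<Rightarrow> real" where
  "symb x = E - 2 * p * cos (fst x) - 2 * q * cos (snd x)"

definition symp :: "int \<times> int \<Rightarrow>\<^sub>0 complex" where
  "symp = Poly_Mapping.single 0 (of_real E)
     + (Poly_Mapping.single (1, 0) (- of_real p) + Poly_Mapping.single (-1, 0) (- of_real p))
     + (Poly_Mapping.single (0, 1) (- of_real q) + Poly_Mapping.single (0, -1) (- of_real q))"

definition hop :: "(int \<times> int \<Rightarrow> complex) \<Rightarrow> int \<times> int \<Rightarrow> complex" where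
  "hop y n = of_real E * y n - of_real p * (y ((1, 0) + n) + y ((-1, 0) + n))
     - of_real q * (y ((0, 1) + n) + y ((0, -1) + n))"

definition sbound :: real where
  "sbound = \<bar>E\<bar> + 2 * \<bar>p\<bar> + 2 * \<bar>q\<bar>"

lemma symb_bound: "\<bar>symb x\<bar> \<le> sbound"
proof -
  have "\<bar>p * cos (fst x)\<bar> \<le> \<bar>p\<bar>" "\<bar>q * cos (snd x)\<bar> \<le> \<bar>q\<bar>"
    by (auto simp: abs_mult mult_left_le)
  then show ?thesis by (simp add: symb_def sbound_def)
qed

lemma pair_symp: "pair y (symp * a) = pair (hop y) a"
proof -
  have "pair (hop y) a = pair (\<lambda>n. of_real E * y (0 + n) - of_real p * (y ((1, 0) + n) + y ((-1, 0) + n))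
     - of_real q * (y ((0, 1) + n) + y ((0, -1) + n))) a"
    by (simp add: hop_def[abs_def])
  then show ?thesis
    by (simp only: pair_diff_left pair_mult_left pair_add_left symp_def distrib_right pair_add_right
        pair_single_times) (simp add: algebra_simps)
qed

lemma ev_symp: "ev symp x = of_real (symb x)"
  by (simp add: symp_def ev_add ev_single symb_def char_def complex_eq_iff algebra_simps)

lemma ev_symp_mult: "ev (symp * a) x = of_real (symb x) * ev a x"
  by (simp add: ev_mult ev_symp)

fun zrec :: "(int \<times> int \<Rightarrow>\<^sub>0 complex) \<Rightarrow> (int \<times> int \<Rightarrow>\<^sub>0 complex) \<Rightarrow> nat \<Rightarrow> (int \<times> int \<Rightarrow>\<^sub>0 complex)" where
  "zrec z0 z1 0 = z0"
| "zrec z0 z1 (Suc 0) = z1"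
| "zrec z0 z1 (Suc (Suc k)) = symp * zrec z0 z1 (Suc k) - zrec z0 z1 k"

text \<open>Under \<open>pair\<close> the operator passes from one factor to the other, so that the
  two recurrences cancel from one time to the next.\<close>

lemma wronskian:
  assumes "\<And>k n. y (Suc (Suc k)) n + y k n = hop (y (Suc k)) n"
  shows "pair (y k) (zrec z0 z1 (Suc k)) - pair (y (Suc k)) (zrec z0 z1 k) = pair (y 0) z1 - pair (y 1) z0"
proof (induction k)
  case (Suc k)
  have "hop (y (Suc k)) = (\<lambda>n. y (Suc (Suc k)) n + y k n)"
    using assms by auto
  then have "pair (y (Suc k)) (symp * zrec z0 z1 (Suc k)) =
      pair (y (Suc (Suc k))) (zrec z0 z1 (Suc k)) + pair (y k) (zrec z0 z1 (Suc k))"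
    by (simp add: pair_symp pair_add_left)
  then show ?case
    using Suc by (simp add: pair_diff_right)
qed simp

lemma ev_zrec:
  assumes "\<And>x. ev z0 x = f0 (symb x) * ev a x" "\<And>x. ev z1 x = f1 (symb x) * ev a x"
  shows "ev (zrec z0 z1 k) x = frec f0 f1 k (symb x) * ev a x"
  by (induction k rule: induct_nat_012) (simp_all add: assms ev_diff ev_symp_mult algebra_simps)

lemma grad_composite:
  assumes z: "\<And>x. ev z x = f (symb x) * ev a x"
    and f: "\<And>t. \<bar>t\<bar> \<le> sbound \<Longrightarrow> (f has_vector_derivative f' t) (at t)"
  shows "grad1 z x = f' (symb x) * of_real (2 * p * sin (fst x)) * ev a x + f (symb x) * grad1 a x"
    and "grad2 z x = f' (symb x) * of_real (2 * q * sin (snd x)) * ev a x + f (symb x) * grad2 a x"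
proof -
  obtain t s where x: "x = (t, s)" by (cases x)
  note f = f[OF symb_bound]
  have "((\<lambda>t. symb (t, s)) has_vector_derivative 2 * p * sin t) (at t)"
    unfolding symb_def has_real_derivative_iff_has_vector_derivative[symmetric]
    by (auto intro!: derivative_eq_intros)
  from vector_diff_chain_at[OF this f]
  have "((\<lambda>t. f (symb (t, s))) has_vector_derivative (2 * p * sin t) *\<^sub>R f' (symb (t, s))) (at t)"
    by (simp add: o_def)
  from has_vector_derivative_mult[OF this ev_has_derivative1[of a s t]]
  have "((\<lambda>t. ev z (t, s)) has_vector_derivative
      f (symb x) * grad1 a x + (2 * p * sin t) *\<^sub>R f' (symb x) * ev a x) (at t)"
    by (simp add: z x)
  from vector_derivative_unique_at[OF ev_has_derivative1[of z s t] this]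
  show "grad1 z x = f' (symb x) * of_real (2 * p * sin (fst x)) * ev a x + f (symb x) * grad1 a x"
    by (simp add: x scaleR_conv_of_real algebra_simps)
  have "((\<lambda>s. symb (t, s)) has_vector_derivative 2 * q * sin s) (at s)"
    unfolding symb_def has_real_derivative_iff_has_vector_derivative[symmetric]
    by (auto intro!: derivative_eq_intros)
  from vector_diff_chain_at[OF this f]
  have "((\<lambda>s. f (symb (t, s))) has_vector_derivative (2 * q * sin s) *\<^sub>R f' (symb (t, s))) (at s)"
    by (simp add: o_def)
  from has_vector_derivative_mult[OF this ev_has_derivative2[of a t s]]
  have "((\<lambda>s. ev z (t, s)) has_vector_derivative
      f (symb x) * grad2 a x + (2 * q * sin s) *\<^sub>R f' (symb x) * ev a x) (at s)"
    by (simp add: z x)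
  from vector_derivative_unique_at[OF ev_has_derivative2[of z t s] this]
  show "grad2 z x = f' (symb x) * of_real (2 * q * sin (snd x)) * ev a x + f (symb x) * grad2 a x"
    by (simp add: x scaleR_conv_of_real algebra_simps)
qed

end

context lattice_symbol
begin

definition C1_near :: "(real \<Rightarrow> complex) \<Rightarrow> (real \<Rightarrow> complex) \<Rightarrow> real \<Rightarrow> (real \<Rightarrow> complex) \<Rightarrow> (real \<Rightarrow> complex) \<Rightarrow> bool" where
  "C1_near F F' \<delta> f g \<longleftrightarrow> (\<forall>t. \<bar>t\<bar> \<le> sbound \<longrightarrow>
     (f has_vector_derivative g t) (at t) \<and> norm (f t - F t) \<le> \<delta> \<and> norm (g t - F' t) \<le> \<delta>)"

text \<open>The difference of pairings is the Wronskian at time 0. Quantifying over all data that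
  are \<open>C1_near\<close> the wanted ones lets one approximating polynomial serve two half lines,
  with the smaller of two tolerances.\<close>

definition pairing_bound ::
  "(int \<times> int \<Rightarrow> complex) \<Rightarrow> (int \<times> int \<Rightarrow> complex) \<Rightarrow> (int \<times> int \<Rightarrow>\<^sub>0 complex) \<Rightarrow> (real \<Rightarrow> complex) \<Rightarrow> (real \<Rightarrow> complex)
    \<Rightarrow> (real \<Rightarrow> complex) \<Rightarrow> (real \<Rightarrow> complex) \<Rightarrow> real \<Rightarrow> real \<Rightarrow> bool" where
  "pairing_bound u0 u1 a F0 F0' F1 F1' \<delta> \<epsilon> \<longleftrightarrow> (\<forall>z0 z1 f0 f1 g0 g1.
      (\<forall>x. ev z0 x = f0 (symb x) * ev a x) \<and> (\<forall>x. ev z1 x = f1 (symb x) * ev a x) \<and>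
      C1_near F0 F0' \<delta> f0 g0 \<and> C1_near F1 F1' \<delta> f1 g1
      \<longrightarrow> norm (pair u0 z1 - pair u1 z0) \<le> \<epsilon>)"

lemma pairing_boundD:
  assumes "pairing_bound u0 u1 a F0 F0' F1 F1' \<delta> \<epsilon>"
    and "\<And>x. ev z0 x = f0 (symb x) * ev a x" "\<And>x. ev z1 x = f1 (symb x) * ev a x"
    and "C1_near F0 F0' \<delta> f0 g0" "C1_near F1 F1' \<delta> f1 g1"
  shows "norm (pair u0 z1 - pair u1 z0) \<le> \<epsilon>"
  using assms unfolding pairing_bound_def by meson

text \<open>The functions \<open>Z\<^sub>k\<close> need not be polynomials, so \<open>Z\<^sub>k(H) a\<close> need not be finitely supported.
  The tolerance \<open>\<delta>\<close> allows to replace them by polynomials that are close in the \<open>C\<^sup>1\<close> norm.\<close>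

lemma half_line_pairing_small:
  fixes y :: "nat \<Rightarrow> int \<times> int \<Rightarrow> complex" and Z Z' :: "nat \<Rightarrow> real \<Rightarrow> complex"
  assumes y: "\<And>k n. y (Suc (Suc k)) n + y k n = hop (y (Suc k)) n"
    and small: "half_small y"
    and Z: "\<And>k t. \<bar>t\<bar> \<le> sbound \<Longrightarrow> Z (Suc (Suc k)) t = of_real t * Z (Suc k) t - Z k t"
    and Z': "\<And>k t. \<bar>t\<bar> \<le> sbound \<Longrightarrow> Z' (Suc (Suc k)) t = Z (Suc k) t + of_real t * Z' (Suc k) t - Z' k t"
    and ZC: "\<And>k t. \<bar>t\<bar> \<le> sbound \<Longrightarrow> norm (Z k t) \<le> C"
    and Z'C: "\<And>k t. \<bar>t\<bar> \<le> sbound \<Longrightarrow> norm (Z' k t) \<le> C * (1 + real k)"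
    and "\<epsilon> > 0"
  shows "\<exists>\<delta>>0. pairing_bound (y 0) (y 1) a (Z 0) (Z' 0) (Z 1) (Z' 1) \<delta> \<epsilon>"
proof -
  obtain A where A: "A > 0" "\<And>x. norm (ev a x) \<le> A" "\<And>x. norm (grad1 a x) \<le> A" "\<And>x. norm (grad2 a x) \<le> A"
    using ev_grad_bounded by blast
  have sb: "sbound \<ge> 0" by (simp add: sbound_def)
  have "C \<ge> 0" using order_trans[OF norm_ge_zero ZC[of 0 0]] sb by simp
  \<comment> \<open>For times up to \<open>2 * R\<close>, \<open>B\<close> will bound the transform
    of the test solution, \<open>D * real R\<close> its gradient, and \<open>M\<close> the weighted
    norm given by \<open>weighted_bessel\<close>. In \<open>D\<close> the factor
    \<open>2 * \<bar>p\<bar> + 2 * \<bar>q\<bar>\<close> bounds the gradient of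
    \<open>symb\<close>.\<close>
  define B where "B = (C + 1) * A"
  define D where "D = B * (4 * (2 * \<bar>p\<bar> + 2 * \<bar>q\<bar>) + 1)"
  define M where "M = B\<^sup>2 + 2 * D\<^sup>2"
  have "B > 0" using \<open>C \<ge> 0\<close> A(1) by (simp add: B_def)
  then have "M > 0" unfolding M_def by (intro add_pos_nonneg) auto
  \<comment> \<open>Chosen so that the final estimate
    \<open>2 * M * (\<epsilon>' * R + \<epsilon>' * R)\<close> equals
    \<open>R * \<epsilon>\<^sup>2\<close>.\<close>
  define \<epsilon>' where "\<epsilon>' = \<epsilon>\<^sup>2 / (4 * M)"
  have "\<epsilon>' > 0" using \<open>\<epsilon> > 0\<close> \<open>M > 0\<close> by (simp add: \<epsilon>'_def)
  then obtain R0 where R0: "\<And>R F. R \<ge> R0 \<Longrightarrow> finite F \<Longrightarrow>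
     (\<Sum>k\<in>{R..2 * R}. \<Sum>n\<in>F. (norm (y k n))\<^sup>2 / weight (real R) n) \<le> \<epsilon>' * real R"
    using small unfolding half_small_def by blast
  define R where "R = max R0 1"
  have R: "R \<ge> R0" "R \<ge> 1" by (auto simp: R_def)
  \<comment> \<open>The reciprocal of the largest error growth over \<open>2 * R\<close> steps: all
    errors in the window stay below 1.\<close>
  define \<delta> where "\<delta> = 1 / (sbound + 2) ^ (2 * R)"
  have "\<delta> > 0" using sb by (simp add: \<delta>_def)
  have \<delta>k: "\<delta> * (sbound + 2) ^ k \<le> 1" if "k \<le> 2 * R" for k
    using that sb by (simp add: \<delta>_def divide_le_eq_1 power_increasing)
  show ?thesis
    unfolding pairing_bound_def
  proof (intro exI[of _ \<delta>] conjI allI impI \<open>\<delta> > 0\<close>)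
    fix z0 z1 f0 f1 g0 g1
    assume *: "(\<forall>x. ev z0 x = f0 (symb x) * ev a x) \<and> (\<forall>x. ev z1 x = f1 (symb x) * ev a x) \<and>
      C1_near (Z 0) (Z' 0) \<delta> f0 g0 \<and> C1_near (Z 1) (Z' 1) \<delta> f1 g1"
    then have ev: "\<And>x. ev z0 x = f0 (symb x) * ev a x" "\<And>x. ev z1 x = f1 (symb x) * ev a x"
      by auto
    have der: "\<And>t. \<bar>t\<bar> \<le> sbound \<Longrightarrow> (f0 has_vector_derivative g0 t) (at t)"
       "\<And>t. \<bar>t\<bar> \<le> sbound \<Longrightarrow> (f1 has_vector_derivative g1 t) (at t)"
      and close: "\<And>t. \<bar>t\<bar> \<le> sbound \<Longrightarrow> norm (f0 t - Z 0 t) \<le> \<delta>"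
       "\<And>t. \<bar>t\<bar> \<le> sbound \<Longrightarrow> norm (f1 t - Z 1 t) \<le> \<delta>"
       "\<And>t. \<bar>t\<bar> \<le> sbound \<Longrightarrow> norm (g0 t - Z' 0 t) \<le> \<delta>"
       "\<And>t. \<bar>t\<bar> \<le> sbound \<Longrightarrow> norm (g1 t - Z' 1 t) \<le> \<delta>"
      using * by (auto simp: C1_near_def)
    define W where "W = pair (y 0) z1 - pair (y 1) z0"
    define z where "z = zrec z0 z1"
    \<comment> \<open>One finite set that contains the supports of all test sequences in the window,
      as \<open>half_small\<close> speaks of finite sets only.\<close>
    define F where "F = (\<Union>k\<in>{..2 * R}. Poly_Mapping.keys (z k))"
    have "finite F" by (simp add: F_def)
    define \<omega> where "\<omega> k = (\<Sum>n\<in>F. (norm (y k n))\<^sup>2 / weight (real R) n)" for k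
    have \<omega>_nonneg: "\<omega> k \<ge> 0" for k
      unfolding \<omega>_def using weight_pos by (intro sum_nonneg divide_nonneg_nonneg) (auto intro: less_imp_le)
    have fB: "norm (frec f0 f1 k t) \<le> C + 1" if "k \<le> 2 * R" "\<bar>t\<bar> \<le> sbound" for k t
    proof -
      have "norm (frec f0 f1 k t - Z k t) \<le> \<delta> * (sbound + 2) ^ k"
        by (rule frec_close[where Z = "\<lambda>k. Z k t"]) (use that Z close in auto)
      with \<delta>k[OF that(1)] ZC[OF that(2), of k] show ?thesis
        using norm_triangle_sub[of "frec f0 f1 k t" "Z k t"] by linarith
    qed
    have dB: "norm (drec f0 f1 g0 g1 k t) \<le> (C + 1) * (4 * real R)" if "k \<le> 2 * R" "\<bar>t\<bar> \<le> sbound" for k t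
    proof -
      have "norm (drec f0 f1 g0 g1 k t - Z' k t) \<le> \<delta> * (sbound + 2) ^ k"
        by (rule drec_close[where Z = "\<lambda>k. Z k t" and Z' = "\<lambda>k. Z' k t"]) (use that Z Z' close in auto)
      with \<delta>k[OF that(1)] Z'C[OF that(2), of k]
      have "norm (drec f0 f1 g0 g1 k t) \<le> C * (1 + real k) + 1"
        using norm_triangle_sub[of "drec f0 f1 g0 g1 k t" "Z' k t"] by linarith
      also have "\<dots> \<le> C * (4 * real R) + 4 * real R"
        using that(1) R(2) \<open>C \<ge> 0\<close> by (intro add_mono mult_left_mono) linarith+
      finally show ?thesis by (simp add: algebra_simps)
    qed
    have N: "(\<Sum>n\<in>Poly_Mapping.keys (z k). weight (real R) n * (norm (Poly_Mapping.lookup (z k) n))\<^sup>2) \<le> M"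
      if k: "k \<le> 2 * R" for k
      unfolding M_def
    proof (rule weighted_bessel)
      fix x
      have evz: "ev (z k) x = frec f0 f1 k (symb x) * ev a x" for x
        unfolding z_def by (rule ev_zrec[OF ev])
      have f: "norm (frec f0 f1 k (symb x)) \<le> C + 1" "norm (drec f0 f1 g0 g1 k (symb x)) \<le> (C + 1) * (4 * real R)"
        using fB[OF k symb_bound] dB[OF k symb_bound] by auto
      show "norm (ev (z k) x) \<le> B"
        unfolding evz B_def norm_mult using f A(2)[of x] \<open>C \<ge> 0\<close> by (intro mult_mono) auto
      have gr: "norm (drec f0 f1 g0 g1 k (symb x) * of_real (2 * c * w) * ev a x + frec f0 f1 k (symb x) * G) \<le> D * real R"
        if "norm G \<le> A" "\<bar>w\<bar> \<le> 1" "\<bar>c\<bar> \<le> \<bar>p\<bar> + \<bar>q\<bar>" for G w c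
      proof -
        have "\<bar>c\<bar> * \<bar>w\<bar> \<le> (\<bar>p\<bar> + \<bar>q\<bar>) * 1"
          using that by (intro mult_mono) auto
        then have "norm (of_real (2 * c * w) :: complex) \<le> 2 * \<bar>p\<bar> + 2 * \<bar>q\<bar>"
          by (simp only: norm_of_real abs_mult) simp
        then have "norm (drec f0 f1 g0 g1 k (symb x) * of_real (2 * c * w) * ev a x) \<le>
            (C + 1) * (4 * real R) * (2 * \<bar>p\<bar> + 2 * \<bar>q\<bar>) * A"
          unfolding norm_mult using f A(2)[of x] \<open>C \<ge> 0\<close> by (intro mult_mono) auto
        moreover have "norm (frec f0 f1 k (symb x) * G) \<le> (C + 1) * A"
          unfolding norm_mult using f that \<open>C \<ge> 0\<close> by (intro mult_mono) auto
        moreover have "(C + 1) * A * 1 \<le> (C + 1) * A * real R"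
          using R(2) A(1) \<open>C \<ge> 0\<close> by (intro mult_left_mono) auto
        ultimately have "norm (drec f0 f1 g0 g1 k (symb x) * of_real (2 * c * w) * ev a x + frec f0 f1 k (symb x) * G)
            \<le> (C + 1) * (4 * real R) * (2 * \<bar>p\<bar> + 2 * \<bar>q\<bar>) * A + (C + 1) * A * real R"
          by (intro norm_triangle_le) linarith
        then show ?thesis by (simp add: D_def B_def algebra_simps)
      qed
      have fd: "(frec f0 f1 k has_vector_derivative drec f0 f1 g0 g1 k t) (at t)" if "\<bar>t\<bar> \<le> sbound" for t
        using der that by (intro frec_has_derivative)
      note gc = grad_composite[where f = "frec f0 f1 k" and f' = "drec f0 f1 g0 g1 k" and a = a and z = "z k" and x = x]
      show "norm (grad1 (z k) x) \<le> D * real R"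
        by (subst gc(1)[OF evz fd], assumption, rule gr) (auto intro: A)
      show "norm (grad2 (z k) x) \<le> D * real R"
        by (subst gc(2)[OF evz fd], assumption, rule gr) (auto intro: A)
    qed
    have pb: "(norm (pair (y j) (z k)))\<^sup>2 \<le> \<omega> j * M" if "k \<le> 2 * R" for j k
    proof -
      have "(norm (pair (y j) (z k)))\<^sup>2 \<le> (\<Sum>n\<in>Poly_Mapping.keys (z k). (norm (y j n))\<^sup>2 / weight (real R) n) *
         (\<Sum>n\<in>Poly_Mapping.keys (z k). weight (real R) n * (norm (Poly_Mapping.lookup (z k) n))\<^sup>2)"
        by (rule pair_Cauchy_Schwarz)
      also have "\<dots> \<le> \<omega> j * M"
      proof (rule mult_mono[OF _ N[OF that] \<omega>_nonneg])
        show "(\<Sum>n\<in>Poly_Mapping.keys (z k). (norm (y j n))\<^sup>2 / weight (real R) n) \<le> \<omega> j"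
          unfolding \<omega>_def using that \<open>finite F\<close>
          by (intro sum_mono2) (auto simp: F_def intro!: divide_nonneg_nonneg less_imp_le[OF weight_pos])
        show "0 \<le> (\<Sum>n\<in>Poly_Mapping.keys (z k). weight (real R) n * (norm (Poly_Mapping.lookup (z k) n))\<^sup>2)"
          by (auto intro!: sum_nonneg mult_nonneg_nonneg less_imp_le[OF weight_pos])
      qed
      finally show ?thesis .
    qed
    have Wk: "(norm W)\<^sup>2 \<le> 2 * M * (\<omega> k + \<omega> (Suc k))" if "k < 2 * R" for k
    proof -
      have "norm W \<le> norm (pair (y k) (z (Suc k))) + norm (pair (y (Suc k)) (z k))"
        unfolding W_def z_def wronskian[where y = y, OF y, of k, symmetric] by (rule norm_triangle_ineq4)
      then have "(norm W)\<^sup>2 \<le> (norm (pair (y k) (z (Suc k))) + norm (pair (y (Suc k)) (z k)))\<^sup>2"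
        by (intro power_mono) auto
      also have "\<dots> \<le> 2 * (norm (pair (y k) (z (Suc k))))\<^sup>2 + 2 * (norm (pair (y (Suc k)) (z k)))\<^sup>2"
        using sum_squares_bound[of "norm (pair (y k) (z (Suc k)))" "norm (pair (y (Suc k)) (z k))"]
        by (simp add: power2_sum)
      also have "\<dots> \<le> 2 * (\<omega> k * M) + 2 * (\<omega> (Suc k) * M)"
        using that by (intro add_mono mult_left_mono pb) auto
      finally show ?thesis by (simp add: algebra_simps)
    qed
    have "real R * (norm W)\<^sup>2 = (\<Sum>k\<in>{R..<2 * R}. (norm W)\<^sup>2)"
      by simp
    also have "\<dots> \<le> (\<Sum>k\<in>{R..<2 * R}. 2 * M * (\<omega> k + \<omega> (Suc k)))"
      using Wk by (intro sum_mono) auto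
    also have "\<dots> = 2 * M * ((\<Sum>k\<in>{R..<2 * R}. \<omega> k) + (\<Sum>k\<in>{Suc R..<Suc (2 * R)}. \<omega> k))"
      by (simp only: sum_distrib_left[symmetric] sum.distrib sum.shift_bounds_Suc_ivl)
    also have "\<dots> \<le> 2 * M * ((\<Sum>k\<in>{R..2 * R}. \<omega> k) + (\<Sum>k\<in>{R..2 * R}. \<omega> k))"
      using \<open>M > 0\<close> \<omega>_nonneg by (intro mult_left_mono add_mono sum_mono2) auto
    also have "\<dots> \<le> 2 * M * (\<epsilon>' * real R + \<epsilon>' * real R)"
      using \<open>M > 0\<close> R0[OF R(1) \<open>finite F\<close>] unfolding \<omega>_def by (intro mult_left_mono add_mono) auto
    also have "\<dots> = real R * \<epsilon>\<^sup>2"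
      using \<open>M > 0\<close> by (simp add: \<epsilon>'_def field_simps)
    finally have "(norm W)\<^sup>2 \<le> \<epsilon>\<^sup>2"
      using R(2) by simp
    then show "norm (pair (y 0) z1 - pair (y 1) z0) \<le> \<epsilon>"
      unfolding W_def[symmetric] using \<open>\<epsilon> > 0\<close> by (simp add: power2_le_iff_abs_le)
  qed
qed

end

section \<open>Polynomial approximation together with the derivative\<close>

lemma ex_poly_antiderivative:
  fixes Q :: "complex poly"
  shows "\<exists>P. pderiv P = Q \<and> poly P a = b"
proof -
  define P where "P = (\<Sum>i\<le>degree Q. monom (coeff Q i / of_nat (Suc i)) (Suc i))"
  have "pderiv P = (\<Sum>i\<le>degree Q. monom (coeff Q i) i)"
    by (simp add: P_def higher_pderiv_sum[of 1, simplified] pderiv_monom del: of_nat_Suc)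
  also have "\<dots> = Q" by (rule poly_as_sum_of_monoms)
  finally show ?thesis
    by (intro exI[of _ "P + [:b - poly P a:]"]) (simp add: pderiv_add pderiv_pCons)
qed

lemma Weierstrass_complex_poly:
  fixes f :: "real \<Rightarrow> complex"
  assumes "continuous_on {-r..r} f" "\<delta> > 0"
  obtains Q :: "complex poly" where "\<And>t. \<bar>t\<bar> \<le> r \<Longrightarrow> norm (poly Q (of_real t) - f t) \<le> \<delta>"
proof -
  obtain g where g: "polynomial_function g" "\<And>t. t \<in> {-r..r} \<Longrightarrow> norm (f t - g t) < \<delta>"
    using Stone_Weierstrass_polynomial_function[OF compact_Icc assms] by blast
  have "real_polynomial_function (\<lambda>t. g t \<bullet> 1)" "real_polynomial_function (\<lambda>t. g t \<bullet> \<i>)"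
    using g(1) by (auto simp: polynomial_function_iff_Basis_inner Basis_complex_def)
  then obtain a m b n where ab: "(\<lambda>t. Re (g t)) = (\<lambda>t. \<Sum>i\<le>m. a i * t ^ i)"
      "(\<lambda>t. Im (g t)) = (\<lambda>t. \<Sum>i\<le>n. b i * t ^ i)"
    by (auto simp: real_polynomial_function_iff_sum)
  define Q where "Q = (\<Sum>i\<le>m. monom (of_real (a i)) i) + [:\<i>:] * (\<Sum>i\<le>n. monom (of_real (b i)) i)"
  have "poly Q (of_real t) = g t" for t
    using fun_cong[OF ab(1), of t] fun_cong[OF ab(2), of t]
    by (simp add: Q_def poly_sum poly_monom complex_eq_iff Re_power_real flip: of_real_power of_real_mult)
  then show thesis
    using g(2) by (intro that[of Q]) (auto simp: norm_minus_commute abs_le_iff intro!: less_imp_le)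
qed

lemma poly_of_real_has_derivative:
  "((\<lambda>t. poly P (of_real t :: complex)) has_vector_derivative poly (pderiv P) (of_real t)) (at t)"
  by (rule has_vector_derivative_real_field) (rule poly_DERIV)

text \<open>Approximate the derivative uniformly and take the antiderivative that agrees with
  \<open>f\<close> at 0. The mean value inequality costs a factor \<open>r\<close>, whence the
  tolerance \<open>\<delta> / (1 + r)\<close>.\<close>

lemma C1_poly_approximation:
  fixes f :: "real \<Rightarrow> complex"
  assumes der: "\<And>t. (f has_vector_derivative f' t) (at t)"
    and cont: "continuous_on {-r..r} f'" and "\<delta> > 0" "r \<ge> 0"
  obtains P :: "complex poly" where "\<And>t. \<bar>t\<bar> \<le> r \<Longrightarrow> norm (poly P (of_real t) - f t) \<le> \<delta>"
    "\<And>t. \<bar>t\<bar> \<le> r \<Longrightarrow> norm (poly (pderiv P) (of_real t) - f' t) \<le> \<delta>"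
proof -
  define \<eta> where "\<eta> = \<delta> / (1 + r)"
  have \<eta>: "\<eta> > 0" "\<eta> * r \<le> \<delta>" "\<eta> \<le> \<delta>" using assms by (auto simp: \<eta>_def field_simps)
  obtain Q where Q: "\<And>t. \<bar>t\<bar> \<le> r \<Longrightarrow> norm (poly Q (of_real t) - f' t) \<le> \<eta>"
    using Weierstrass_complex_poly[OF cont \<eta>(1)] by blast
  obtain P where P: "pderiv P = Q" "poly P (of_real 0) = f 0"
    using ex_poly_antiderivative by blast
  have Q': "norm (poly (pderiv P) (of_real t) - f' t) \<le> \<eta>" if "\<bar>t\<bar> \<le> r" for t
    using Q[OF that] by (simp only: P(1))
  have 1: "norm (poly (pderiv P) (of_real t) - f' t) \<le> \<delta>" if "\<bar>t\<bar> \<le> r" for t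
    using Q'[OF that] \<eta>(3) by (rule order_trans)
  have 2: "norm (poly P (of_real t) - f t) \<le> \<delta>" if t: "\<bar>t\<bar> \<le> r" for t
  proof -
    define h where "h = (\<lambda>s. poly P (of_real s) - f s)"
    have "norm (h t - h 0) \<le> \<eta> * norm (t - 0)"
    proof (rule differentiable_bound[where S = "{-r..r}" and
          f' = "\<lambda>s x. x *\<^sub>R (poly (pderiv P) (of_real s) - f' s)"])
      show "(h has_derivative (\<lambda>x. x *\<^sub>R (poly (pderiv P) (of_real s) - f' s))) (at s within {-r..r})" for s
        unfolding h_def has_vector_derivative_def[symmetric]
        by (rule has_vector_derivative_at_within)
          (intro has_vector_derivative_diff poly_of_real_has_derivative der)
      show "onorm (\<lambda>x. x *\<^sub>R (poly (pderiv P) (of_real s) - f' s)) \<le> \<eta>" if "s \<in> {-r..r}" for s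
      proof (rule onorm_le)
        show "norm (x *\<^sub>R (poly (pderiv P) (of_real s) - f' s)) \<le> \<eta> * norm x" for x
          using mult_right_mono[OF Q'[of s], of "\<bar>x\<bar>"] that by (auto simp: mult.commute abs_le_iff)
      qed
    qed (use t assms in auto)
    also have "\<dots> \<le> \<eta> * r" using t \<eta> by (intro mult_left_mono) auto
    finally show ?thesis using \<eta>(2) P(2) by (simp add: h_def)
  qed
  from 2 1 show thesis by (rule that)
qed

context lattice_symbol
begin

lemma ex_poly_symp:
  "\<exists>z. \<forall>x. ev z x = poly P (of_real (symb x)) * ev a x"
proof (induction P)
  case 0
  then show ?case by (intro exI[of _ 0]) simp
next
  case (pCons c P)
  then obtain z where z: "\<And>x. ev z x = poly P (of_real (symb x)) * ev a x" by blast
  show ?case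
    by (intro exI[of _ "Poly_Mapping.single 0 c * a + symp * z"])
      (simp add: ev_add ev_single_times ev_symp_mult z ev_mult ev_single ev_symp algebra_simps)
qed

end

section \<open>A branch of the square root whose cube is continuously differentiable\<close>

definition rt :: "real \<Rightarrow> real" where
  "rt x = sqrt (max 0 x)"

lemma rt_square: "rt x * rt x = max 0 x"
  by (simp add: rt_def)

lemma rt_nonpos: "x \<le> 0 \<Longrightarrow> rt x = 0"
  by (simp add: rt_def max_def)

lemma rt_nonneg: "rt x \<ge> 0"
  by (simp add: rt_def)

lemma continuous_on_rt [continuous_intros]:
  "continuous_on S f \<Longrightarrow> continuous_on S (\<lambda>x. rt (f x))"
  unfolding rt_def by (intro continuous_intros)

text \<open>This is the positive part to the power 3/2. At 0 the difference quotient is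
  \<open>rt\<close> itself, which tends to 0, so the two sides fit together.\<close>

lemma rt_cube_has_derivative: "((\<lambda>x. rt x ^ 3) has_real_derivative 3 / 2 * rt x) (at x)"
proof -
  consider "x < 0" | "x = 0" | "x > 0" by linarith
  then show ?thesis
  proof cases
    case 1
    have "((\<lambda>x. 0) has_real_derivative 3 / 2 * rt x) (at x)"
      using 1 by (simp add: rt_nonpos)
    then show ?thesis
      by (rule has_field_derivative_transform_within_open[where S = "{..<0}"]) (use 1 in \<open>auto simp: rt_nonpos\<close>)
  next
    case 2
    have "((\<lambda>u. rt u) \<longlongrightarrow> rt 0) (at 0)"
      using continuous_on_rt[of UNIV "\<lambda>x. x"] by (simp add: continuous_on_def)
    moreover have "eventually (\<lambda>u. rt u = (rt (0 + u) ^ 3 - rt 0 ^ 3) / u) (at 0)"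
      unfolding eventually_at_filter
    proof (intro always_eventually allI impI)
      fix u :: real assume "u \<noteq> 0"
      have "rt u ^ 3 = rt u * max 0 u"
        by (simp add: power3_eq_cube rt_square mult.assoc)
      then show "rt u = (rt (0 + u) ^ 3 - rt 0 ^ 3) / u"
        using \<open>u \<noteq> 0\<close> by (cases "u > 0") (simp_all add: rt_nonpos)
    qed
    ultimately have "((\<lambda>u. (rt (0 + u) ^ 3 - rt 0 ^ 3) / u) \<longlongrightarrow> rt 0) (at 0)"
      by (rule Lim_transform_eventually)
    then show ?thesis
      using 2 by (simp add: DERIV_def rt_nonpos)
  next
    case 3
    have "((\<lambda>x. sqrt x ^ 3) has_real_derivative 3 / 2 * rt x) (at x)"
      using 3 by (auto intro!: derivative_eq_intros simp: rt_def field_simps power2_eq_square)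
    then show ?thesis
      by (rule has_field_derivative_transform_within_open[where S = "{0<..}"]) (use 3 in \<open>auto simp: rt_def\<close>)
  qed
qed

lemma rt_cube_has_derivative':
  "(f has_real_derivative f') (at x) \<Longrightarrow> ((\<lambda>x. rt (f x) ^ 3) has_real_derivative 3 / 2 * rt (f x) * f') (at x)"
  using DERIV_chain2[OF rt_cube_has_derivative] .

text \<open>A branch of the square root of \<open>t\<^sup>2 - 4\<close> for which the root \<open>small_root t\<close> of \<open>w\<^sup>2 - t w + 1\<close> stays in the
  closed unit disc. Its cube is continuously differentiable at the branch points as well.\<close>

definition disc_root :: "real \<Rightarrow> complex" where
  "disc_root t = of_real (rt (- t - 2) * rt (2 - t) - rt (t - 2) * rt (t + 2)) + \<i> * of_real (rt (2 - t) * rt (2 + t))"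

lemma disc_root_cases:
  fixes t :: real
  obtains "t \<ge> 2" "disc_root t = of_real (- (rt (t - 2) * rt (t + 2)))" "rt (2 - t) = 0" "rt (- t - 2) = 0"
  | "t \<le> -2" "disc_root t = of_real (rt (- t - 2) * rt (2 - t))" "rt (t - 2) = 0" "rt (2 + t) = 0"
  | "\<bar>t\<bar> < 2" "disc_root t = \<i> * of_real (rt (2 - t) * rt (2 + t))" "rt (t - 2) = 0" "rt (- t - 2) = 0"
proof -
  consider "t \<ge> 2" | "t \<le> -2" | "\<bar>t\<bar> < 2" by linarith
  then show thesis
  proof cases
    case 1
    then have "rt (2 - t) = 0" "rt (- t - 2) = 0" by (auto intro!: rt_nonpos)
    with 1 show thesis by (intro that(1)) (auto simp: disc_root_def)
  next
    case 2
    then have "rt (t - 2) = 0" "rt (2 + t) = 0" by (auto intro!: rt_nonpos)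
    with 2 show thesis by (intro that(2)) (auto simp: disc_root_def)
  next
    case 3
    then have "rt (t - 2) = 0" "rt (- t - 2) = 0" by (auto intro!: rt_nonpos)
    with 3 show thesis by (intro that(3)) (auto simp: disc_root_def)
  qed
qed

lemma disc_root_square: "disc_root t * disc_root t = of_real (t\<^sup>2 - 4)"
proof (cases t rule: disc_root_cases)
  case 1
  have "(rt (t - 2) * rt (t + 2)) * (rt (t - 2) * rt (t + 2)) = (rt (t - 2) * rt (t - 2)) * (rt (t + 2) * rt (t + 2))"
    by (simp only: mult_ac)
  also have "\<dots> = t\<^sup>2 - 4" unfolding rt_square using 1(1) by (simp add: power2_eq_square algebra_simps)
  finally show ?thesis unfolding 1(2) by (simp flip: of_real_mult)
next
  case 2
  have "(rt (- t - 2) * rt (2 - t)) * (rt (- t - 2) * rt (2 - t)) = (rt (- t - 2) * rt (- t - 2)) * (rt (2 - t) * rt (2 - t))"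
    by (simp only: mult_ac)
  also have "\<dots> = t\<^sup>2 - 4" unfolding rt_square using 2(1) by (simp add: power2_eq_square algebra_simps)
  finally show ?thesis unfolding 2(2) by (simp flip: of_real_mult)
next
  case 3
  have "(rt (2 - t) * rt (2 + t)) * (rt (2 - t) * rt (2 + t)) = (rt (2 - t) * rt (2 - t)) * (rt (2 + t) * rt (2 + t))"
    by (simp only: mult_ac)
  also have "\<dots> = 4 - t\<^sup>2" unfolding rt_square using 3(1) by (simp add: power2_eq_square algebra_simps)
  finally have eq: "(rt (2 - t) * rt (2 + t)) * (rt (2 - t) * rt (2 + t)) = 4 - t\<^sup>2" .
  have "disc_root t * disc_root t = - of_real ((rt (2 - t) * rt (2 + t)) * (rt (2 - t) * rt (2 + t)))"
    unfolding 3(2) by (simp add: complex_eq_iff)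
  also have "\<dots> = of_real (t\<^sup>2 - 4)" unfolding eq by simp
  finally show ?thesis .
qed

text \<open>For each \<open>t\<close> at most one of the three products is nonzero, so the cube acts
  termwise; the sign of the last term is that of \<i> cubed.\<close>

lemma disc_root_cube_eq:
  "disc_root t ^ 3 = of_real (rt (- t - 2) ^ 3 * rt (2 - t) ^ 3 - rt (t - 2) ^ 3 * rt (t + 2) ^ 3)
     - \<i> * of_real (rt (2 - t) ^ 3 * rt (2 + t) ^ 3)"
proof (cases t rule: disc_root_cases)
  case 1
  show ?thesis unfolding 1(2) using 1(3,4) by (simp add: power_mult_distrib flip: of_real_power)
next
  case 2
  show ?thesis unfolding 2(2) using 2(3,4) by (simp add: power_mult_distrib flip: of_real_power)
next
  case 3
  show ?thesis unfolding 3(2) using 3(3,4)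
    by (simp add: power_mult_distrib power3_eq_cube complex_eq_iff)
qed

text \<open>Write s for \<open>disc_root\<close>. From s s = t^2 - 4 one gets s s' = t formally,
  hence (s^3)' = 3 s (s s') = 3 t s. This is continuous at 2 and -2, although s' blows up
  there.\<close>

lemma disc_root_cube_has_derivative:
  "((\<lambda>t. disc_root t ^ 3) has_vector_derivative 3 * of_real t * disc_root t) (at t)"
proof -
  define A where "A t = rt (- t - 2) ^ 3 * rt (2 - t) ^ 3 - rt (t - 2) ^ 3 * rt (t + 2) ^ 3" for t
  define B where "B t = rt (2 - t) ^ 3 * rt (2 + t) ^ 3" for t
  define A' where "A' = 3 / 2 * rt (- t - 2) * (-1) * rt (2 - t) ^ 3 + rt (- t - 2) ^ 3 * (3 / 2 * rt (2 - t) * (-1))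
     - (3 / 2 * rt (t - 2) * 1 * rt (t + 2) ^ 3 + rt (t - 2) ^ 3 * (3 / 2 * rt (t + 2) * 1))"
  define B' where "B' = 3 / 2 * rt (2 - t) * (-1) * rt (2 + t) ^ 3 + rt (2 - t) ^ 3 * (3 / 2 * rt (2 + t) * 1)"
  have d: "((\<lambda>t. - t - 2) has_real_derivative - 1) (at t)" "((\<lambda>t. 2 - t) has_real_derivative - 1) (at t)"
    "((\<lambda>t. t - 2) has_real_derivative 1) (at t)" "((\<lambda>t. t + 2) has_real_derivative 1) (at t)"
    "((\<lambda>t. 2 + t) has_real_derivative 1) (at t)"
    by (auto intro!: derivative_eq_intros)
  note c = d[THEN rt_cube_has_derivative']
  have A: "(A has_real_derivative A') (at t)"
    unfolding A_def A'_def
    by (rule DERIV_cong[OF DERIV_diff[OF DERIV_mult[OF c(1,2)] DERIV_mult[OF c(3,4)]]]) (simp add: algebra_simps)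
  have B: "(B has_real_derivative B') (at t)"
    unfolding B_def B'_def by (rule DERIV_cong[OF DERIV_mult[OF c(2,5)]]) (simp add: algebra_simps)
  have "((\<lambda>t. of_real (A t) - \<i> * of_real (B t)) has_vector_derivative of_real A' - \<i> * of_real B') (at t)"
    using A B by (intro has_vector_derivative_diff has_vector_derivative_of_real has_vector_derivative_mult_right)
  moreover have "of_real A' - \<i> * of_real B' = 3 * of_real t * disc_root t"
  proof -
    have cube: "rt x ^ 3 = max 0 x * rt x" for x
      by (simp add: power3_eq_cube rt_square)
    show ?thesis
    proof (cases t rule: disc_root_cases)
      case 1
      then show ?thesis
        by (simp add: A'_def B'_def cube complex_eq_iff) (simp add: field_simps)
    next
      case 2
      then show ?thesis
        by (simp add: A'_def B'_def cube complex_eq_iff) (simp add: field_simps)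
    next
      case 3
      then show ?thesis
        by (simp add: A'_def B'_def cube complex_eq_iff) (simp add: field_simps)
    qed
  qed
  ultimately show ?thesis
    by (simp add: disc_root_cube_eq[abs_def] A_def B_def)
qed

lemma continuous_on_disc_root [continuous_intros]: "continuous_on S disc_root"
  unfolding disc_root_def by (intro continuous_intros)

definition small_root :: "real \<Rightarrow> complex" where
  "small_root t = (of_real t + disc_root t) / 2"

lemma small_root_square: "small_root t * small_root t = of_real t * small_root t - 1"
proof -
  have s: "disc_root t * disc_root t = of_real t * of_real t - 4"
    using disc_root_square[of t] by (simp add: power2_eq_square)
  have "4 * (small_root t * small_root t) = of_real t * of_real t + 2 * of_real t * disc_root t + disc_root t * disc_root t"
    by (simp add: small_root_def algebra_simps)
  also have "\<dots> = 4 * (of_real t * small_root t - 1)"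
    unfolding s by (simp add: small_root_def algebra_simps)
  finally show ?thesis by (simp only: mult_cancel_left) simp
qed

text \<open>The two roots have product 1. For \<open>\<bar>t\<bar> < 2\<close> they are conjugate,
  hence unimodular. Otherwise they are real and the sign in \<open>disc_root\<close> selects the
  smaller one: \<open>w\<close> is a geometric mean of \<open>\<bar>t\<bar> - 2\<close> and
  \<open>\<bar>t\<bar> + 2\<close>, so it lies between them.\<close>

lemma norm_small_root: "norm (small_root t) \<le> 1"
proof (cases t rule: disc_root_cases)
  case 1
  define w where "w = rt (t - 2) * rt (t + 2)"
  have "rt (t - 2) * rt (t - 2) \<le> w"
    unfolding w_def using 1(1) by (intro mult_left_mono rt_nonneg) (auto simp: rt_def)
  then have "w \<ge> t - 2" using 1(1) by (simp add: rt_square)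
  moreover have "w \<le> rt (t + 2) * rt (t + 2)"
    unfolding w_def using 1(1) by (intro mult_right_mono rt_nonneg) (auto simp: rt_def)
  then have "w \<le> t + 2" using 1(1) by (simp add: rt_square)
  moreover have "small_root t = of_real ((t - w) / 2)"
    unfolding small_root_def 1(2) w_def by simp
  ultimately show ?thesis by (simp only: norm_of_real) (auto simp: abs_le_iff)
next
  case 2
  define w where "w = rt (- t - 2) * rt (2 - t)"
  have "rt (- t - 2) * rt (- t - 2) \<le> w"
    unfolding w_def using 2(1) by (intro mult_left_mono rt_nonneg) (auto simp: rt_def)
  then have "w \<ge> - t - 2" using 2(1) by (simp add: rt_square)
  moreover have "w \<le> rt (2 - t) * rt (2 - t)"
    unfolding w_def using 2(1) by (intro mult_right_mono rt_nonneg) (auto simp: rt_def)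
  then have "w \<le> 2 - t" using 2(1) by (simp add: rt_square)
  moreover have "small_root t = of_real ((t + w) / 2)"
    unfolding small_root_def 2(2) w_def by simp
  ultimately show ?thesis by (simp only: norm_of_real) (auto simp: abs_le_iff)
next
  case 3
  define w where "w = rt (2 - t) * rt (2 + t)"
  have "w * w = (rt (2 - t) * rt (2 - t)) * (rt (2 + t) * rt (2 + t))"
    unfolding w_def by (simp only: mult_ac)
  also have "\<dots> = 4 - t\<^sup>2" unfolding rt_square using 3(1) by (simp add: power2_eq_square algebra_simps)
  finally have "w * w = 4 - t\<^sup>2" .
  moreover have "(norm (small_root t))\<^sup>2 = (t\<^sup>2 + w * w) / 4"
    unfolding small_root_def 3(2) w_def[symmetric] cmod_power2
    by (simp add: power2_eq_square add_divide_distrib)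
  ultimately have "(norm (small_root t))\<^sup>2 = 1" by simp
  then show ?thesis by (auto simp: power2_eq_1_iff)
qed

lemma norm_disc_root: "norm (disc_root t) \<le> 2 + \<bar>t\<bar>"
proof -
  have "disc_root t = 2 * small_root t - of_real t"
    by (simp add: small_root_def field_simps)
  then have "norm (disc_root t) \<le> norm (2 * small_root t) + norm (of_real t :: complex)"
    using norm_triangle_ineq4 by metis
  then show ?thesis using norm_small_root[of t] by (simp add: norm_mult)
qed

lemma has_vector_derivative_quadratic:
  "((\<lambda>t. (of_real (t\<^sup>2 - 4))\<^sup>2 :: complex) has_vector_derivative of_real (4 * t * (t\<^sup>2 - 4))) (at t)"
proof -
  have "((\<lambda>t. (t\<^sup>2 - 4)\<^sup>2) has_real_derivative 4 * t * (t\<^sup>2 - 4)) (at t)"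
    by (auto intro!: derivative_eq_intros simp: algebra_simps)
  from has_vector_derivative_of_real[OF this] show ?thesis by simp
qed

context lattice_symbol
begin

definition edge_poly :: "int \<times> int \<Rightarrow>\<^sub>0 complex" where
  "edge_poly = (symp * symp - Poly_Mapping.single 0 4) ^ 2"

lemma ev_edge_poly: "ev edge_poly x = (of_real ((symb x)\<^sup>2 - 4))\<^sup>2"
  using ev_single[of 0 4 x] by (simp add: edge_poly_def power2_eq_square ev_mult ev_diff ev_symp)

text \<open>The powers of \<open>small_root\<close>, multiplied by \<open>disc_root\<^sup>3\<close>, are bounded \<open>C\<^sup>1\<close> solutions of the
  recurrence in both directions of time, so both half lines give vanishing Wronskians. Their sum determines \<open>y k\<close> up to
  the factor \<open>disc_root\<^sup>4 = (t\<^sup>2 - 4)\<^sup>2\<close>.\<close>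

lemma homogeneous_pair_edge_poly:
  fixes y :: "int \<Rightarrow> int \<times> int \<Rightarrow> complex"
  assumes y: "\<And>k n. y (k + 1) n + y (k - 1) n = hop (y k) n"
    and small: "half_small (\<lambda>j. y (k + int j))" "half_small (\<lambda>j. y (k - int j))"
  shows "pair (y k) (edge_poly * a) = 0"
proof -
  define Z where "Z j t = disc_root t ^ 3 * small_root t ^ j" for j t
  \<comment> \<open>The derivative of \<open>Z j\<close> in \<open>t\<close>. With s for
    \<open>disc_root\<close> and w for \<open>small_root\<close>, s s' = t and w' = w / s; the
    powers of s in \<open>Z\<close> cancel the denominators.\<close>
  define Z' where "Z' j t = disc_root t * small_root t ^ j * (3 * of_real t + of_nat j * disc_root t)" for j t
  have rec: "Z (Suc (Suc j)) t = of_real t * Z (Suc j) t - Z j t" for j t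
  proof -
    have "Z (Suc (Suc j)) t = disc_root t ^ 3 * small_root t ^ j * (small_root t * small_root t)"
      by (simp add: Z_def mult_ac)
    then show ?thesis unfolding small_root_square by (simp add: Z_def algebra_simps)
  qed
  have rec': "Z' (Suc (Suc j)) t = Z (Suc j) t + of_real t * Z' (Suc j) t - Z' j t" for j t
  proof -
    define s where "s = disc_root t"
    define w where "w = small_root t"
    define T where "T = (of_real t :: complex)"
    have w2: "w * w = T * w - 1" unfolding w_def T_def by (rule small_root_square)
    have s: "s = 2 * w - T" by (simp add: s_def w_def T_def small_root_def field_simps)
    have "s * (w * w) * (3 * T + (of_nat j + 2) * s) = s ^ 3 * w + T * (s * w * (3 * T + (of_nat j + 1) * s)) - s * (3 * T + of_nat j * s)"
      using w2 unfolding s by algebra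
    then have "w ^ j * (s * (w * w) * (3 * T + (of_nat j + 2) * s)) = w ^ j * (s ^ 3 * w + T * (s * w * (3 * T + (of_nat j + 1) * s)) - s * (3 * T + of_nat j * s))"
      by simp
    then show ?thesis
      unfolding Z'_def Z_def s_def[symmetric] w_def[symmetric] T_def[symmetric]
      by (simp add: algebra_simps)
  qed
  define r where "r = sbound"
  have "r \<ge> 0" by (simp add: r_def sbound_def)
  define C where "C = (2 + r) ^ 3 + 3 * (2 + r)\<^sup>2"
  have sr: "norm (disc_root t) \<le> 2 + r" if "\<bar>t\<bar> \<le> r" for t
    using norm_disc_root[of t] that by linarith
  have wj: "norm (small_root t ^ j) \<le> 1" for t j
    using norm_small_root[of t] by (simp add: norm_power power_le_one)
  have ZC: "norm (Z j t) \<le> C" if "\<bar>t\<bar> \<le> r" for j t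
  proof -
    have "norm (Z j t) \<le> (2 + r) ^ 3 * 1"
      unfolding Z_def norm_mult norm_power[of "disc_root t"]
      using sr[OF that] wj \<open>r \<ge> 0\<close> by (intro mult_mono power_mono) auto
    then show ?thesis using \<open>r \<ge> 0\<close> by (simp add: C_def add_increasing2)
  qed
  have Z'C: "norm (Z' j t) \<le> C * (1 + real j)" if "\<bar>t\<bar> \<le> r" for j t
  proof -
    have "norm (3 * of_real t + of_nat j * disc_root t) \<le> 3 * \<bar>t\<bar> + real j * norm (disc_root t)"
      using norm_triangle_ineq[of "3 * of_real t" "of_nat j * disc_root t"] by (simp add: norm_mult)
    also have "\<dots> \<le> 3 * (2 + r) + real j * (2 + r)"
      using sr[OF that] that by (intro add_mono mult_left_mono) auto
    finally have "norm (Z' j t) \<le> (2 + r) * 1 * (3 * (2 + r) + real j * (2 + r))"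
      unfolding Z'_def norm_mult using sr[OF that] wj \<open>r \<ge> 0\<close> by (intro mult_mono) auto
    also have "\<dots> = 3 * (2 + r)\<^sup>2 + (2 + r)\<^sup>2 * real j"
      by (simp add: power2_eq_square algebra_simps)
    also have "\<dots> \<le> 3 * (2 + r)\<^sup>2 + (3 * (2 + r)\<^sup>2) * real j"
      by (intro add_left_mono mult_right_mono) auto
    also have "\<dots> \<le> C * (1 + real j)"
      using \<open>r \<ge> 0\<close> by (simp add: C_def algebra_simps)
    finally show ?thesis .
  qed
  have "norm (pair (y k) (edge_poly * a)) \<le> 0 + \<epsilon>" if "\<epsilon> > 0" for \<epsilon> :: real
  proof -
    have e2: "\<epsilon> / 2 > 0" using that by simp
    have yp: "y (k + int (Suc (Suc j))) n + y (k + int j) n = hop (y (k + int (Suc j))) n" for j n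
      using y[of "k + int j + 1" n] by (simp add: algebra_simps)
    have ym: "y (k - int (Suc (Suc j))) n + y (k - int j) n = hop (y (k - int (Suc j))) n" for j n
      using y[of "k - int j - 1" n] by (simp add: algebra_simps)
    have "\<exists>\<delta>>0. pairing_bound (y (k + int 0)) (y (k + int 1)) a (Z 0) (Z' 0) (Z 1) (Z' 1) \<delta> (\<epsilon> / 2)"
      by (rule half_line_pairing_small[where y = "\<lambda>j. y (k + int j)" and Z = Z and Z' = Z' and C = C, OF yp small(1) rec rec'])
        (use ZC Z'C e2 in \<open>auto simp: r_def\<close>)
    then obtain \<delta>1 where d1: "\<delta>1 > 0"
      "pairing_bound (y (k + int 0)) (y (k + int 1)) a (Z 0) (Z' 0) (Z 1) (Z' 1) \<delta>1 (\<epsilon> / 2)"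
      by blast
    have "\<exists>\<delta>>0. pairing_bound (y (k - int 0)) (y (k - int 1)) a (Z 0) (Z' 0) (Z 1) (Z' 1) \<delta> (\<epsilon> / 2)"
      by (rule half_line_pairing_small[where y = "\<lambda>j. y (k - int j)" and Z = Z and Z' = Z' and C = C, OF ym small(2) rec rec'])
        (use ZC Z'C e2 in \<open>auto simp: r_def\<close>)
    then obtain \<delta>2 where d2: "\<delta>2 > 0"
      "pairing_bound (y (k - int 0)) (y (k - int 1)) a (Z 0) (Z' 0) (Z 1) (Z' 1) \<delta>2 (\<epsilon> / 2)"
      by blast
    define \<delta> where "\<delta> = min \<delta>1 \<delta>2"
    \<comment> \<open>The data at time 1 contain \<open>t\<close> times the approximating
      polynomial, which enlarges its error by a factor of at most \<open>1 + r\<close>.\<close>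
    define d where "d = \<delta> / (1 + r)"
    have "\<delta> > 0" using d1(1) d2(1) by (simp add: \<delta>_def)
    have d: "d > 0" "d \<le> \<delta>" "d * (1 + r) = \<delta>"
      using \<open>\<delta> > 0\<close> \<open>r \<ge> 0\<close> by (auto simp: d_def field_simps)
    obtain P where P: "\<And>t. \<bar>t\<bar> \<le> r \<Longrightarrow> norm (poly P (of_real t) - disc_root t ^ 3) \<le> d"
      "\<And>t. \<bar>t\<bar> \<le> r \<Longrightarrow> norm (poly (pderiv P) (of_real t) - 3 * of_real t * disc_root t) \<le> d"
      by (rule C1_poly_approximation[OF disc_root_cube_has_derivative _ d(1) \<open>r \<ge> 0\<close>])
        (auto intro!: continuous_intros)
    obtain z0 where z0: "\<And>x. ev z0 x = poly P (of_real (symb x)) * ev a x"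
      using ex_poly_symp by blast
    \<comment> \<open>The wanted datum at time 1 is s^3 w = (t s^3 + s^4) / 2. As s^4 is the
      polynomial behind \<open>edge_poly\<close>, only s^3 had to be approximated.\<close>
    define z1 where "z1 = Poly_Mapping.single 0 (1 / 2) * (symp * z0 + edge_poly * a)"
    define f1 where "f1 t = (of_real t * poly P (of_real t) + (of_real (t\<^sup>2 - 4))\<^sup>2) / 2" for t
    define g1 where "g1 t = (of_real t * poly (pderiv P) (of_real t) + of_real 1 * poly P (of_real t) + of_real (4 * t * (t\<^sup>2 - 4))) / 2" for t
    have z1: "ev z1 x = f1 (symb x) * ev a x" for x
      by (simp add: z1_def f1_def ev_single ev_add ev_mult ev_symp ev_edge_poly z0 algebra_simps)
    have der1: "(f1 has_vector_derivative g1 t) (at t)" for t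
      unfolding f1_def g1_def
      by (intro has_vector_derivative_divide has_vector_derivative_add has_vector_derivative_mult
          has_vector_derivative_of_real DERIV_ident poly_of_real_has_derivative has_vector_derivative_quadratic)
    have f0: "norm (poly P (of_real t) - Z 0 t) \<le> \<delta>" if "\<bar>t\<bar> \<le> r" for t
      using order_trans[OF P(1)[OF that] d(2)] by (simp add: Z_def)
    have g0: "norm (poly (pderiv P) (of_real t) - Z' 0 t) \<le> \<delta>" if "\<bar>t\<bar> \<le> r" for t
      using order_trans[OF P(2)[OF that] d(2)] by (simp add: Z'_def mult_ac)
    have ss: "disc_root t * disc_root t = of_real (t\<^sup>2 - 4)" for t
      by (rule disc_root_square)
    have f1: "norm (f1 t - Z 1 t) \<le> \<delta>" if "\<bar>t\<bar> \<le> r" for t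
    proof -
      have "Z 1 t = (of_real t * disc_root t ^ 3 + (disc_root t * disc_root t)\<^sup>2) / 2"
        by (simp add: Z_def small_root_def power2_eq_square power3_eq_cube algebra_simps)
      then have "f1 t - Z 1 t = of_real (t / 2) * (poly P (of_real t) - disc_root t ^ 3)"
        unfolding ss by (simp add: f1_def algebra_simps diff_divide_distrib add_divide_distrib)
      then have "norm (f1 t - Z 1 t) = \<bar>t / 2\<bar> * norm (poly P (of_real t) - disc_root t ^ 3)"
        by (simp only: norm_mult norm_of_real)
      also have "\<dots> \<le> (1 + r) * d"
        using P(1)[OF that] that d(1) \<open>r \<ge> 0\<close> by (intro mult_mono) auto
      finally show ?thesis using d(3) by (simp add: mult.commute)
    qed
    have g1: "norm (g1 t - Z' 1 t) \<le> \<delta>" if "\<bar>t\<bar> \<le> r" for t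
    proof -
      have "Z' 1 t = (of_real t * (3 * of_real t * disc_root t) + disc_root t ^ 3 + 4 * of_real t * (disc_root t * disc_root t)) / 2"
        by (simp add: Z'_def small_root_def power2_eq_square power3_eq_cube algebra_simps)
      then have "g1 t - Z' 1 t = (of_real t * (poly (pderiv P) (of_real t) - 3 * of_real t * disc_root t)
          + (poly P (of_real t) - disc_root t ^ 3)) / 2"
        unfolding ss by (simp add: g1_def algebra_simps diff_divide_distrib add_divide_distrib)
      then have "norm (g1 t - Z' 1 t) = norm (of_real t * (poly (pderiv P) (of_real t) - 3 * of_real t * disc_root t)
          + (poly P (of_real t) - disc_root t ^ 3)) / 2"
        by (simp only: norm_divide norm_numeral)
      also have "\<dots> \<le> norm (of_real t * (poly (pderiv P) (of_real t) - 3 * of_real t * disc_root t)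
          + (poly P (of_real t) - disc_root t ^ 3))"
        by simp
      also have "\<dots> \<le> \<bar>t\<bar> * norm (poly (pderiv P) (of_real t) - 3 * of_real t * disc_root t)
          + norm (poly P (of_real t) - disc_root t ^ 3)"
        by (rule order_trans[OF norm_triangle_ineq]) (simp only: norm_mult norm_of_real order_refl)
      also have "\<dots> \<le> r * d + d"
        using P[OF that] that d(1) \<open>r \<ge> 0\<close> by (intro add_mono mult_mono) auto
      also have "\<dots> = \<delta>" using d(3) by (simp add: algebra_simps)
      finally show ?thesis .
    qed
    have "norm (pair (y (k + int 0)) z1 - pair (y (k + int 1)) z0) \<le> \<epsilon> / 2"
      by (rule pairing_boundD[OF d1(2), where ?f0.0 = "\<lambda>t. poly P (of_real t)" and ?g0.0 = "\<lambda>t. poly (pderiv P) (of_real t)"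
            and ?f1.0 = f1 and ?g1.0 = g1])
        (use z0 z1 der1 poly_of_real_has_derivative f0 g0 f1 g1 in \<open>auto simp: r_def \<delta>_def C1_near_def\<close>)
    moreover have "norm (pair (y (k - int 0)) z1 - pair (y (k - int 1)) z0) \<le> \<epsilon> / 2"
      by (rule pairing_boundD[OF d2(2), where ?f0.0 = "\<lambda>t. poly P (of_real t)" and ?g0.0 = "\<lambda>t. poly (pderiv P) (of_real t)"
            and ?f1.0 = f1 and ?g1.0 = g1])
        (use z0 z1 der1 poly_of_real_has_derivative f0 g0 f1 g1 in \<open>auto simp: r_def \<delta>_def C1_near_def\<close>)
    \<comment> \<open>In the sum of the two Wronskians the neighbours \<open>y (k + 1)\<close> and
      \<open>y (k - 1)\<close> combine to \<open>hop (y k)\<close>, which cancels the part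
      \<open>symp * z0\<close> of twice \<open>z1\<close>.\<close>
    moreover have "pair (y k) (edge_poly * a) = (pair (y k) z1 - pair (y (k + 1)) z0) + (pair (y k) z1 - pair (y (k - 1)) z0)"
    proof -
      have "hop (y k) = (\<lambda>n. y (k + 1) n + y (k - 1) n)"
        using y by auto
      then have "pair (y k) (symp * z0) = pair (y (k + 1)) z0 + pair (y (k - 1)) z0"
        by (simp add: pair_symp pair_add_left)
      moreover have "pair (y k) z1 = (pair (y k) (symp * z0) + pair (y k) (edge_poly * a)) / 2"
        by (simp add: z1_def pair_single_times pair_add_right)
      ultimately show ?thesis by (simp add: field_simps)
    qed
    ultimately show ?thesis
      using norm_triangle_ineq[of "pair (y k) z1 - pair (y (k + 1)) z0" "pair (y k) z1 - pair (y (k - 1)) z0"]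
      by simp
  qed
  then have "norm (pair (y k) (edge_poly * a)) \<le> 0"
    by (rule field_le_epsilon)
  then show ?thesis by simp
qed

end

section \<open>Uniqueness for the homogeneous equation\<close>

text \<open>The condition of \<open>B0star\<close> in the coordinates of the recurrence, with cubes
  instead of balls; the first argument is the discrete time.\<close>

definition vanishing_average :: "(int \<Rightarrow> int \<times> int \<Rightarrow> complex) \<Rightarrow> bool" where
  "vanishing_average y \<longleftrightarrow> (\<forall>\<epsilon>>0. \<exists>R0. \<forall>R\<ge>R0.
     (\<Sum>k\<in>{-int R..int R}. \<Sum>n\<in>{-int R..int R} \<times> {-int R..int R}. (norm (y k n))\<^sup>2) \<le> \<epsilon> * real R)"

text \<open>A dyadic decomposition: if \<open>j\<close> is the least index for which
  \<open>n\<close> lies in the square of radius \<open>2 ^ j * R\<close>, then the weight is at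
  least \<open>4 ^ j / 4\<close>.\<close>

lemma inverse_weight_le:
  assumes "R \<ge> 1" "max \<bar>fst n\<bar> \<bar>snd n\<bar> \<le> 2 ^ J * int R"
  shows "1 / weight (real R) n \<le>
    (\<Sum>j\<le>J. 4 / 4 ^ j * (if max \<bar>fst n\<bar> \<bar>snd n\<bar> \<le> 2 ^ j * int R then 1 else 0))"
proof -
  define m where "m = max \<bar>fst n\<bar> \<bar>snd n\<bar>"
  define j where "j = (LEAST j. m \<le> 2 ^ j * int R)"
  have j: "m \<le> 2 ^ j * int R" unfolding j_def by (rule LeastI) (use assms in \<open>simp add: m_def\<close>)
  have "j \<le> J" unfolding j_def by (rule Least_le) (use assms in \<open>simp add: m_def\<close>)
  have "4 ^ j / 4 \<le> weight (real R) n"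
  proof (cases j)
    case 0
    then show ?thesis by (simp add: weight_def add_increasing2)
  next
    case (Suc i)
    then have "\<not> m \<le> 2 ^ i * int R" unfolding j_def by (metis lessI not_less_Least)
    then have "real_of_int (2 ^ i * int R) \<le> real_of_int m"
      by (simp only: of_int_le_iff)
    then have "2 ^ i * real R \<le> real_of_int m" by simp
    then have "(2 ^ i * real R)\<^sup>2 \<le> (real_of_int m)\<^sup>2"
      by (intro power_mono) auto
    also have "\<dots> \<le> (real_of_int (fst n))\<^sup>2 + (real_of_int (snd n))\<^sup>2"
      unfolding m_def by (cases "\<bar>fst n\<bar> \<le> \<bar>snd n\<bar>") (simp_all add: max_def)
    finally have *: "(2 ^ i * real R)\<^sup>2 \<le> (real_of_int (fst n))\<^sup>2 + (real_of_int (snd n))\<^sup>2" .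
    have "4 ^ i \<le> ((real_of_int (fst n))\<^sup>2 + (real_of_int (snd n))\<^sup>2) / (real R)\<^sup>2"
    proof -
      have "(4::real) ^ i = 2 ^ i * 2 ^ i" by (simp flip: power_mult_distrib)
      then have "(2 ^ i * real R)\<^sup>2 = 4 ^ i * (real R)\<^sup>2"
        by (simp add: power_mult_distrib power2_eq_square)
      then show ?thesis
        using assms(1) * by (simp add: le_divide_eq)
    qed
    then show ?thesis using Suc by (simp add: weight_def)
  qed
  then have "1 / weight (real R) n \<le> 4 / 4 ^ j"
    using weight_pos[of "real R" n] by (simp add: field_simps)
  also have "\<dots> = 4 / 4 ^ j * (if m \<le> 2 ^ j * int R then 1 else 0)" using j by simp
  also have "\<dots> \<le> (\<Sum>j\<le>J. 4 / 4 ^ j * (if m \<le> 2 ^ j * int R then 1 else 0))"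
    by (rule member_le_sum) (use \<open>j \<le> J\<close> in auto)
  finally show ?thesis by (simp add: m_def)
qed

text \<open>The dyadic cube with index \<open>j\<close> carries mass of order
  \<open>2 ^ j * R\<close>, with a small factor, while the inverse weight contributes
  \<open>4 / 4 ^ j\<close>; the geometric series converges. The map \<open>c\<close> allows half
  lines in either direction from any starting time.\<close>

lemma half_small_if_vanishing_average:
  assumes y: "vanishing_average y" and c: "inj c" "\<And>j. \<bar>c j\<bar> \<le> int K + int j"
  shows "half_small (\<lambda>j. y (c j))"
  unfolding half_small_def
proof (intro allI impI)
  fix \<epsilon> :: real assume "\<epsilon> > 0"
  define S where "S R = (\<Sum>k\<in>{-int R..int R}. \<Sum>n\<in>{-int R..int R} \<times> {-int R..int R}. (norm (y k n))\<^sup>2)" for R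
  from \<open>\<epsilon> > 0\<close> have "\<epsilon> / 24 > 0" by simp
  \<comment> \<open>The 24 is the product of 4 from \<open>inverse_weight_le\<close>, 3 from
    \<open>\<bar>c k\<bar> \<le> 3 * R\<close> in the window, and 2 from the geometric
    series.\<close>
  then obtain R0 where R0: "\<And>R. R \<ge> R0 \<Longrightarrow> S R \<le> \<epsilon> / 24 * real R"
    using y unfolding vanishing_average_def S_def by blast
  show "\<exists>R0. \<forall>R\<ge>R0. \<forall>F. finite F \<longrightarrow>
     (\<Sum>k\<in>{R..2 * R}. \<Sum>n\<in>F. (norm (y (c k) n))\<^sup>2 / weight (real R) n) \<le> \<epsilon> * real R"
  proof (intro exI[of _ "max R0 (max K 1)"] allI impI)
    fix R and F :: "(int \<times> int) set" assume R: "max R0 (max K 1) \<le> R" and "finite F"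
    define m where "m n = max \<bar>fst n\<bar> \<bar>snd n\<bar>" for n :: "int \<times> int"
    define J where "J = (\<Sum>n\<in>F. nat (m n))"
    have mJ: "m n \<le> 2 ^ J * int R" if "n \<in> F" for n
    proof -
      have "nat (m n) \<le> J" unfolding J_def by (rule member_le_sum) (use that \<open>finite F\<close> in auto)
      then have "m n \<le> int J" by linarith
      also have "int J \<le> 2 ^ J" using of_nat_mono[OF less_imp_le[OF less_exp[of J]], where 'a = int] by simp
      also have "\<dots> \<le> 2 ^ J * int R" using R by simp
      finally show ?thesis .
    qed
    have box: "(\<Sum>k\<in>{R..2 * R}. \<Sum>n\<in>F. (norm (y (c k) n))\<^sup>2 * (if m n \<le> 2 ^ j * int R then 1 else 0)) \<le> S (3 * 2 ^ j * R)" for j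
    proof -
      have "1 * int R \<le> 2 ^ j * int R" by (intro mult_right_mono) auto
      then have R2: "int R \<le> 2 ^ j * int R" by simp
      have "(\<Sum>k\<in>{R..2 * R}. \<Sum>n\<in>F. (norm (y (c k) n))\<^sup>2 * (if m n \<le> 2 ^ j * int R then 1 else 0))
        = (\<Sum>k\<in>{R..2 * R}. \<Sum>n\<in>{n\<in>F. m n \<le> 2 ^ j * int R}. (norm (y (c k) n))\<^sup>2)"
        by (rule sum.cong[OF refl], subst sum.inter_filter[OF \<open>finite F\<close>]) (auto intro: sum.cong)
      also have "\<dots> = (\<Sum>k\<in>c ` {R..2 * R}. \<Sum>n\<in>{n\<in>F. m n \<le> 2 ^ j * int R}. (norm (y k n))\<^sup>2)"
        using c(1) by (subst sum.reindex) (auto intro: inj_on_subset)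
      also have "\<dots> \<le> (\<Sum>k\<in>{-int (3 * 2 ^ j * R)..int (3 * 2 ^ j * R)}. \<Sum>n\<in>{n\<in>F. m n \<le> 2 ^ j * int R}. (norm (y k n))\<^sup>2)"
      proof (intro sum_mono2)
        show "c ` {R..2 * R} \<subseteq> {-int (3 * 2 ^ j * R)..int (3 * 2 ^ j * R)}"
        proof (intro image_subsetI)
          fix k assume "k \<in> {R..2 * R}"
          then have "\<bar>c k\<bar> \<le> 3 * int R" using c(2)[of k] R by simp
          also have "\<dots> \<le> int (3 * 2 ^ j * R)" using R2 by simp
          finally show "c k \<in> {-int (3 * 2 ^ j * R)..int (3 * 2 ^ j * R)}" by (simp add: abs_le_iff)
        qed
      qed (auto intro: sum_nonneg)
      also have "\<dots> \<le> S (3 * 2 ^ j * R)"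
        unfolding S_def using R2 by (intro sum_mono sum_mono2) (auto simp: m_def abs_le_iff)
      finally show ?thesis .
    qed
    have "(\<Sum>k\<in>{R..2 * R}. \<Sum>n\<in>F. (norm (y (c k) n))\<^sup>2 / weight (real R) n) \<le>
        (\<Sum>k\<in>{R..2 * R}. \<Sum>n\<in>F. (norm (y (c k) n))\<^sup>2 * (\<Sum>j\<le>J. 4 / 4 ^ j * (if m n \<le> 2 ^ j * int R then 1 else 0)))"
    proof (intro sum_mono)
      fix k n assume "n \<in> F"
      have "1 / weight (real R) n \<le> (\<Sum>j\<le>J. 4 / 4 ^ j * (if m n \<le> 2 ^ j * int R then 1 else 0))"
        unfolding m_def by (rule inverse_weight_le) (use R mJ[OF \<open>n \<in> F\<close>] in \<open>auto simp: m_def\<close>)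
      from mult_left_mono[OF this, of "(norm (y (c k) n))\<^sup>2"]
      show "(norm (y (c k) n))\<^sup>2 / weight (real R) n \<le>
        (norm (y (c k) n))\<^sup>2 * (\<Sum>j\<le>J. 4 / 4 ^ j * (if m n \<le> 2 ^ j * int R then 1 else 0))" by simp
    qed
    also have "\<dots> = (\<Sum>k\<in>{R..2 * R}. \<Sum>n\<in>F. \<Sum>j\<le>J. 4 / 4 ^ j * ((norm (y (c k) n))\<^sup>2 * (if m n \<le> 2 ^ j * int R then 1 else 0)))"
      unfolding sum_distrib_left by (simp only: mult_ac)
    also have "\<dots> = (\<Sum>j\<le>J. \<Sum>k\<in>{R..2 * R}. \<Sum>n\<in>F. 4 / 4 ^ j * ((norm (y (c k) n))\<^sup>2 * (if m n \<le> 2 ^ j * int R then 1 else 0)))"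
      by (subst sum.swap[of _ _ F], subst sum.swap[of _ _ "{R..2 * R}"]) (rule refl)
    also have "\<dots> = (\<Sum>j\<le>J. 4 / 4 ^ j * (\<Sum>k\<in>{R..2 * R}. \<Sum>n\<in>F. (norm (y (c k) n))\<^sup>2 * (if m n \<le> 2 ^ j * int R then 1 else 0)))"
      unfolding sum_distrib_left ..
    also have "\<dots> \<le> (\<Sum>j\<le>J. 4 / 4 ^ j * (\<epsilon> / 24 * real (3 * 2 ^ j * R)))"
    proof (intro sum_mono mult_left_mono)
      fix j
      have "1 * R \<le> 3 * 2 ^ j * R" by (intro mult_right_mono) auto
      then have "R0 \<le> 3 * 2 ^ j * R" using R by linarith
      from order_trans[OF box R0[OF this]]
      show "(\<Sum>k\<in>{R..2 * R}. \<Sum>n\<in>F. (norm (y (c k) n))\<^sup>2 * (if m n \<le> 2 ^ j * int R then 1 else 0))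
        \<le> \<epsilon> / 24 * real (3 * 2 ^ j * R)" .
    qed auto
    also have "\<dots> = (\<Sum>j\<le>J. (\<epsilon> / 2 * real R) * (1 / 2) ^ j)"
    proof (intro sum.cong refl)
      fix j
      have "(4::real) ^ j = 2 ^ j * 2 ^ j" by (simp flip: power_mult_distrib)
      then show "4 / 4 ^ j * (\<epsilon> / 24 * real (3 * 2 ^ j * R)) = (\<epsilon> / 2 * real R) * (1 / 2) ^ j"
        by (simp add: field_simps power_one_over)
    qed
    also have "\<dots> = (\<epsilon> / 2 * real R) * (\<Sum>j\<le>J. (1 / 2) ^ j)"
      by (simp only: sum_distrib_left)
    also have "\<dots> \<le> (\<epsilon> / 2 * real R) * 2"
    proof (rule mult_left_mono)
      have "(\<Sum>j\<le>J. (1 / 2 :: real) ^ j) = 2 - (1 / 2) ^ J"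
        by (induction J) auto
      then show "(\<Sum>j\<le>J. (1 / 2 :: real) ^ j) \<le> 2" by simp
    qed (use \<open>\<epsilon> > 0\<close> in simp)
    finally show "(\<Sum>k\<in>{R..2 * R}. \<Sum>n\<in>F. (norm (y (c k) n))\<^sup>2 / weight (real R) n) \<le> \<epsilon> * real R"
      by simp
  qed
qed

section \<open>Averages along lines in time\<close>

definition line_average :: "(int \<Rightarrow> complex) \<Rightarrow> bool" where
  "line_average f \<longleftrightarrow> (\<forall>\<epsilon>>0. \<exists>R0. \<forall>R\<ge>R0. (\<Sum>k\<in>{-int R..int R}. (norm (f k))\<^sup>2) \<le> \<epsilon> * real R)"

text \<open>A nonzero value would recur at a positive proportion of the times and contribute a sum
  of order R, which the average excludes.\<close>

lemma line_average_periodic_zero: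
  assumes "line_average f" "\<And>k. f (k + 2) = f k"
  shows "f k = 0"
proof -
  have per: "f (k + 2 * int j) = f k" for j
  proof (induction j)
    case (Suc j)
    then show ?case using assms(2)[of "k + 2 * int j"] by (simp add: algebra_simps)
  qed simp
  have "(norm (f k))\<^sup>2 \<le> 0 + \<epsilon>" if "\<epsilon> > 0" for \<epsilon> :: real
  proof -
    have "\<epsilon> / 3 > 0" using that by simp
    then obtain R0 where R0: "\<And>R. R \<ge> R0 \<Longrightarrow> (\<Sum>k\<in>{-int R..int R}. (norm (f k))\<^sup>2) \<le> \<epsilon> / 3 * real R"
      using assms(1) unfolding line_average_def by blast
    \<comment> \<open>\<open>M\<close> counts the recurrences that are used. The choice of
      \<open>R\<close> keeps all of them in the window, and \<open>M \<ge> \<bar>k\<bar>\<close>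
      gives \<open>R \<le> 3 * M\<close>, which explains the third of \<epsilon>.\<close>
    define M where "M = R0 + nat \<bar>k\<bar> + 1"
    define R where "R = nat \<bar>k\<bar> + 2 * M"
    have "real M * (norm (f k))\<^sup>2 = (\<Sum>j<M. (norm (f (k + 2 * int j)))\<^sup>2)"
      by (simp add: per)
    also have "\<dots> = (\<Sum>i\<in>(\<lambda>j. k + 2 * int j) ` {..<M}. (norm (f i))\<^sup>2)"
      by (subst sum.reindex) (auto simp: inj_on_def)
    also have "\<dots> \<le> (\<Sum>i\<in>{-int R..int R}. (norm (f i))\<^sup>2)"
      by (intro sum_mono2) (auto simp: R_def)
    also have "\<dots> \<le> \<epsilon> / 3 * real R"
      by (rule R0) (simp add: R_def M_def)
    also have "\<dots> \<le> \<epsilon> / 3 * (3 * real M)"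
      using that by (intro mult_left_mono) (auto simp: R_def M_def)
    also have "\<dots> = real M * \<epsilon>" by simp
    finally have "real M * (norm (f k))\<^sup>2 \<le> real M * \<epsilon>" .
    moreover have "real M > 0" by (simp add: M_def)
    ultimately show ?thesis by simp
  qed
  then have "(norm (f k))\<^sup>2 \<le> 0" by (rule field_le_epsilon)
  then show ?thesis by simp
qed

lemma line_average_difference:
  assumes "line_average f"
  shows "line_average (\<lambda>k. f (k + 2) - f k)"
  unfolding line_average_def
proof (intro allI impI)
  fix \<epsilon> :: real assume "\<epsilon> > 0"
  then have "\<epsilon> / 12 > 0" by simp
  then obtain R0 where R0: "\<And>R. R \<ge> R0 \<Longrightarrow> (\<Sum>k\<in>{-int R..int R}. (norm (f k))\<^sup>2) \<le> \<epsilon> / 12 * real R"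
    using assms unfolding line_average_def by blast
  show "\<exists>R0. \<forall>R\<ge>R0. (\<Sum>k\<in>{-int R..int R}. (norm (f (k + 2) - f k))\<^sup>2) \<le> \<epsilon> * real R"
  proof (intro exI[of _ "R0 + 1"] allI impI)
    fix R assume R: "R0 + 1 \<le> R"
    have tri: "(norm (a - b))\<^sup>2 \<le> 2 * (norm a)\<^sup>2 + 2 * (norm b)\<^sup>2" for a b :: complex
    proof -
      have "(norm (a - b))\<^sup>2 \<le> (norm a + norm b)\<^sup>2"
        by (intro power_mono norm_triangle_ineq4) auto
      then show ?thesis
        using sum_squares_bound[of "norm a" "norm b"] by (simp add: power2_sum)
    qed
    have "(\<Sum>k\<in>{-int R..int R}. (norm (f (k + 2) - f k))\<^sup>2) \<le>
        2 * (\<Sum>k\<in>{-int R..int R}. (norm (f (k + 2)))\<^sup>2) + 2 * (\<Sum>k\<in>{-int R..int R}. (norm (f k))\<^sup>2)"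
      unfolding sum_distrib_left sum.distrib[symmetric] by (intro sum_mono tri)
    also have "(\<Sum>k\<in>{-int R..int R}. (norm (f (k + 2)))\<^sup>2) = (\<Sum>k\<in>(\<lambda>k. k + 2) ` {-int R..int R}. (norm (f k))\<^sup>2)"
      by (subst sum.reindex) auto
    also have "2 * \<dots> \<le> 2 * (\<Sum>k\<in>{-int (R + 2)..int (R + 2)}. (norm (f k))\<^sup>2)"
      by (intro mult_left_mono sum_mono2) auto
    also have "\<dots> \<le> 2 * (\<epsilon> / 12 * real (R + 2))"
      by (intro mult_left_mono R0) (use R in auto)
    also have "2 * (\<Sum>k\<in>{-int R..int R}. (norm (f k))\<^sup>2) \<le> 2 * (\<epsilon> / 12 * real R)"
      by (intro mult_left_mono R0) (use R in auto)
    also have "2 * (\<epsilon> / 12 * real (R + 2)) + 2 * (\<epsilon> / 12 * real R) = \<epsilon> / 12 * (4 * real R + 4)"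
      by (simp add: field_simps)
    also have "\<dots> \<le> \<epsilon> / 12 * (12 * real R)"
      using \<open>\<epsilon> > 0\<close> R by (intro mult_left_mono) auto
    finally show "(\<Sum>k\<in>{-int R..int R}. (norm (f (k + 2) - f k))\<^sup>2) \<le> \<epsilon> * real R"
      by simp
  qed
qed

text \<open>Step-two differences inherit small averages. Hence each iterated difference whose own
  difference vanishes is periodic and therefore zero, and four such descents end at
  \<open>f\<close>.\<close>

lemma line_average_fourth_difference:
  assumes f: "line_average f"
    and "\<And>k. f (k + 8) - 4 * f (k + 6) + 6 * f (k + 4) - 4 * f (k + 2) + f k = 0"
  shows "f k = 0"
proof -
  define \<Delta> where "\<Delta> f k = f (k + 2) - f k" for f :: "int \<Rightarrow> complex" and k
  have av: "line_average (\<Delta> g)" if "line_average g" for g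
    using line_average_difference[OF that] by (simp add: \<Delta>_def[abs_def])
  have zero: "g k = 0" if g: "line_average g" and per: "\<And>k. \<Delta> g k = 0" for g k
  proof (rule line_average_periodic_zero[OF g])
    show "g (k + 2) = g k" for k using per[of k] unfolding \<Delta>_def by simp
  qed
  note av1 = av[OF f] and av2 = av[OF av[OF f]] and av3 = av[OF av[OF av[OF f]]]
  have "\<Delta> (\<Delta> (\<Delta> (\<Delta> f))) k = 0" for k
    using assms(2)[of k] by (simp add: \<Delta>_def algebra_simps)
  from zero[OF av3 this] have "\<Delta> (\<Delta> (\<Delta> f)) k = 0" for k .
  from zero[OF av2 this] have "\<Delta> (\<Delta> f) k = 0" for k .
  from zero[OF av1 this] have "\<Delta> f k = 0" for k .
  from zero[OF f this] show ?thesis .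
qed

lemma line_average_if_vanishing_average:
  assumes "vanishing_average y"
  shows "line_average (\<lambda>k. y k n)"
  unfolding line_average_def
proof (intro allI impI)
  fix \<epsilon> :: real assume "\<epsilon> > 0"
  then obtain R0 where R0: "\<And>R. R \<ge> R0 \<Longrightarrow>
     (\<Sum>k\<in>{-int R..int R}. \<Sum>n\<in>{-int R..int R} \<times> {-int R..int R}. (norm (y k n))\<^sup>2) \<le> \<epsilon> * real R"
    using assms unfolding vanishing_average_def by blast
  show "\<exists>R0. \<forall>R\<ge>R0. (\<Sum>k\<in>{-int R..int R}. (norm (y k n))\<^sup>2) \<le> \<epsilon> * real R"
  proof (intro exI[of _ "R0 + nat \<bar>fst n\<bar> + nat \<bar>snd n\<bar>"] allI impI)
    fix R assume R: "R0 + nat \<bar>fst n\<bar> + nat \<bar>snd n\<bar> \<le> R"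
    have "n \<in> {-int R..int R} \<times> {-int R..int R}"
      using R by (cases n) auto
    then have "(\<Sum>k\<in>{-int R..int R}. (norm (y k n))\<^sup>2) \<le>
        (\<Sum>k\<in>{-int R..int R}. \<Sum>n\<in>{-int R..int R} \<times> {-int R..int R}. (norm (y k n))\<^sup>2)"
      by (intro sum_mono member_le_sum) auto
    also have "\<dots> \<le> \<epsilon> * real R" using R by (intro R0) simp
    finally show "(\<Sum>k\<in>{-int R..int R}. (norm (y k n))\<^sup>2) \<le> \<epsilon> * real R" .
  qed
qed

context lattice_symbol
begin

text \<open>By the recurrence \<open>symp\<^sup>2 - 4\<close> acts as the second difference \<open>y\<^sub>k\<^sub>+\<^sub>2 - 2 y\<^sub>k + y\<^sub>k\<^sub>-\<^sub>2\<close>, so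
  annihilation by \<open>edge_poly\<close> says that a fourth difference in time vanishes.\<close>

theorem homogeneous_solution_zero:
  fixes y :: "int \<Rightarrow> int \<times> int \<Rightarrow> complex"
  assumes y: "\<And>k n. y (k + 1) n + y (k - 1) n = hop (y k) n"
    and avg: "vanishing_average y"
  shows "y k n = 0"
proof -
  have half: "half_small (\<lambda>j. y (k + int j))" "half_small (\<lambda>j. y (k - int j))" for k
    by (rule half_small_if_vanishing_average[OF avg, where K = "nat \<bar>k\<bar>"]; simp add: inj_def)+
  have shift: "pair (y k) (symp * a) = pair (y (k + 1)) a + pair (y (k - 1)) a" for k a
  proof -
    have "hop (y k) = (\<lambda>n. y (k + 1) n + y (k - 1) n)"
      using y by auto
    then show ?thesis by (simp add: pair_symp pair_add_left)
  qed
  have "y (k + 8) n - 4 * y (k + 6) n + 6 * y (k + 4) n - 4 * y (k + 2) n + y k n = 0" for k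
  proof -
    have sq: "pair (y k) ((symp * symp - 4) * a) = pair (y (k + 2)) a - 2 * pair (y k) a + pair (y (k - 2)) a" for k a
    proof -
      have "(symp * symp - 4) * a = symp * (symp * a) - (a + a + a + a)"
        by (simp add: algebra_simps)
      then show ?thesis
        by (simp only: pair_diff_right pair_add_right shift) (simp add: algebra_simps)
    qed
    have "edge_poly * Poly_Mapping.single n 1 = (symp * symp - 4) * ((symp * symp - 4) * Poly_Mapping.single n 1)"
      by (simp add: edge_poly_def power2_eq_square mult_ac)
    with homogeneous_pair_edge_poly[where y = y and k = "k + 4" and a = "Poly_Mapping.single n 1", OF y half]
    have "pair (y (k + 4)) ((symp * symp - 4) * ((symp * symp - 4) * Poly_Mapping.single n 1)) = 0"
      by simp
    then have "y (k + 4 + 2 + 2) n - 2 * y (k + 4 + 2) n + y (k + 4 + 2 - 2) n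
        - 2 * (y (k + 4 + 2) n - 2 * y (k + 4) n + y (k + 4 - 2) n)
        + (y (k + 4 - 2 + 2) n - 2 * y (k + 4 - 2) n + y (k + 4 - 2 - 2) n) = 0"
      unfolding sq pair_single mult_1 .
    then show ?thesis by (simp add: algebra_simps)
  qed
  then show ?thesis
    by (rule line_average_fourth_difference[OF line_average_if_vanishing_average[OF avg]])
qed

end

section \<open>Energies inside the spectrum\<close>

lemma char_sum_derivative1:
  "((\<lambda>t. \<Sum>n\<in>S. c n * char n (t, s)) has_vector_derivative
    (\<Sum>n\<in>S. c n * (\<i> * of_int (fst n) * char n (t, s)))) (at t)"
proof (intro has_vector_derivative_sum has_vector_derivative_mult_right)
  fix n
  show "((\<lambda>t. char n (t, s)) has_vector_derivative \<i> * of_int (fst n) * char n (t, s)) (at t)"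
    using ev_has_derivative1[of "Poly_Mapping.single n 1" s t] by (simp add: ev_def grad1_def)
qed

lemma char_sum_derivative2:
  "((\<lambda>s. \<Sum>n\<in>S. c n * char n (t, s)) has_vector_derivative
    (\<Sum>n\<in>S. c n * (\<i> * of_int (snd n) * char n (t, s)))) (at s)"
proof (intro has_vector_derivative_sum has_vector_derivative_mult_right)
  fix n
  show "((\<lambda>s. char n (t, s)) has_vector_derivative \<i> * of_int (snd n) * char n (t, s)) (at s)"
    using ev_has_derivative2[of "Poly_Mapping.single n 1" t s] by (simp add: ev_def grad2_def)
qed

lemma derivative_zero_on_open:
  fixes f :: "real \<Rightarrow> complex"
  assumes "(f has_vector_derivative D) (at t)" "open T" "t \<in> T" "\<And>x. x \<in> T \<Longrightarrow> f x = 0"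
  shows "D = 0"
proof -
  have "((\<lambda>_. 0) has_vector_derivative D) (at t)"
    by (rule has_vector_derivative_transform_within_open[OF assms(1-3)]) (use assms(4) in auto)
  moreover have "((\<lambda>_. 0) has_vector_derivative (0 :: complex)) (at t)"
    by (rule has_vector_derivative_const)
  ultimately show ?thesis by (rule vector_derivative_unique_at)
qed

text \<open>After division by \<open>char m\<close> the term of \<open>m\<close> is constant and
  disappears under differentiation in either angle. The rest vanishes on the same open set with
  coefficients \<open>c n\<close> times a coordinate of \<open>n - m\<close>, up to the factor \<i>.
  For \<open>n \<noteq> m\<close> one coordinate is nonzero, so induction gives
  \<open>c n = 0\<close>.\<close>

lemma chars_independent_on_open:
  assumes "finite S" "open U" "U \<noteq> {}" "\<And>x. x \<in> U \<Longrightarrow> (\<Sum>n\<in>S. c n * char n x) = 0"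
  shows "\<forall>n\<in>S. c n = 0"
  using assms(1,4)
proof (induction S arbitrary: c rule: finite_induct)
  case (insert m S)
  define h where "h x = (\<Sum>n\<in>insert m S. c n * char (n - m) x)" for x
  have h: "h x = 0" if "x \<in> U" for x
  proof -
    have "h x = char (- m) x * (\<Sum>n\<in>insert m S. c n * char n x)"
      unfolding h_def sum_distrib_left
      by (intro sum.cong refl) (use char_add[of "- m" _ x] in \<open>simp add: algebra_simps\<close>)
    then show ?thesis using insert.prems[OF that] by simp
  qed
  have reindex: "(\<Sum>n\<in>insert m S. c n * char (n - m) x) = (\<Sum>j\<in>(\<lambda>n. n - m) ` insert m S. c (j + m) * char j x)" for x
    by (subst sum.reindex) (auto simp: inj_on_def)
  have slice: "open {t. (t, s) \<in> U}" "open {t. (s, t) \<in> U}" for s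
    using open_vimage[OF \<open>open U\<close> continuous_on_Pair[OF continuous_on_id continuous_on_const[of UNIV s]]]
      open_vimage[OF \<open>open U\<close> continuous_on_Pair[OF continuous_on_const[of UNIV s] continuous_on_id]]
    by (auto simp: vimage_def)
  have zero: "c n = 0" if "n \<in> S" for n
  proof -
    have mult_char: "(\<Sum>n\<in>S. (c n * k n) * char n x) = 0"
      if "(\<Sum>n\<in>insert m S. c n * (k n * char (n - m) x)) = 0" "k m = 0" for k x
    proof -
      have cm: "char n x = char m x * char (n - m) x" for n
        using char_add[of m "n - m" x] by simp
      have "(\<Sum>n\<in>S. (c n * k n) * char n x) = char m x * (\<Sum>n\<in>S. c n * (k n * char (n - m) x))"
        unfolding sum_distrib_left
        by (intro sum.cong refl) (subst cm, simp add: mult_ac)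
      also have "(\<Sum>n\<in>S. c n * (k n * char (n - m) x)) = 0"
        using that insert.hyps by simp
      finally show ?thesis by simp
    qed
    have "(\<Sum>n\<in>S. (c n * (\<i> * of_int (fst (n - m)))) * char n x) = 0" if "x \<in> U" for x
    proof (rule mult_char)
      obtain t s where x: "x = (t, s)" by (cases x)
      have "(\<Sum>j\<in>(\<lambda>n. n - m) ` insert m S. c (j + m) * (\<i> * of_int (fst j) * char j (t, s))) = 0"
        by (rule derivative_zero_on_open[OF char_sum_derivative1 slice(1)[of s]])
          (use that h x in \<open>auto simp: h_def reindex simp del: sum.insert\<close>)
      then show "(\<Sum>n\<in>insert m S. c n * (\<i> * of_int (fst (n - m)) * char (n - m) x)) = 0"
        unfolding x by (subst (asm) sum.reindex) (auto simp: inj_on_def simp del: sum.insert)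
    qed simp
    from insert.IH[OF this] that have 1: "c n * (\<i> * of_int (fst (n - m))) = 0" by blast
    have "(\<Sum>n\<in>S. (c n * (\<i> * of_int (snd (n - m)))) * char n x) = 0" if "x \<in> U" for x
    proof (rule mult_char)
      obtain t s where x: "x = (t, s)" by (cases x)
      have "(\<Sum>j\<in>(\<lambda>n. n - m) ` insert m S. c (j + m) * (\<i> * of_int (snd j) * char j (t, s))) = 0"
        by (rule derivative_zero_on_open[OF char_sum_derivative2 slice(2)[of t]])
          (use that h x in \<open>auto simp: h_def reindex simp del: sum.insert\<close>)
      then show "(\<Sum>n\<in>insert m S. c n * (\<i> * of_int (snd (n - m)) * char (n - m) x)) = 0"
        unfolding x by (subst (asm) sum.reindex) (auto simp: inj_on_def simp del: sum.insert)
    qed simp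
    from insert.IH[OF this] that have 2: "c n * (\<i> * of_int (snd (n - m))) = 0" by blast
    have "n \<noteq> m" using that insert.hyps by auto
    then show "c n = 0" using 1 2 by (auto simp: prod_eq_iff)
  qed
  moreover have "c m = 0"
  proof -
    obtain x where "x \<in> U" using \<open>U \<noteq> {}\<close> by auto
    have "(\<Sum>n\<in>S. c n * char n x) = 0" using zero by simp
    then have "c m * char m x = 0" using insert.prems[OF \<open>x \<in> U\<close>] insert.hyps by simp
    moreover have "char m x \<noteq> 0" using norm_char[of m x] by (metis norm_zero zero_neq_one)
    ultimately show ?thesis by simp
  qed
  ultimately show ?case by simp
qed simp

lemma ev_one: "ev 1 x = 1"
  by (simp add: ev_def pair_def)

text \<open>A \<open>C\<^sup>1\<close> weight supported where \<open>|t| \<le> 2\<close>, that is, where all solutions of the scalar recurrence are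
  bounded.\<close>

definition bump :: "real \<Rightarrow> real" where
  "bump t = (rt (2 - t) * rt (2 + t)) ^ 3"

lemma continuous_on_bump [continuous_intros]:
  "continuous_on S f \<Longrightarrow> continuous_on S (\<lambda>x. bump (f x))"
  unfolding bump_def by (intro continuous_intros)

lemma bump_nonneg: "bump t \<ge> 0"
  by (simp add: bump_def rt_nonneg)

lemma bump_pos: "\<bar>t\<bar> < 2 \<Longrightarrow> bump t > 0"
  by (auto simp: bump_def rt_def)

lemma bump_has_derivative:
  "((\<lambda>t. of_real (bump t)) has_vector_derivative of_real (- 3 * t * (rt (2 - t) * rt (2 + t)))) (at t)"
proof -
  have eq: "bump = (\<lambda>t. - Im (disc_root t ^ 3))"
    unfolding disc_root_cube_eq by (simp add: bump_def[abs_def] power_mult_distrib)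
  have "((\<lambda>t. - Im (disc_root t ^ 3)) has_vector_derivative - Im (3 * of_real t * disc_root t)) (at t)"
    by (intro has_vector_derivative_minus bounded_linear.has_vector_derivative[OF bounded_linear_Im]
        disc_root_cube_has_derivative)
  then have "(bump has_real_derivative - Im (3 * of_real t * disc_root t)) (at t)"
    unfolding has_real_derivative_iff_has_vector_derivative eq .
  from has_vector_derivative_of_real[OF this] show ?thesis
    by (simp add: disc_root_def)
qed

context lattice_symbol
begin

text \<open>Finitely supported substitutes \<open>X i\<close> for \<open>bump\<close> of the
  operator, which itself need not be finitely supported; the derivative is approximated as well so
  that \<open>C1_near\<close> applies.\<close>

definition bump_approx :: "(nat \<Rightarrow> int \<times> int \<Rightarrow>\<^sub>0 complex) \<Rightarrow> (nat \<Rightarrow> complex poly) \<Rightarrow> bool" where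
  "bump_approx X P \<longleftrightarrow> (\<forall>i x. ev (X i) x = poly (P i) (of_real (symb x))) \<and>
    (\<forall>i t. \<bar>t\<bar> \<le> sbound \<longrightarrow> norm (poly (P i) (of_real t) - of_real (bump t)) \<le> 1 / real (Suc i)) \<and>
    (\<forall>i t. \<bar>t\<bar> \<le> sbound \<longrightarrow> norm (poly (pderiv (P i)) (of_real t) - of_real (- 3 * t * (rt (2 - t) * rt (2 + t)))) \<le> 1 / real (Suc i))"

lemma ex_bump_approximation: "\<exists>X P. bump_approx X P"
proof -
  have "\<exists>P :: complex poly. (\<forall>t. \<bar>t\<bar> \<le> sbound \<longrightarrow> norm (poly P (of_real t) - of_real (bump t)) \<le> 1 / real (Suc i)) \<and>
    (\<forall>t. \<bar>t\<bar> \<le> sbound \<longrightarrow> norm (poly (pderiv P) (of_real t) - of_real (- 3 * t * (rt (2 - t) * rt (2 + t)))) \<le> 1 / real (Suc i))" for i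
  proof -
    have c: "continuous_on {-sbound..sbound} (\<lambda>t. of_real (- 3 * t * (rt (2 - t) * rt (2 + t))) :: complex)"
      by (intro continuous_intros)
    have p: "1 / real (Suc i) > 0" "sbound \<ge> 0" by (auto simp: sbound_def)
    show ?thesis by (rule C1_poly_approximation[OF bump_has_derivative c p]) blast
  qed
  then obtain P :: "nat \<Rightarrow> complex poly" where P: "\<And>i. (\<forall>t. \<bar>t\<bar> \<le> sbound \<longrightarrow> norm (poly (P i) (of_real t) - of_real (bump t)) \<le> 1 / real (Suc i)) \<and>
    (\<forall>t. \<bar>t\<bar> \<le> sbound \<longrightarrow> norm (poly (pderiv (P i)) (of_real t) - of_real (- 3 * t * (rt (2 - t) * rt (2 + t)))) \<le> 1 / real (Suc i))"
    by metis
  have "\<exists>z. \<forall>x. ev z x = poly (P i) (of_real (symb x))" for i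
    using ex_poly_symp[of "P i" 1] by (simp add: ev_one)
  then obtain X where "\<And>i x. ev (X i) x = poly (P i) (of_real (symb x))"
    by metis
  with P show ?thesis unfolding bump_approx_def by (intro exI[of _ X] exI[of _ P]) auto
qed

text \<open>The Wronskian with the solution that is 0 at time 0 and \<open>bump\<close> at time 1 is
  the pairing in question, as the term with \<open>y 1\<close> drops out. That solution is bounded,
  since \<open>bump\<close> vanishes where the recurrence has unbounded solutions; hence a single
  half line suffices.\<close>

lemma half_line_bump_limit:
  fixes y :: "nat \<Rightarrow> int \<times> int \<Rightarrow> complex"
  assumes y: "\<And>k n. y (Suc (Suc k)) n + y k n = hop (y (Suc k)) n" and small: "half_small y"
    and X: "\<And>i x. ev (X i) x = poly (P i) (of_real (symb x))"
    and P: "\<And>i t. \<bar>t\<bar> \<le> sbound \<Longrightarrow> norm (poly (P i) (of_real t) - of_real (bump t)) \<le> 1 / real (Suc i)"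
    "\<And>i t. \<bar>t\<bar> \<le> sbound \<Longrightarrow> norm (poly (pderiv (P i)) (of_real t) - of_real (- 3 * t * (rt (2 - t) * rt (2 + t)))) \<le> 1 / real (Suc i)"
  shows "(\<lambda>i. pair (y 0) (X i * a)) \<longlonglongrightarrow> 0"
proof -
  define w where "w t = rt (2 - t) * rt (2 + t)" for t
  \<comment> \<open>For t = 2 cos \<theta> with \<theta> in (0, pi), \<open>small_root\<close> is
    exp(\<i>\<theta>) and w = 2 sin \<theta>, so \<open>Z j\<close> is 8 sin^2 \<theta> sin(j
    \<theta>), with value w^3 at time 1. Outside (-2, 2) it is 0.\<close>
  define Z where "Z j t = (of_real (2 * (w t)\<^sup>2 * Im (small_root t ^ j)) :: complex)" for j t
  \<comment> \<open>The derivative of \<open>Z j\<close>, from (w^2)' = -2 t and \<theta>' = -1 / w;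
    the factor w^2 absorbs the singularity of \<theta>'.\<close>
  define Z' where "Z' j t = (of_real (- 4 * t * Im (small_root t ^ j) - 2 * w t * (real j * Re (small_root t ^ j))) :: complex)" for j t
  define r where "r = sbound"
  have "r \<ge> 0" by (simp add: r_def sbound_def)
  have pow: "small_root t ^ Suc (Suc j) = of_real t * small_root t ^ Suc j - small_root t ^ j" for j t
  proof -
    have "small_root t ^ Suc (Suc j) = small_root t ^ j * (small_root t * small_root t)"
      by (simp add: mult_ac)
    then show ?thesis unfolding small_root_square by (simp add: algebra_simps)
  qed
  have rec: "Z (Suc (Suc j)) t = of_real t * Z (Suc j) t - Z j t" for j t
    unfolding Z_def pow of_real_mult[symmetric] of_real_diff[symmetric] of_real_eq_iff
    by (simp only: minus_complex.sel Im_complex_of_real Re_complex_of_real times_complex.sel) (simp add: algebra_simps)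
  have ws: "of_real (w t) * (2 * small_root t - of_real t) = \<i> * of_real ((w t)\<^sup>2)" for t
    by (cases t rule: disc_root_cases)
      (auto simp: w_def small_root_def power2_eq_square complex_eq_iff add.commute)
  have rec': "Z' (Suc (Suc j)) t = Z (Suc j) t + of_real t * Z' (Suc j) t - Z' j t" for j t
  proof -
    define V where "V = small_root t ^ Suc j"
    define V0 where "V0 = small_root t ^ j"
    have p2: "small_root t ^ Suc (Suc j) = of_real t * V - V0"
      unfolding pow V_def V0_def ..
    have VL: "of_real t * V - V0 = V * small_root t"
      unfolding V_def V0_def pow[symmetric] by simp
    have "w t * Re (2 * (of_real t * V - V0) - of_real t * V) = Re (of_real (w t) * (2 * small_root t - of_real t) * V)"
      unfolding VL by (simp add: algebra_simps)
    also have "\<dots> = - ((w t)\<^sup>2 * Im V)"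
      unfolding ws by simp
    finally have key: "w t * (t * Re V - 2 * Re V0) = - ((w t)\<^sup>2 * Im V)"
      by (simp add: algebra_simps)
    have "- 4 * t * Im (of_real t * V - V0) - 2 * w t * (real (Suc (Suc j)) * Re (of_real t * V - V0)) =
      2 * (w t)\<^sup>2 * Im V + t * (- 4 * t * Im V - 2 * w t * (real (Suc j) * Re V)) - (- 4 * t * Im V0 - 2 * w t * (real j * Re V0))"
      using key by (simp add: algebra_simps)
    then show ?thesis
      unfolding Z_def Z'_def p2 V_def[symmetric] V0_def[symmetric]
      unfolding of_real_mult[symmetric] of_real_diff[symmetric] of_real_add[symmetric] of_real_eq_iff .
  qed
  have w2: "(w t)\<^sup>2 \<le> 4" for t
  proof -
    have "(w t)\<^sup>2 = max 0 (2 - t) * max 0 (2 + t)"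
      unfolding rt_square[symmetric] by (simp add: w_def power2_eq_square mult_ac)
    also have "\<dots> \<le> 4" using zero_le_square[of t] by (auto simp: max_def algebra_simps mult_nonneg_nonpos)
    finally show ?thesis .
  qed
  have w0: "0 \<le> w t" "w t \<le> 2" for t
    using w2[of t] power2_le_imp_le[of "w t" 2] by (auto simp: w_def rt_nonneg)
  have L: "\<bar>Re (small_root t ^ j)\<bar> \<le> 1" "\<bar>Im (small_root t ^ j)\<bar> \<le> 1" for t j
  proof -
    have "norm (small_root t ^ j) \<le> 1"
      using norm_small_root[of t] by (simp add: norm_power power_le_one)
    then show "\<bar>Re (small_root t ^ j)\<bar> \<le> 1" "\<bar>Im (small_root t ^ j)\<bar> \<le> 1"
      using abs_Re_le_cmod[of "small_root t ^ j"] abs_Im_le_cmod[of "small_root t ^ j"] by linarith+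
  qed
  have ZC: "norm (Z j t) \<le> 8 + 4 * r" for j t
  proof -
    have "norm (Z j t) = 2 * (w t)\<^sup>2 * \<bar>Im (small_root t ^ j)\<bar>"
      unfolding Z_def norm_of_real by (simp add: abs_mult)
    also have "\<dots> \<le> 2 * 4 * 1" using w2[of t] L(2)[of t j] by (intro mult_mono) auto
    finally show ?thesis using \<open>r \<ge> 0\<close> by simp
  qed
  have Z'C: "norm (Z' j t) \<le> (8 + 4 * r) * (1 + real j)" if "\<bar>t\<bar> \<le> r" for j t
  proof -
    have "norm (Z' j t) \<le> \<bar>- 4 * t * Im (small_root t ^ j)\<bar> + \<bar>2 * w t * (real j * Re (small_root t ^ j))\<bar>"
      unfolding Z'_def norm_of_real by (rule abs_triangle_ineq4)
    also have "\<dots> = 4 * \<bar>t\<bar> * \<bar>Im (small_root t ^ j)\<bar> + 2 * w t * (real j * \<bar>Re (small_root t ^ j)\<bar>)"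
      using w0 by (simp add: abs_mult)
    also have "\<dots> \<le> 4 * r * 1 + 2 * 2 * (real j * 1)"
      using that L w0 \<open>r \<ge> 0\<close> by (intro add_mono mult_mono) auto
    also have "\<dots> \<le> (8 + 4 * r) * (1 + real j)"
      using \<open>r \<ge> 0\<close> by (simp add: algebra_simps)
    finally show ?thesis .
  qed
  have Z0: "Z 0 t = 0" "Z' 0 t = 0" for t by (auto simp: Z_def Z'_def)
  have Im1: "w t * Im (small_root t) = (w t)\<^sup>2 / 2" for t
    using arg_cong[OF ws[of t], of Im] by (simp add: small_root_def algebra_simps power2_eq_square)
  have Z1: "Z 1 t = of_real (bump t)" for t
  proof -
    have "2 * (w t)\<^sup>2 * Im (small_root t) = 2 * w t * (w t * Im (small_root t))"
      by (simp add: power2_eq_square)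
    also have "\<dots> = bump t" unfolding Im1 by (simp add: bump_def w_def power2_eq_square power3_eq_cube)
    finally show ?thesis by (simp add: Z_def)
  qed
  have Z'1: "Z' 1 t = of_real (- 3 * t * (rt (2 - t) * rt (2 + t)))" for t
  proof (cases t rule: disc_root_cases)
    case 1
    then show ?thesis by (simp add: Z'_def w_def small_root_def)
  next
    case 2
    then show ?thesis by (simp add: Z'_def w_def small_root_def)
  next
    case 3
    then show ?thesis by (simp add: Z'_def w_def small_root_def field_simps)
  qed
  show ?thesis
  proof (rule LIMSEQ_I)
    fix \<epsilon> :: real assume "\<epsilon> > 0"
    then have "\<epsilon> / 2 > 0" by simp
    have "\<exists>\<delta>>0. pairing_bound (y 0) (y 1) a (Z 0) (Z' 0) (Z 1) (Z' 1) \<delta> (\<epsilon> / 2)"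
      by (rule half_line_pairing_small[where y = y and Z = Z and Z' = Z' and C = "8 + 4 * r", OF y small rec rec'])
        (use ZC Z'C \<open>\<epsilon> / 2 > 0\<close> in \<open>auto simp: r_def\<close>)
    then obtain \<delta> where \<delta>: "\<delta> > 0" "pairing_bound (y 0) (y 1) a (Z 0) (Z' 0) (Z 1) (Z' 1) \<delta> (\<epsilon> / 2)"
      by blast
    obtain i0 where i0: "1 / real (Suc i0) < \<delta>" using nat_approx_posE[OF \<delta>(1)] .
    show "\<exists>no. \<forall>i\<ge>no. norm (pair (y 0) (X i * a) - 0) < \<epsilon>"
    proof (intro exI[of _ i0] allI impI)
      fix i assume "i0 \<le> i"
      then have i: "1 / real (Suc i) \<le> \<delta>"
        using i0 frac_le[of 1 1 "real (Suc i0)" "real (Suc i)"] by simp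
      have "norm (pair (y 0) (X i * a) - pair (y 1) 0) \<le> \<epsilon> / 2"
      proof (rule pairing_boundD[OF \<delta>(2), where ?f0.0 = "\<lambda>_. 0" and ?g0.0 = "\<lambda>_. 0" and
            ?f1.0 = "\<lambda>t. poly (P i) (of_real t)" and ?g1.0 = "\<lambda>t. poly (pderiv (P i)) (of_real t)"])
        show "ev (X i * a) x = poly (P i) (of_real (symb x)) * ev a x" for x
          by (simp add: ev_mult X)
        show "C1_near (Z 0) (Z' 0) \<delta> (\<lambda>_. 0) (\<lambda>_. 0)"
          using \<delta>(1) by (simp add: C1_near_def Z0)
        show "C1_near (Z 1) (Z' 1) \<delta> (\<lambda>t. poly (P i) (of_real t)) (\<lambda>t. poly (pderiv (P i)) (of_real t))"
          unfolding C1_near_def Z1 Z'1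
          using order_trans[OF P(1) i] order_trans[OF P(2) i] poly_of_real_has_derivative by blast
      qed simp
      then show "norm (pair (y 0) (X i * a) - 0) < \<epsilon>" using \<open>\<epsilon> > 0\<close> by simp
    qed
  qed
qed

end

lemma vanishing_average_diff:
  assumes "vanishing_average y" "vanishing_average z"
  shows "vanishing_average (\<lambda>k n. y k n - z k n)"
  unfolding vanishing_average_def
proof (intro allI impI)
  fix \<epsilon> :: real assume "\<epsilon> > 0"
  then have "\<epsilon> / 4 > 0" by simp
  define S where "S u R = (\<Sum>k\<in>{-int R..int R}. \<Sum>n\<in>{-int R..int R} \<times> {-int R..int R}. (norm (u k n :: complex))\<^sup>2)" for u R
  obtain R1 where R1: "\<And>R. R \<ge> R1 \<Longrightarrow> S y R \<le> \<epsilon> / 4 * real R"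
    using assms(1) \<open>\<epsilon> / 4 > 0\<close> unfolding vanishing_average_def S_def by blast
  obtain R2 where R2: "\<And>R. R \<ge> R2 \<Longrightarrow> S z R \<le> \<epsilon> / 4 * real R"
    using assms(2) \<open>\<epsilon> / 4 > 0\<close> unfolding vanishing_average_def S_def by blast
  have tri: "(norm (a - b))\<^sup>2 \<le> 2 * (norm a)\<^sup>2 + 2 * (norm b)\<^sup>2" for a b :: complex
  proof -
    have "(norm (a - b))\<^sup>2 \<le> (norm a + norm b)\<^sup>2"
      by (intro power_mono norm_triangle_ineq4) auto
    then show ?thesis
      using sum_squares_bound[of "norm a" "norm b"] by (simp add: power2_sum)
  qed
  have "S (\<lambda>k n. y k n - z k n) R \<le> \<epsilon> * real R" if "R \<ge> max R1 R2" for R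
  proof -
    have "S (\<lambda>k n. y k n - z k n) R \<le> 2 * S y R + 2 * S z R"
      unfolding S_def sum_distrib_left sum.distrib[symmetric] by (intro sum_mono tri)
    also have "\<dots> \<le> 2 * (\<epsilon> / 4 * real R) + 2 * (\<epsilon> / 4 * real R)"
      using that by (intro add_mono mult_left_mono R1 R2) auto
    finally show ?thesis by simp
  qed
  then show "\<exists>R0. \<forall>R\<ge>R0. (\<Sum>k\<in>{-int R..int R}. \<Sum>n\<in>{-int R..int R} \<times> {-int R..int R}. (norm (y k n - z k n))\<^sup>2) \<le> \<epsilon> * real R"
    unfolding S_def by blast
qed

lemma vanishing_average_if_summable:
  assumes "(\<lambda>(k, n). (norm (y k n))\<^sup>2) summable_on UNIV"
  shows "vanishing_average y"
  unfolding vanishing_average_def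
proof (intro allI impI)
  fix \<epsilon> :: real assume "\<epsilon> > 0"
  define T where "T = infsum (\<lambda>(k, n). (norm (y k n))\<^sup>2) UNIV"
  define R0 where "R0 = nat \<lceil>T / \<epsilon>\<rceil>"
  show "\<exists>R0. \<forall>R\<ge>R0. (\<Sum>k\<in>{-int R..int R}. \<Sum>n\<in>{-int R..int R} \<times> {-int R..int R}. (norm (y k n))\<^sup>2) \<le> \<epsilon> * real R"
  proof (intro exI[of _ R0] allI impI)
    fix R assume "R0 \<le> R"
    have "(\<Sum>k\<in>{-int R..int R}. \<Sum>n\<in>{-int R..int R} \<times> {-int R..int R}. (norm (y k n))\<^sup>2) =
        (\<Sum>(k, n)\<in>{-int R..int R} \<times> ({-int R..int R} \<times> {-int R..int R}). (norm (y k n))\<^sup>2)"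
      by (rule sum.cartesian_product)
    also have "\<dots> \<le> T"
      unfolding T_def by (rule finite_sum_le_infsum[OF assms]) auto
    also have "T / \<epsilon> \<le> real R" using \<open>R0 \<le> R\<close> unfolding R0_def by linarith
    then have "T \<le> \<epsilon> * real R" using \<open>\<epsilon> > 0\<close> by (simp add: field_simps)
    finally show "(\<Sum>k\<in>{-int R..int R}. \<Sum>n\<in>{-int R..int R} \<times> {-int R..int R}. (norm (y k n))\<^sup>2) \<le> \<epsilon> * real R" .
  qed
qed

lemma mean_diff:
  assumes "continuous_on torus F" "continuous_on torus G"
  shows "mean (\<lambda>x. F x - G x) = mean F - mean G"
  unfolding mean_def using assms
  by (subst integral_diff) (auto intro: integrable_on_torus simp: diff_divide_distrib)

lemma ev_sum: "ev (\<Sum>i\<in>S. a i) x = (\<Sum>i\<in>S. ev (a i) x)"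
  by (induction S rule: infinite_finite_induct) (auto simp: ev_add)

text \<open>In the expanded product the mean of \<open>char (m - n)\<close> selects the diagonal.
  The sign in \<open>char (- n)\<close> is due to the pairing being bilinear rather than
  sesquilinear.\<close>

lemma pair_eq_mean:
  assumes "finite S" "\<And>n. n \<notin> S \<Longrightarrow> u n = 0"
  shows "pair u b = mean (\<lambda>x. ev b x * (\<Sum>n\<in>S. u n * char (- n) x))"
proof -
  define c where "c = Poly_Mapping.lookup b"
  have "mean (\<lambda>x. ev b x * (\<Sum>n\<in>S. u n * char (- n) x)) =
      mean (\<lambda>x. \<Sum>m\<in>Poly_Mapping.keys b. \<Sum>n\<in>S. (c m * u n) * char (m - n) x)"
  proof (rule arg_cong[where f = mean], rule ext)
    fix x
    have "ev b x * (\<Sum>n\<in>S. u n * char (- n) x) =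
        (\<Sum>m\<in>Poly_Mapping.keys b. \<Sum>n\<in>S. (char m x * c m) * (u n * char (- n) x))"
      by (simp add: ev_def pair_def sum_product c_def)
    also have "\<dots> = (\<Sum>m\<in>Poly_Mapping.keys b. \<Sum>n\<in>S. (c m * u n) * char (m - n) x)"
      using char_add[of _ "- _" x] by (intro sum.cong refl) (simp add: mult_ac)
    finally show "ev b x * (\<Sum>n\<in>S. u n * char (- n) x) =
        (\<Sum>m\<in>Poly_Mapping.keys b. \<Sum>n\<in>S. (c m * u n) * char (m - n) x)" .
  qed
  also have "\<dots> = (\<Sum>m\<in>Poly_Mapping.keys b. \<Sum>n\<in>S. (c m * u n) * mean (char (m - n)))"
    by (simp add: mean_sum mean_mult_left continuous_intros)
  also have "\<dots> = (\<Sum>m\<in>Poly_Mapping.keys b. u m * c m)"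
  proof (intro sum.cong refl)
    fix m
    have "(\<Sum>n\<in>S. (c m * u n) * mean (char (m - n))) = (\<Sum>n\<in>S. if m = n then c m * u n else 0)"
      by (intro sum.cong refl) (auto simp: mean_char)
    also have "\<dots> = u m * c m"
      using assms by (cases "m \<in> S") auto
    finally show "(\<Sum>n\<in>S. (c m * u n) * mean (char (m - n))) = u m * c m" .
  qed
  finally show ?thesis by (simp add: pair_def c_def)
qed

context lattice_symbol
begin

lemma continuous_on_symb [continuous_intros]: "continuous_on S symb"
  unfolding symb_def by (intro continuous_intros)

text \<open>Let G be the transform of \<open>u\<close> and choose \<open>a\<close> with transform
  \<open>cnj G\<close>. The limit of the pairings is then the mean of \<open>bump (symb x)\<close>
  times the squared modulus of G. Its vanishing forces G = 0 on the nonempty open set where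
  \<open>\<bar>symb x\<bar> < 2\<close>, and the characters are independent there.\<close>

lemma finite_support_zero:
  assumes S: "finite S" "\<And>n. n \<notin> S \<Longrightarrow> u n = 0"
    and X: "\<And>i x. ev (X i) x = poly (P i) (of_real (symb x))"
    and P: "\<And>i t. \<bar>t\<bar> \<le> sbound \<Longrightarrow> norm (poly (P i) (of_real t) - of_real (bump t)) \<le> 1 / real (Suc i)"
    and lim: "\<And>a. (\<lambda>i. pair u (X i * a)) \<longlonglongrightarrow> 0"
    and x0: "x0 \<in> box (0, 0) (2 * pi, 2 * pi)" "\<bar>symb x0\<bar> < 2"
  shows "u n = 0"
proof -
  define G where "G x = (\<Sum>n\<in>S. u n * char (- n) x)" for x
  define a where "a = (\<Sum>n\<in>S. Poly_Mapping.single n (cnj (u n)))"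
  define B where "B = (\<Sum>n\<in>S. norm (u n))"
  have a: "ev a x = cnj (G x)" for x
    by (simp add: a_def G_def ev_sum ev_single char_uminus)
  have GB: "norm (G x) \<le> B" for x
    unfolding G_def B_def by (rule sum_norm_le) (simp add: norm_mult)
  have "B \<ge> 0" by (simp add: B_def sum_nonneg)
  have contG [continuous_intros]: "continuous_on T G" for T
    unfolding G_def by (intro continuous_intros)
  have contP [continuous_intros]: "continuous_on T (\<lambda>x. poly (P i) (of_real (symb x)))" for T i
    using continuous_on_ev[of T "X i"] by (simp add: X[abs_def])
  define I where "I = mean (\<lambda>x. of_real (bump (symb x)) * (cnj (G x) * G x))"
  have pairI: "norm (pair u (X i * a) - I) \<le> 1 / real (Suc i) * (B * B)" for i
  proof -
    have "pair u (X i * a) = mean (\<lambda>x. ev (X i * a) x * G x)"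
      unfolding G_def by (rule pair_eq_mean[OF S])
    then have "pair u (X i * a) = mean (\<lambda>x. poly (P i) (of_real (symb x)) * (cnj (G x) * G x))"
      by (simp only: ev_mult X a mult.assoc)
    then have "pair u (X i * a) - I = mean (\<lambda>x. poly (P i) (of_real (symb x)) * (cnj (G x) * G x)
        - of_real (bump (symb x)) * (cnj (G x) * G x))"
      unfolding I_def by (subst mean_diff) (auto intro!: continuous_intros)
    also have "\<dots> = mean (\<lambda>x. (poly (P i) (of_real (symb x)) - of_real (bump (symb x))) * (cnj (G x) * G x))"
      by (simp add: algebra_simps)
    finally have eq: "pair u (X i * a) - I = mean (\<lambda>x. (poly (P i) (of_real (symb x)) - of_real (bump (symb x))) * (cnj (G x) * G x))" .
    show ?thesis
      unfolding eq
    proof (rule mean_norm_le)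
      show "continuous_on torus (\<lambda>x. (poly (P i) (of_real (symb x)) - of_real (bump (symb x))) * (cnj (G x) * G x))"
        by (intro continuous_intros)
      show "norm ((poly (P i) (of_real (symb x)) - of_real (bump (symb x))) * (cnj (G x) * G x)) \<le> 1 / real (Suc i) * (B * B)" for x
        unfolding norm_mult complex_mod_cnj
        using P[OF symb_bound] GB \<open>B \<ge> 0\<close> by (intro mult_mono) auto
    qed
  qed
  have "(\<lambda>i. pair u (X i * a)) \<longlonglongrightarrow> I"
  proof (rule LIM_zero_cancel, rule Lim_null_comparison)
    show "\<forall>\<^sub>F i in sequentially. norm (pair u (X i * a) - I) \<le> 1 / real (Suc i) * (B * B)"
      using pairI by auto
    have "(\<lambda>i. inverse (real (Suc i)) * (B * B)) \<longlonglongrightarrow> 0 * (B * B)"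
      by (intro tendsto_intros LIMSEQ_inverse_real_of_nat)
    then show "(\<lambda>i. 1 / real (Suc i) * (B * B)) \<longlonglongrightarrow> 0"
      by (simp add: inverse_eq_divide)
  qed
  then have "I = 0" using lim LIMSEQ_unique by blast
  define f where "f x = bump (symb x) * (norm (G x))\<^sup>2" for x
  have contf: "continuous_on torus f" unfolding f_def by (intro continuous_intros)
  have "(\<lambda>x. of_real (bump (symb x)) * (cnj (G x) * G x)) = (\<lambda>x. complex_of_real (f x))"
  proof
    fix x
    have "cnj (G x) * G x = of_real ((norm (G x))\<^sup>2)"
      using complex_norm_square[of "G x"] by (simp add: mult.commute)
    then show "of_real (bump (symb x)) * (cnj (G x) * G x) = complex_of_real (f x)"
      by (simp add: f_def)
  qed
  then have "integral torus (\<lambda>x. complex_of_real (f x)) = 0"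
    using \<open>I = 0\<close> by (simp add: I_def mean_def)
  moreover have "integral torus (Re \<circ> (\<lambda>x. complex_of_real (f x))) = Re (integral torus (\<lambda>x. complex_of_real (f x)))"
    by (rule integral_linear[OF _ bounded_linear_Re])
      (intro integrable_on_torus continuous_intros contf)
  ultimately have "integral torus f = 0" by (simp add: o_def)
  then have int0: "(f has_integral 0) torus"
    using integrable_integral[OF integrable_on_torus[OF contf]] by simp
  have f0: "f x = 0" if "x \<in> torus" for x
    by (rule has_integral_0_cbox_imp_0[OF contf[unfolded torus_def] _ int0[unfolded torus_def] _ that[unfolded torus_def]])
      (use x0(1) in \<open>auto simp: f_def bump_nonneg\<close>)
  define U where "U = {x \<in> box (0, 0) (2 * pi, 2 * pi). \<bar>symb x\<bar> < 2}"
  have "open U"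
  proof -
    have "open {x. \<bar>symb x\<bar> < 2}" by (intro open_Collect_less continuous_intros)
    then have "open (box (0, 0) (2 * pi, 2 * pi) \<inter> {x. \<bar>symb x\<bar> < 2})" by (intro open_Int open_box)
    then show ?thesis by (simp add: U_def Int_def)
  qed
  have "x0 \<in> U" using x0 by (simp add: U_def)
  then have "U \<noteq> {}" by blast
  have GU: "(\<Sum>m\<in>uminus ` S. u (- m) * char m x) = 0" if "x \<in> U" for x
  proof -
    have "x \<in> torus" using that box_subset_cbox unfolding U_def torus_def by blast
    then have "bump (symb x) * (norm (G x))\<^sup>2 = 0" using f0 by (simp add: f_def)
    moreover have "bump (symb x) > 0" using that by (intro bump_pos) (simp add: U_def)
    ultimately have "G x = 0" by simp
    then show ?thesis by (simp add: G_def sum.reindex)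
  qed
  have "\<forall>m\<in>uminus ` S. u (- m) = 0"
    by (rule chars_independent_on_open[OF _ \<open>open U\<close> \<open>U \<noteq> {}\<close> GU]) (use S in auto)
  then show ?thesis using S(2)[of n] by (cases "n \<in> S") auto
qed

lemma solution_unique:
  assumes y: "\<And>k n. y (k + 1) n + y (k - 1) n = hop (y k) n + g k n" "vanishing_average y"
    and w: "\<And>k n. w (k + 1) n + w (k - 1) n = hop (w k) n + g k n" "vanishing_average w"
  shows "y k n = w k n"
proof -
  have "(y (k + 1) n - w (k + 1) n) + (y (k - 1) n - w (k - 1) n) = hop (\<lambda>n. y k n - w k n) n" for k n
  proof -
    have "hop (\<lambda>n. y k n - w k n) n = hop (y k) n - hop (w k) n"
      by (simp add: hop_def algebra_simps)
    then show ?thesis using y(1)[of k n] w(1)[of k n] by (simp add: algebra_simps)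
  qed
  from homogeneous_solution_zero[where y = "\<lambda>k n. y k n - w k n", OF this vanishing_average_diff[OF y(2) w(2)]]
  show ?thesis by simp
qed

fun backward :: "(nat \<Rightarrow> int \<times> int \<Rightarrow> complex) \<Rightarrow> nat \<Rightarrow> int \<times> int \<Rightarrow> complex" where
  "backward h 0 = (\<lambda>n. 0)"
| "backward h (Suc 0) = (\<lambda>n. 0)"
| "backward h (Suc (Suc j)) = (\<lambda>n. hop (backward h (Suc j)) n - backward h j n + h (Suc j) n)"

lemma finite_support_hop:
  assumes "finite {n. u n \<noteq> 0}"
  shows "finite {n. hop u n \<noteq> 0}"
proof -
  have fin: "finite {n. u (v + n) \<noteq> 0}" for v
    using finite_vimageI[OF assms, of "\<lambda>n. v + n"] by (simp add: vimage_def)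
  have "{n. hop u n \<noteq> 0} \<subseteq> {n. u n \<noteq> 0} \<union> {n. u ((1, 0) + n) \<noteq> 0} \<union> {n. u ((-1, 0) + n) \<noteq> 0}
      \<union> {n. u ((0, 1) + n) \<noteq> 0} \<union> {n. u ((0, -1) + n) \<noteq> 0}"
    by (auto simp: hop_def)
  then show ?thesis by (rule finite_subset) (intro finite_UnI assms fin)
qed

lemma finite_support_backward:
  assumes "\<And>j. finite {n. h j n \<noteq> 0}"
  shows "finite {n. backward h j n \<noteq> 0}"
proof (induction j rule: induct_nat_012)
  case (ge2 j)
  have "{n. backward h (Suc (Suc j)) n \<noteq> 0} \<subseteq>
      {n. hop (backward h (Suc j)) n \<noteq> 0} \<union> {n. backward h j n \<noteq> 0} \<union> {n. h (Suc j) n \<noteq> 0}"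
    by auto
  then show ?case
    by (rule finite_subset) (intro finite_UnI assms ge2 finite_support_hop)
qed auto

text \<open>\<open>backward\<close>, read with reversed time, solves the inhomogeneous equation with zero data in the
  remote future. Its pairings with \<open>bump(H) a\<close> agree with those of \<open>y\<close> up to terms that vanish in the limit, and
  those of \<open>y\<close> tend to zero beyond the support of the source, so it vanishes in the remote past too.\<close>

theorem inner_energy_summable:
  assumes y: "\<And>k n. y (k + 1) n + y (k - 1) n = hop (y k) n + g k n"
    and g: "finite {(k, n). g k n \<noteq> 0}"
    and avg: "vanishing_average y"
    and x0: "x0 \<in> box (0, 0) (2 * pi, 2 * pi)" "\<bar>symb x0\<bar> < 2"
  shows "(\<lambda>(k, n). (norm (y k n))\<^sup>2) summable_on UNIV"
proof -
  have fin: "finite {n. g k n \<noteq> 0}" for k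
  proof -
    have "{n. g k n \<noteq> 0} = Pair k -` {(k, n). g k n \<noteq> 0}" by auto
    then show ?thesis using finite_vimageI[OF g, of "Pair k"] by (simp add: inj_on_def)
  qed
  \<comment> \<open>The added 1 makes the source vanish already at time \<open>N\<close> in modulus,
    and the inserted 0 keeps the maximum meaningful for a zero source.\<close>
  define N where "N = Max (insert 0 ((\<lambda>x. \<bar>fst x\<bar> + 1) ` {(k, n). g k n \<noteq> 0}))"
  have gN: "g k n = 0" if "\<bar>k\<bar> \<ge> N" for k n
  proof (rule ccontr)
    assume "g k n \<noteq> 0"
    then have "\<bar>k\<bar> + 1 \<le> N"
      unfolding N_def using g by (intro Max_ge) (auto intro!: rev_image_eqI[of "(k, n)"])
    then show False using that by simp
  qed
  have "N \<ge> 0" unfolding N_def using g by (intro Max_ge) auto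
  \<comment> \<open>Counting backwards from \<open>N + 1\<close> puts the two zero seeds at the
    times \<open>N + 1\<close> and \<open>N\<close>, and \<open>h (Suc j)\<close> in
    \<open>backward\<close> becomes the source at time \<open>N - j\<close>.\<close>
  define w where "w k = backward (\<lambda>j. g (N + 1 - int j)) (nat (N + 1 - k))" for k
  have w: "w (k + 1) n + w (k - 1) n = hop (w k) n + g k n" for k n
  proof (cases "k \<le> N")
    case True
    then have "nat (N + 1 - (k - 1)) = Suc (Suc (nat (N - k)))" "nat (N + 1 - k) = Suc (nat (N - k))"
      "nat (N + 1 - (k + 1)) = nat (N - k)" "N + 1 - int (Suc (nat (N - k))) = k"
      by auto
    then show ?thesis by (simp add: w_def)
  next
    case False
    then have "nat (N + 1 - k) = 0" "nat (N + 1 - (k + 1)) = 0" by auto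
    moreover have "nat (N + 1 - (k - 1)) = 0 \<or> nat (N + 1 - (k - 1)) = Suc 0" using False by auto
    ultimately show ?thesis using gN[of k n] False \<open>N \<ge> 0\<close> by (auto simp: w_def hop_def)
  qed
  have finw: "finite {n. w k n \<noteq> 0}" for k
    unfolding w_def by (rule finite_support_backward) (rule fin)
  obtain X P where XP: "bump_approx X P"
    using ex_bump_approximation by blast
  have X: "\<And>i x. ev (X i) x = poly (P i) (of_real (symb x))"
    and P: "\<And>i t. \<bar>t\<bar> \<le> sbound \<Longrightarrow> norm (poly (P i) (of_real t) - of_real (bump t)) \<le> 1 / real (Suc i)"
    "\<And>i t. \<bar>t\<bar> \<le> sbound \<Longrightarrow> norm (poly (pderiv (P i)) (of_real t) - of_real (- 3 * t * (rt (2 - t) * rt (2 + t)))) \<le> 1 / real (Suc i)"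
    using XP by (auto simp: bump_approx_def)
  have ylim: "(\<lambda>i. pair (y k) (X i * a)) \<longlonglongrightarrow> 0" if "\<bar>k\<bar> \<ge> N" for k a
  proof -
    \<comment> \<open>Moving away from the source, in the direction of the sign of \<open>k\<close>,
      gives a half line on which \<open>y\<close> solves the homogeneous equation.\<close>
    have "\<exists>s\<in>{1, -1 :: int}. \<forall>j. \<bar>k + s * int j\<bar> \<ge> N"
    proof (cases "k \<ge> 0")
      case True
      then show ?thesis using that by (intro bexI[of _ 1]) auto
    next
      case False
      then show ?thesis using that by (intro bexI[of _ "-1"]) auto
    qed
    then obtain s where s': "s \<in> {1, -1}" "\<forall>j. \<bar>k + s * int j\<bar> \<ge> N" by (rule bexE)
    then have s: "s = 1 \<or> s = -1" "\<bar>k + s * int j\<bar> \<ge> N" for j by auto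
    have eq: "y (k + s * int (Suc (Suc j))) n + y (k + s * int j) n = hop (y (k + s * int (Suc j))) n" for j n
      using y[of "k + s * int (Suc j)" n] gN[OF s(2)[of "Suc j"], of n] s(1) by (auto simp: algebra_simps)
    have "half_small (\<lambda>j. y (k + s * int j))"
      by (rule half_small_if_vanishing_average[OF avg, where K = "nat \<bar>k\<bar>"]) (use s(1) in \<open>auto simp: inj_def\<close>)
    from half_line_bump_limit[where y = "\<lambda>j. y (k + s * int j)", OF eq this X P]
    show ?thesis by simp
  qed
  define d where "d k n = y k n - w k n" for k n
  have d: "d (k - 1) = (\<lambda>n. hop (d k) n - d (k + 1) n)" for k
  proof
    fix n
    have hd: "hop (d k) n = hop (y k) n - hop (w k) n"
      by (simp add: hop_def d_def algebra_simps)
    show "d (k - 1) n = hop (d k) n - d (k + 1) n"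
      using y[of k n] w[of k n] unfolding hd unfolding d_def by algebra
  qed
  have w0: "w k n = 0" if "k \<ge> N" for k n
  proof -
    have "nat (N + 1 - k) = 0 \<or> nat (N + 1 - k) = Suc 0" using that by auto
    then show ?thesis by (auto simp: w_def)
  qed
  \<comment> \<open>The difference \<open>d\<close> is homogeneous at all times. At \<open>N\<close>
    and \<open>N + 1\<close> it equals \<open>y\<close>, whose pairings tend to 0, and the
    recurrence carries this back across the support of the source.\<close>
  have dlim: "(\<forall>a. (\<lambda>i. pair (d (N - int j)) (X i * a)) \<longlonglongrightarrow> 0) \<and>
      (\<forall>a. (\<lambda>i. pair (d (N + 1 - int j)) (X i * a)) \<longlonglongrightarrow> 0)" for j
  proof (induction j)
    case 0
    have "d N = y N" "d (N + 1) = y (N + 1)" by (auto simp: d_def w0)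
    then show ?case using ylim[of N] ylim[of "N + 1"] \<open>N \<ge> 0\<close> by simp
  next
    case (Suc j)
    have "(\<lambda>i. pair (d (N - int (Suc j))) (X i * a)) \<longlonglongrightarrow> 0" for a
    proof -
      have "pair (d (N - int (Suc j))) b = pair (d (N - int j)) (symp * b) - pair (d (N + 1 - int j)) b" for b
      proof -
        have "d (N - int (Suc j)) = (\<lambda>n. hop (d (N - int j)) n - d (N + 1 - int j) n)"
          using d[of "N - int j"] by (simp add: algebra_simps)
        then show ?thesis by (simp only: pair_symp pair_diff_left)
      qed
      then have "(\<lambda>i. pair (d (N - int (Suc j))) (X i * a)) =
          (\<lambda>i. pair (d (N - int j)) (X i * (symp * a)) - pair (d (N + 1 - int j)) (X i * a))"
        by (simp add: mult_ac)
      moreover have "\<dots> \<longlonglongrightarrow> 0 - 0"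
        using Suc by (intro tendsto_diff) auto
      ultimately show ?thesis by simp
    qed
    moreover have "N + 1 - int (Suc j) = N - int j" by simp
    ultimately show ?case using Suc by simp
  qed
  \<comment> \<open>Before the source the pairings of both \<open>y\<close> and \<open>d\<close>
    tend to 0, hence those of \<open>w = y - d\<close>, which is finitely supported at each
    time.\<close>
  have w0': "w k n = 0" if "k \<le> - N" for k n
  proof (rule finite_support_zero[OF finw[of k] _ X P(1) _ x0])
    show "n \<notin> {n. w k n \<noteq> 0} \<Longrightarrow> w k n = 0" for n by simp
    fix a
    have "N - int (nat (N - k)) = k" using that \<open>N \<ge> 0\<close> by simp
    then have "(\<lambda>i. pair (d k) (X i * a)) \<longlonglongrightarrow> 0" using dlim[of "nat (N - k)"] by simp
    moreover have "(\<lambda>i. pair (y k) (X i * a)) \<longlonglongrightarrow> 0" using that \<open>N \<ge> 0\<close> by (intro ylim) simp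
    ultimately have "(\<lambda>i. pair (y k) (X i * a) - pair (d k) (X i * a)) \<longlonglongrightarrow> 0 - 0"
      by (intro tendsto_diff)
    moreover have "w k = (\<lambda>n. y k n - d k n)" by (simp add: d_def)
    ultimately show "(\<lambda>i. pair (w k) (X i * a)) \<longlonglongrightarrow> 0" by (simp add: pair_diff_left)
  qed
  have "finite (SIGMA k:{-N..N}. {n. w k n \<noteq> 0})" using finw by (intro finite_SigmaI) auto
  moreover have "{(k, n). w k n \<noteq> 0} \<subseteq> (SIGMA k:{-N..N}. {n. w k n \<noteq> 0})"
  proof (intro subsetI, clarify)
    fix k n assume "w k n \<noteq> 0"
    then have "\<not> k \<ge> N" "\<not> k \<le> - N" using w0[of k n] w0'[of k n] by linarith+
    then show "k \<in> {-N..N} \<and> n \<in> {n. w k n \<noteq> 0}" using \<open>w k n \<noteq> 0\<close> by simp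
  qed
  ultimately have "finite {(k, n). w k n \<noteq> 0}" by (rule finite_subset[rotated])
  then have sw: "(\<lambda>(k, n). (norm (w k n))\<^sup>2) summable_on UNIV"
    by (intro finite_nonzero_values_imp_summable_on) (simp add: case_prod_unfold)
  have "y k n = w k n" for k n
    by (rule solution_unique[OF y avg w vanishing_average_if_summable[OF sw]])
  then show ?thesis using sw by simp
qed

end

section \<open>Sequences on the lattice\<close>

definition averages_vanish :: "(lattice \<Rightarrow> complex) \<Rightarrow> bool" where
  "averages_vanish f \<longleftrightarrow> ((\<lambda>R :: real. 1 / R * (\<Sum>n | real_of_int (l1norm n) < R. (norm (f n))\<^sup>2)) \<longlongrightarrow> 0) at_top"

definition square_summable :: "('a \<Rightarrow> complex) \<Rightarrow> bool" where
  "square_summable f \<longleftrightarrow> (\<lambda>n. (norm (f n))\<^sup>2) summable_on UNIV"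

lemma l1norm_triangle: "l1norm (m + n) \<le> l1norm m + l1norm n"
  unfolding l1norm_def sum.distrib[symmetric] by (intro sum_mono) auto

lemma l1norm_nonneg: "l1norm n \<ge> 0"
  by (simp add: l1norm_def sum_nonneg)

lemma norm_add_power2_le:
  fixes x y \<eta> :: real
  assumes "\<eta> > 0"
  shows "(x + y)\<^sup>2 \<le> (1 + \<eta>) * x\<^sup>2 + (1 + 1 / \<eta>) * y\<^sup>2"
proof -
  have "2 * x * y \<le> \<eta> * x\<^sup>2 + y\<^sup>2 / \<eta>"
  proof -
    have "0 \<le> (\<eta> * x - y)\<^sup>2 / \<eta>" using assms by simp
    also have "\<dots> = \<eta> * x\<^sup>2 + y\<^sup>2 / \<eta> - 2 * x * y"
      using assms by (simp add: power2_eq_square field_simps)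
    finally show ?thesis by simp
  qed
  then show ?thesis by (simp add: power2_sum algebra_simps)
qed

lemma weighted_sum_power2_le:
  fixes c x :: "'a \<Rightarrow> real"
  assumes "finite D" "\<And>d. d \<in> D \<Longrightarrow> c d \<ge> 0"
  shows "(\<Sum>d\<in>D. c d * x d)\<^sup>2 \<le> (\<Sum>d\<in>D. c d) * (\<Sum>d\<in>D. c d * (x d)\<^sup>2)"
proof -
  have "(\<Sum>d\<in>D. c d * x d)\<^sup>2 = (\<Sum>d\<in>D. sqrt (c d) * (sqrt (c d) * x d))\<^sup>2"
    using assms by (intro arg_cong[where f = "\<lambda>x. x\<^sup>2"] sum.cong) (auto simp: mult.assoc[symmetric])
  also have "\<dots> \<le> (\<Sum>d\<in>D. (sqrt (c d))\<^sup>2) * (\<Sum>d\<in>D. (sqrt (c d) * x d)\<^sup>2)"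
    by (rule Cauchy_Schwarz_ineq_sum)
  also have "\<dots> = (\<Sum>d\<in>D. c d) * (\<Sum>d\<in>D. c d * (x d)\<^sup>2)"
    using assms by (simp add: power_mult_distrib)
  finally show ?thesis .
qed

text \<open>The condition on the averages makes the boundary contributions of tent functions vanish.\<close>

theorem square_summable_if_contraction:
  fixes u v :: "lattice \<Rightarrow> complex" and c :: "lattice \<Rightarrow> complex" and E :: complex
  assumes u: "averages_vanish u" and v: "square_summable v" and D: "finite D"
    and eq: "\<And>n. E * u n = (\<Sum>d\<in>D. c d * u (n + d)) + v n"
    and less: "(\<Sum>d\<in>D. norm (c d)) < norm E"
  shows "square_summable u"
proof -
  define \<alpha> where "\<alpha> = (\<Sum>d\<in>D. norm (c d))"
  have "\<alpha> \<ge> 0" by (simp add: \<alpha>_def sum_nonneg)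
  have "\<alpha>\<^sup>2 < (norm E)\<^sup>2" using less \<open>\<alpha> \<ge> 0\<close> unfolding \<alpha>_def by (intro power_strict_mono) auto
  \<comment> \<open>Splitting off \<open>v\<close> by Young's inequality inflates the coefficient by
    \<open>1 + \<eta>\<close>. Taking \<open>\<eta> * (1 + \<alpha>\<^sup>2)\<close> as half of the
    gap keeps the contraction strict.\<close>
  obtain \<eta> where \<eta>: "\<eta> > 0" "(1 + \<eta>) * \<alpha>\<^sup>2 < (norm E)\<^sup>2"
  proof -
    define q where "q = 1 + \<alpha>\<^sup>2"
    define \<eta> where "\<eta> = ((norm E)\<^sup>2 - \<alpha>\<^sup>2) / 2 / q"
    have p: "q > 0" by (simp add: q_def add_pos_nonneg)
    have "\<eta> > 0" using \<open>\<alpha>\<^sup>2 < (norm E)\<^sup>2\<close> p by (simp add: \<eta>_def)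
    have "\<eta> * q = ((norm E)\<^sup>2 - \<alpha>\<^sup>2) / 2" using p by (simp add: \<eta>_def)
    then have "\<eta> * (1 + \<alpha>\<^sup>2) = ((norm E)\<^sup>2 - \<alpha>\<^sup>2) / 2" by (simp add: q_def)
    then have "(1 + \<eta>) * \<alpha>\<^sup>2 < (norm E)\<^sup>2" using \<open>\<eta> > 0\<close> \<open>\<alpha>\<^sup>2 < (norm E)\<^sup>2\<close> by (simp add: algebra_simps)
    with \<open>\<eta> > 0\<close> show thesis by (rule that)
  qed
  define \<kappa> where "\<kappa> = (norm E)\<^sup>2 - (1 + \<eta>) * \<alpha>\<^sup>2"
  have "\<kappa> > 0" using \<eta>(2) by (simp add: \<kappa>_def)
  define ball where "ball R = {n. real_of_int (l1norm n) < R}" for R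
  have fin: "finite (ball R)" for R unfolding ball_def by (rule finite_l1ball)
  define S where "S R = (\<Sum>n\<in>ball R. (norm (u n))\<^sup>2)" for R
  define L where "L = (\<Sum>d\<in>D. real_of_int (l1norm d))"
  have L: "real_of_int (l1norm d) \<le> L" if "d \<in> D" for d
    unfolding L_def using that D by (intro member_le_sum) (auto simp: l1norm_nonneg)
  have "L \<ge> 0" unfolding L_def by (intro sum_nonneg) (simp add: l1norm_nonneg)
  \<comment> \<open>A tent of height 1 and slope \<open>1 / R\<close>: a shift by an element of
    \<open>D\<close> changes it by at most \<open>L / R\<close>.\<close>
  define w where "w R n = max 0 (1 - real_of_int (l1norm n) / R)" for R n
  define A where "A R = (\<Sum>n\<in>ball R. w R n * (norm (u n))\<^sup>2)" for R
  define V where "V = infsum (\<lambda>n. (norm (v n))\<^sup>2) UNIV"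
  have shifted: "(\<Sum>n\<in>ball R. w R n * (norm (u (n + d)))\<^sup>2) \<le> A R + L / R * S (R + L)"
    if d: "d \<in> D" and R: "R > 0" for d R
  proof -
    have "w R n \<le> w R (n + d) + L / R" for n
    proof -
      have max_le: "max 0 x \<le> max 0 y + z" if "x \<le> y + z" "z \<ge> 0" for x y z :: real
        using that by (auto simp: max_def)
      have "real_of_int (l1norm (n + d)) \<le> real_of_int (l1norm n) + L"
        using L[OF d] l1norm_triangle[of n d] by linarith
      then have "real_of_int (l1norm (n + d)) / R \<le> (real_of_int (l1norm n) + L) / R"
        using R by (intro divide_right_mono) auto
      then have "1 - real_of_int (l1norm n) / R \<le> 1 - real_of_int (l1norm (n + d)) / R + L / R"
        by (simp add: add_divide_distrib)
      then show ?thesis unfolding w_def by (rule max_le) (use R \<open>L \<ge> 0\<close> in simp)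
    qed
    then have "(\<Sum>n\<in>ball R. w R n * (norm (u (n + d)))\<^sup>2) \<le>
        (\<Sum>n\<in>ball R. (w R (n + d) + L / R) * (norm (u (n + d)))\<^sup>2)"
      by (intro sum_mono mult_right_mono) auto
    also have "\<dots> = (\<Sum>n\<in>(\<lambda>n. n + d) ` ball R. (w R n + L / R) * (norm (u n))\<^sup>2)"
      by (subst sum.reindex) auto
    also have "\<dots> \<le> (\<Sum>n\<in>ball (R + L). (w R n + L / R) * (norm (u n))\<^sup>2)"
    proof (rule sum_mono2[OF fin])
      show "(\<lambda>n. n + d) ` ball R \<subseteq> ball (R + L)"
      proof (intro image_subsetI)
        fix n assume "n \<in> ball R"
        then show "n + d \<in> ball (R + L)"
          using L[OF d] l1norm_triangle[of n d] unfolding ball_def mem_Collect_eq by linarith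
      qed
    qed (use R \<open>L \<ge> 0\<close> in \<open>auto simp: w_def intro!: mult_nonneg_nonneg\<close>)
    also have "\<dots> = (\<Sum>n\<in>ball (R + L). w R n * (norm (u n))\<^sup>2) + L / R * S (R + L)"
      by (simp add: S_def sum_distrib_left sum.distrib[symmetric] distrib_right)
    also have "(\<Sum>n\<in>ball (R + L). w R n * (norm (u n))\<^sup>2) = A R"
      unfolding A_def using R \<open>L \<ge> 0\<close>
      by (intro sum.mono_neutral_right fin) (auto simp: ball_def w_def)
    finally show ?thesis .
  qed
  \<comment> \<open>The shifted sums reproduce \<open>A R\<close> up to a boundary term, so
    \<open>A R\<close> is absorbed on the left, where the coefficient \<kappa> remains.\<close>
  have A_bound: "\<kappa> * A R \<le> (1 + \<eta>) * \<alpha>\<^sup>2 * (L / R * S (R + L)) + (1 + 1 / \<eta>) * V" if R: "R > 0" for R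
  proof -
    have pointwise: "(norm E)\<^sup>2 * (norm (u n))\<^sup>2 \<le>
        (1 + \<eta>) * (\<alpha> * (\<Sum>d\<in>D. norm (c d) * (norm (u (n + d)))\<^sup>2)) + (1 + 1 / \<eta>) * (norm (v n))\<^sup>2" for n
    proof -
      have "norm E * norm (u n) \<le> (\<Sum>d\<in>D. norm (c d) * norm (u (n + d))) + norm (v n)"
      proof -
        have "norm E * norm (u n) = norm ((\<Sum>d\<in>D. c d * u (n + d)) + v n)"
          using eq[of n] by (simp flip: norm_mult)
        also have "\<dots> \<le> norm (\<Sum>d\<in>D. c d * u (n + d)) + norm (v n)"
          by (rule norm_triangle_ineq)
        also have "norm (\<Sum>d\<in>D. c d * u (n + d)) \<le> (\<Sum>d\<in>D. norm (c d) * norm (u (n + d)))"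
          by (rule sum_norm_le) (simp add: norm_mult)
        finally show ?thesis by simp
      qed
      then have "(norm E * norm (u n))\<^sup>2 \<le> ((\<Sum>d\<in>D. norm (c d) * norm (u (n + d))) + norm (v n))\<^sup>2"
        by (intro power_mono) auto
      also have "\<dots> \<le> (1 + \<eta>) * (\<Sum>d\<in>D. norm (c d) * norm (u (n + d)))\<^sup>2 + (1 + 1 / \<eta>) * (norm (v n))\<^sup>2"
        by (rule norm_add_power2_le[OF \<eta>(1)])
      also have "\<dots> \<le> (1 + \<eta>) * (\<alpha> * (\<Sum>d\<in>D. norm (c d) * (norm (u (n + d)))\<^sup>2)) + (1 + 1 / \<eta>) * (norm (v n))\<^sup>2"
        unfolding \<alpha>_def using \<eta>(1) by (intro add_right_mono mult_left_mono weighted_sum_power2_le D) auto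
      finally show ?thesis by (simp add: power_mult_distrib)
    qed
    have wn: "w R n \<ge> 0" "w R n \<le> 1" for n using R by (auto simp: w_def l1norm_nonneg)
    have "(norm E)\<^sup>2 * A R = (\<Sum>n\<in>ball R. w R n * ((norm E)\<^sup>2 * (norm (u n))\<^sup>2))"
      by (simp add: A_def sum_distrib_left mult_ac)
    also have "\<dots> \<le> (\<Sum>n\<in>ball R. w R n * ((1 + \<eta>) * (\<alpha> * (\<Sum>d\<in>D. norm (c d) * (norm (u (n + d)))\<^sup>2)) + (1 + 1 / \<eta>) * (norm (v n))\<^sup>2))"
      using pointwise wn by (intro sum_mono mult_left_mono) auto
    also have "\<dots> = (1 + \<eta>) * (\<alpha> * (\<Sum>d\<in>D. norm (c d) * (\<Sum>n\<in>ball R. w R n * (norm (u (n + d)))\<^sup>2)))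
        + (1 + 1 / \<eta>) * (\<Sum>n\<in>ball R. w R n * (norm (v n))\<^sup>2)"
    proof -
      have "(\<Sum>n\<in>ball R. w R n * (\<Sum>d\<in>D. norm (c d) * (norm (u (n + d)))\<^sup>2)) =
          (\<Sum>d\<in>D. norm (c d) * (\<Sum>n\<in>ball R. w R n * (norm (u (n + d)))\<^sup>2))"
        unfolding sum_distrib_left by (subst sum.swap) (simp only: mult_ac)
      moreover have "(\<Sum>n\<in>ball R. w R n * (a * (b * f n) + e * h n)) =
          a * (b * (\<Sum>n\<in>ball R. w R n * f n)) + e * (\<Sum>n\<in>ball R. w R n * h n)" for a b e and f h :: "lattice \<Rightarrow> real"
        by (simp add: sum_distrib_left sum.distrib[symmetric] distrib_left mult_ac)
      ultimately show ?thesis by simp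
    qed
    also have "\<dots> \<le> (1 + \<eta>) * (\<alpha> * (\<Sum>d\<in>D. norm (c d) * (A R + L / R * S (R + L)))) + (1 + 1 / \<eta>) * V"
    proof (intro add_mono mult_left_mono sum_mono)
      show "(\<Sum>n\<in>ball R. w R n * (norm (v n))\<^sup>2) \<le> V"
      proof -
        have "(\<Sum>n\<in>ball R. w R n * (norm (v n))\<^sup>2) \<le> (\<Sum>n\<in>ball R. 1 * (norm (v n))\<^sup>2)"
          using wn by (intro sum_mono mult_right_mono) auto
        also have "\<dots> \<le> V"
          unfolding V_def mult_1 using v fin unfolding square_summable_def by (intro finite_sum_le_infsum) auto
        finally show ?thesis .
      qed
    qed (use shifted R \<eta>(1) \<open>\<alpha> \<ge> 0\<close> in auto)
    also have "\<dots> = (1 + \<eta>) * \<alpha>\<^sup>2 * A R + (1 + \<eta>) * \<alpha>\<^sup>2 * (L / R * S (R + L)) + (1 + 1 / \<eta>) * V"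
    proof -
      have "(\<Sum>d\<in>D. norm (c d) * Y) = \<alpha> * Y" for Y
        by (simp add: \<alpha>_def sum_distrib_right)
      then show ?thesis by (simp only:) (simp add: power2_eq_square add_divide_distrib algebra_simps)
    qed
    finally show ?thesis by (simp add: \<kappa>_def algebra_simps)
  qed
  \<comment> \<open>The averages are known over radius \<open>R + L\<close>; the quotient of
    \<open>R + L\<close> and \<open>R\<close> tends to 1.\<close>
  have lim: "((\<lambda>R. L / R * S (R + L)) \<longlongrightarrow> 0) at_top"
  proof -
    have "((\<lambda>R. 1 / (R + L) * S (R + L)) \<longlongrightarrow> 0) at_top"
      using filterlim_compose[OF u[unfolded averages_vanish_def] filterlim_tendsto_add_at_top[OF tendsto_const[of L] filterlim_ident]]
      by (simp add: S_def ball_def add.commute)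
    moreover have "((\<lambda>R. L * (1 + L * inverse R)) \<longlongrightarrow> L * (1 + L * 0)) at_top"
      by (intro tendsto_intros tendsto_inverse_0_at_top filterlim_ident)
    ultimately have "((\<lambda>R. (1 / (R + L) * S (R + L)) * (L * (1 + L * inverse R))) \<longlongrightarrow> 0 * (L * (1 + L * 0))) at_top"
      by (rule tendsto_mult)
    then have "((\<lambda>R. (1 / (R + L) * S (R + L)) * (L * (1 + L * inverse R))) \<longlongrightarrow> 0) at_top" by simp
    moreover have "\<forall>\<^sub>F R in at_top. (1 / (R + L) * S (R + L)) * (L * (1 + L * inverse R)) = L / R * S (R + L)"
      using eventually_gt_at_top[of 0]
    proof eventually_elim
      case (elim R)
      then have "1 + L * inverse R = (R + L) / R" "R + L > 0" using \<open>L \<ge> 0\<close> by (auto simp: field_simps)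
      then show ?case by simp
    qed
    ultimately show ?thesis by (rule Lim_transform_eventually)
  qed
  have bound: "(\<Sum>n\<in>F. (norm (u n))\<^sup>2) \<le> ((1 + \<eta>) * \<alpha>\<^sup>2 * 0 + (1 + 1 / \<eta>) * V) / \<kappa>" if F: "finite F" for F
  proof (rule tendsto_le[OF trivial_limit_at_top_linorder])
    show "((\<lambda>R. ((1 + \<eta>) * \<alpha>\<^sup>2 * (L / R * S (R + L)) + (1 + 1 / \<eta>) * V) / \<kappa>)
        \<longlongrightarrow> ((1 + \<eta>) * \<alpha>\<^sup>2 * 0 + (1 + 1 / \<eta>) * V) / \<kappa>) at_top"
      using \<open>\<kappa> > 0\<close> by (intro tendsto_intros lim) auto
    have "((\<lambda>R. \<Sum>n\<in>F. max 0 (1 - real_of_int (l1norm n) * inverse R) * (norm (u n))\<^sup>2) \<longlongrightarrow>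
        (\<Sum>n\<in>F. max 0 (1 - real_of_int (l1norm n) * 0) * (norm (u n))\<^sup>2)) at_top"
      by (intro tendsto_intros tendsto_inverse_0_at_top filterlim_ident)
    then show "((\<lambda>R. \<Sum>n\<in>F. w R n * (norm (u n))\<^sup>2) \<longlongrightarrow> (\<Sum>n\<in>F. (norm (u n))\<^sup>2)) at_top"
      by (simp add: w_def divide_inverse)
    show "\<forall>\<^sub>F R in at_top. (\<Sum>n\<in>F. w R n * (norm (u n))\<^sup>2) \<le> ((1 + \<eta>) * \<alpha>\<^sup>2 * (L / R * S (R + L)) + (1 + 1 / \<eta>) * V) / \<kappa>"
      using eventually_gt_at_top[of 0]
    proof eventually_elim
      case (elim R)
      have "(\<Sum>n\<in>F. w R n * (norm (u n))\<^sup>2) \<le> (\<Sum>n\<in>F \<union> ball R. w R n * (norm (u n))\<^sup>2)"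
        using F fin by (intro sum_mono2) (auto simp: w_def)
      also have "\<dots> = A R"
        unfolding A_def using F fin elim by (intro sum.mono_neutral_right) (auto simp: ball_def w_def)
      also have "\<dots> \<le> ((1 + \<eta>) * \<alpha>\<^sup>2 * (L / R * S (R + L)) + (1 + 1 / \<eta>) * V) / \<kappa>"
        using A_bound[OF elim] \<open>\<kappa> > 0\<close> by (simp add: pos_le_divide_eq mult.commute)
      finally show ?case .
    qed
  qed
  show ?thesis
    unfolding square_summable_def
  proof (rule nonneg_bdd_above_summable_on)
    show "bdd_above (sum (\<lambda>n. (norm (u n))\<^sup>2) ` {F. F \<subseteq> UNIV \<and> finite F})"
      using bound by (intro bdd_aboveI2) auto
  qed auto
qed

section \<open>Stability of finite support and of square summability\<close>

definition finite_support :: "('a \<Rightarrow> complex) \<Rightarrow> bool" where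
  "finite_support f \<longleftrightarrow> finite {n. f n \<noteq> 0}"

lemma finite_support_add: "finite_support f \<Longrightarrow> finite_support g \<Longrightarrow> finite_support (\<lambda>n. f n + g n)"
  unfolding finite_support_def by (rule finite_subset[of _ "{n. f n \<noteq> 0} \<union> {n. g n \<noteq> 0}"]) auto

lemma finite_support_mult: "finite_support f \<Longrightarrow> finite_support (\<lambda>n. c * f n)"
  unfolding finite_support_def by (rule finite_subset[of _ "{n. f n \<noteq> 0}"]) auto

lemma finite_support_diff: "finite_support f \<Longrightarrow> finite_support g \<Longrightarrow> finite_support (\<lambda>n. f n - g n)"
  using finite_support_add[of f "\<lambda>n. (-1) * g n"] finite_support_mult[of g "-1"] by simp

lemma finite_support_shift:
  fixes f :: "lattice \<Rightarrow> complex"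
  assumes "finite_support f"
  shows "finite_support (\<lambda>n. f (n + d))"
  using finite_vimageI[OF assms[unfolded finite_support_def], of "\<lambda>n. n + d"]
  by (simp add: finite_support_def vimage_def)

lemma finite_support_yhat: "finite_support f \<Longrightarrow> finite_support (yhat j f)"
proof -
  assume f: "finite_support f"
  have eq: "yhat j f = (\<lambda>n. 1 / (2 * \<i>) * (f (n + axis j 1) - f (n + - axis j 1)))"
    by (auto simp: yhat_def)
  show ?thesis unfolding eq by (intro finite_support_mult finite_support_diff finite_support_shift f)
qed

lemma square_summable_if_finite_support: "finite_support f \<Longrightarrow> square_summable f"
  unfolding finite_support_def square_summable_def
  by (intro finite_nonzero_values_imp_summable_on) auto

lemma square_summable_mult: "square_summable f \<Longrightarrow> square_summable (\<lambda>n. c * f n)"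
  unfolding square_summable_def by (simp add: norm_mult power_mult_distrib summable_on_cmult_right)

lemma square_summable_add:
  assumes "square_summable f" "square_summable g"
  shows "square_summable (\<lambda>n. f n + g n)"
proof -
  have "(\<lambda>n. 2 * (norm (f n))\<^sup>2 + 2 * (norm (g n))\<^sup>2) summable_on UNIV"
    using assms unfolding square_summable_def by (intro summable_on_add summable_on_cmult_right)
  then show ?thesis
    unfolding square_summable_def
  proof (rule summable_on_comparison_test)
    fix n
    have "(norm (f n + g n))\<^sup>2 \<le> (norm (f n) + norm (g n))\<^sup>2"
      by (intro power_mono norm_triangle_ineq) auto
    also have "\<dots> \<le> 2 * (norm (f n))\<^sup>2 + 2 * (norm (g n))\<^sup>2"
      using norm_add_power2_le[of 1 "norm (f n)" "norm (g n)"] by simp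
    finally show "(norm (f n + g n))\<^sup>2 \<le> 2 * (norm (f n))\<^sup>2 + 2 * (norm (g n))\<^sup>2" .
  qed auto
qed

lemma square_summable_diff:
  "square_summable f \<Longrightarrow> square_summable g \<Longrightarrow> square_summable (\<lambda>n. f n - g n)"
  using square_summable_add[of f "\<lambda>n. (-1) * g n"] square_summable_mult[of g "-1"] by simp

lemma square_summable_shift:
  fixes f :: "'a :: ab_group_add \<Rightarrow> complex"
  assumes "square_summable f"
  shows "square_summable (\<lambda>n. f (n + d))"
proof -
  have "bij_betw (\<lambda>n. n + d) UNIV UNIV"
    by (rule bij_betwI[of _ _ _ "\<lambda>n. n - d"]) auto
  from summable_on_reindex_bij_betw[OF this, of "\<lambda>n. (norm (f n))\<^sup>2"] assms show ?thesis
    by (simp add: square_summable_def)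
qed

lemma square_summable_yhat: "square_summable f \<Longrightarrow> square_summable (yhat j f)"
proof -
  assume f: "square_summable f"
  have eq: "yhat j f = (\<lambda>n. 1 / (2 * \<i>) * (f (n + axis j 1) - f (n + - axis j 1)))"
    by (auto simp: yhat_def)
  show ?thesis unfolding eq by (intro square_summable_mult square_summable_diff square_summable_shift f)
qed

lemma yhat_add: "yhat j (\<lambda>n. f n + g n) n = yhat j f n + yhat j g n"
  by (simp add: yhat_def field_simps)

lemma yhat_diff: "yhat j (\<lambda>n. f n - g n) n = yhat j f n - yhat j g n"
  by (simp add: yhat_def field_simps)

lemma yhat_mult: "yhat j (\<lambda>n. c * f n) n = c * yhat j f n"
  by (simp add: yhat_def field_simps)

lemma yhat_commute: "yhat i (yhat j f) n = yhat j (yhat i f) n"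
  by (simp add: yhat_def diff_divide_distrib add_divide_distrib algebra_simps)

lemma yhat_yhat: "yhat j (yhat j f) n = (2 * f n - f (n + axis j 2) - f (n + axis j (- 2))) / 4"
proof -
  have eqs: "n + axis j 2 = n + axis j 1 + axis j 1" "n + axis j (- 2) = n - axis j 1 - axis j 1"
    by (simp_all add: vec_eq_iff axis_def)
  show ?thesis unfolding eqs by (simp add: yhat_def field_simps)
qed

lemma averages_vanish_mono:
  assumes "u \<in> B0star" "\<And>n. norm (f n) \<le> norm (u n)"
  shows "averages_vanish f"
  unfolding averages_vanish_def
proof (rule Lim_null_comparison)
  show "((\<lambda>R :: real. 1 / R * (\<Sum>n | real_of_int (l1norm n) < R. (norm (u n))\<^sup>2)) \<longlongrightarrow> 0) at_top"
    using assms(1) by (simp add: B0star_def)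
  show "\<forall>\<^sub>F R in at_top. norm (1 / R * (\<Sum>n | real_of_int (l1norm n) < R. (norm (f n))\<^sup>2)) \<le>
      1 / R * (\<Sum>n | real_of_int (l1norm n) < R. (norm (u n))\<^sup>2)"
    using eventually_gt_at_top[of 0]
  proof eventually_elim
    case (elim R)
    have "(\<Sum>n | real_of_int (l1norm n) < R. (norm (f n))\<^sup>2) \<le> (\<Sum>n | real_of_int (l1norm n) < R. (norm (u n))\<^sup>2)"
      using assms(2) by (intro sum_mono power_mono) auto
    then show ?case using elim by (simp add: sum_nonneg divide_right_mono)
  qed
qed

text \<open>By \<open>yhat_yhat\<close> the diagonal part of the operator is C / 2, where C is the
  sum of the \<open>c j\<close>. Moved to the other side it leaves \<open>E - C / 2\<close>, while
  the absolute values of the shift coefficients add up to C / 2; the contraction condition is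
  exactly \<open>E > C\<close>.\<close>

lemma square_summable_outside_spectrum:
  assumes u: "averages_vanish u" and v: "square_summable v" and c: "\<And>j. c j \<ge> 0"
    and E: "E > (\<Sum>j\<in>UNIV. c j)"
    and eq: "\<And>n. of_real E * u n - (\<Sum>j\<in>UNIV. of_real (c j) * yhat j (yhat j u) n) = v n"
  shows "square_summable u"
proof -
  define C where "C = (\<Sum>j\<in>UNIV. c j)"
  have "C \<ge> 0" by (simp add: C_def sum_nonneg c)
  define D where "D = (\<lambda>(j, s). axis j s) ` ((UNIV :: 3 set) \<times> {2, -2 :: int})"
  \<comment> \<open>The choice recovers the axis from a shift vector with a single nonzero entry,
    since coefficients have to be indexed by shifts.\<close>
  define cc where "cc d = - of_real (c (SOME j. d $ j \<noteq> 0)) / (4 :: complex)" for d :: lattice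
  have inj: "inj_on (\<lambda>(j, s). axis j s) ((UNIV :: 3 set) \<times> {2, -2 :: int})"
    by (auto simp: inj_on_def axis_eq_axis)
  have cc: "cc (axis j s) = - of_real (c j) / 4" if "s \<in> {2, -2}" for s j
  proof -
    have "(SOME i. axis j s $ i \<noteq> 0) = j"
      using that by (intro some_equality) (auto simp: axis_def split: if_splits)
    then show ?thesis by (simp add: cc_def)
  qed
  have sumD: "(\<Sum>d\<in>D. F d) = (\<Sum>j\<in>UNIV. F (axis j 2) + F (axis j (- 2)))" for F :: "lattice \<Rightarrow> 'b::comm_monoid_add"
  proof -
    have "(\<Sum>d\<in>D. F d) = (\<Sum>(j, s)\<in>UNIV \<times> {2, -2}. F (axis j s))"
      unfolding D_def by (subst sum.reindex[OF inj]) (auto intro: sum.cong)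
    also have "\<dots> = (\<Sum>j\<in>UNIV. \<Sum>s\<in>{2, -2}. F (axis j s))"
      by (rule sum.cartesian_product[symmetric])
    finally show ?thesis by simp
  qed
  show ?thesis
  proof (rule square_summable_if_contraction[OF u v, where D = D and c = cc and E = "of_real (E - C / 2)"])
    show "finite D" by (simp add: D_def)
    fix n
    have "(\<Sum>j\<in>UNIV. of_real (c j) * yhat j (yhat j u) n) =
        (\<Sum>j\<in>UNIV. of_real (c j) / 2 * u n + (cc (axis j 2) * u (n + axis j 2) + cc (axis j (- 2)) * u (n + axis j (- 2))))"
      unfolding yhat_yhat by (intro sum.cong refl) (simp add: cc field_simps)
    also have "\<dots> = of_real (C / 2) * u n + (\<Sum>d\<in>D. cc d * u (n + d))"
      unfolding sumD sum.distrib by (simp add: C_def sum_distrib_right sum_divide_distrib)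
    finally show "of_real (E - C / 2) * u n = (\<Sum>d\<in>D. cc d * u (n + d)) + v n"
      using eq[of n] by (simp add: algebra_simps)
  next
    have "(\<Sum>d\<in>D. norm (cc d)) = C / 2"
      unfolding sumD by (simp add: cc norm_divide c C_def sum_divide_distrib)
    then show "(\<Sum>d\<in>D. norm (cc d)) < norm (complex_of_real (E - C / 2))"
      using E \<open>C \<ge> 0\<close> unfolding norm_of_real C_def by linarith
  qed
qed

section \<open>Transience and the Green function\<close>

type_synonym pt = "int \<times> int \<times> int"

definition e1 :: pt where "e1 = (1, 0, 0)"
definition e2 :: pt where "e2 = (0, 1, 0)"
definition e3 :: pt where "e3 = (0, 0, 1)"

definition nonzeros_finite :: "(pt \<Rightarrow> 'b::zero) \<Rightarrow> bool" where
  "nonzeros_finite f \<longleftrightarrow> finite {x. f x \<noteq> 0}"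

lemma nonzeros_finite_shift:
  assumes "nonzeros_finite f"
  shows "nonzeros_finite (\<lambda>x. f (x + d))"
  using finite_vimageI[OF assms[unfolded nonzeros_finite_def], of "\<lambda>x. x + d"]
  by (simp add: nonzeros_finite_def vimage_def)

lemma nonzeros_finite_comb:
  assumes "nonzeros_finite f" "nonzeros_finite g" "\<And>x. f x = 0 \<Longrightarrow> g x = 0 \<Longrightarrow> h x = 0"
  shows "nonzeros_finite h"
  unfolding nonzeros_finite_def
  by (rule finite_subset[of _ "{x. f x \<noteq> 0} \<union> {x. g x \<noteq> 0}"]) (use assms in \<open>auto simp: nonzeros_finite_def\<close>)

lemma nonzeros_finite_mono: "nonzeros_finite f \<Longrightarrow> (\<And>x. f x = 0 \<Longrightarrow> h x = 0) \<Longrightarrow> nonzeros_finite h"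
  by (rule nonzeros_finite_comb[of f f])

lemma summable_if_nonzeros_finite:
  fixes f :: "pt \<Rightarrow> 'b::{comm_monoid_add,topological_space}"
  shows "nonzeros_finite f \<Longrightarrow> f summable_on UNIV"
  unfolding nonzeros_finite_def by (intro finite_nonzero_values_imp_summable_on) auto

lemma infsum_translate:
  fixes f :: "pt \<Rightarrow> 'b::{comm_monoid_add,t2_space}"
  shows "infsum (\<lambda>x. f (x + d)) UNIV = infsum f UNIV"
proof -
  have "bij_betw (\<lambda>x :: pt. x + d) UNIV UNIV"
    by (rule bij_betwI[of _ _ _ "\<lambda>x. x - d"]) auto
  from infsum_reindex_bij_betw[OF this, of f] show ?thesis .
qed

section \<open>A unit flow of finite energy and transience\<close>

definition level :: "nat \<Rightarrow> (nat \<times> nat \<times> nat) set" where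
  "level l = {(a, b, c). a + b + c = l}"

lemma finite_level: "finite (level l)"
  by (rule finite_subset[of _ "{..l} \<times> {..l} \<times> {..l}"]) (auto simp: level_def)

lemma card_level_le: "card (level l) \<le> (l + 1)\<^sup>2"
proof -
  have "card (level l) \<le> card ({..l} \<times> {..l})"
    by (rule card_inj_on_le[of "\<lambda>(a, b, c). (a, b)"]) (auto simp: level_def inj_on_def)
  then show ?thesis by (simp add: power2_eq_square)
qed

text \<open>Each shift is injective, and the points of the next level outside its image have
  coordinate 0, so their terms carry the factor 0.\<close>

lemma level_shift_sum:
  fixes \<phi> :: "nat \<times> nat \<times> nat \<Rightarrow> real"
  shows "(\<Sum>(a, b, c)\<in>level l. real (a + 1) * \<phi> (a + 1, b, c)) = (\<Sum>(a, b, c)\<in>level (l + 1). real a * \<phi> (a, b, c))"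
    and "(\<Sum>(a, b, c)\<in>level l. real (b + 1) * \<phi> (a, b + 1, c)) = (\<Sum>(a, b, c)\<in>level (l + 1). real b * \<phi> (a, b, c))"
    and "(\<Sum>(a, b, c)\<in>level l. real (c + 1) * \<phi> (a, b, c + 1)) = (\<Sum>(a, b, c)\<in>level (l + 1). real c * \<phi> (a, b, c))"
proof -
  have *: "(\<Sum>x\<in>level l. F (s x)) = (\<Sum>x\<in>level (l + 1). F x)"
    if "inj_on s (level l)" "s ` level l \<subseteq> level (l + 1)" "\<And>x. x \<in> level (l + 1) - s ` level l \<Longrightarrow> F x = 0"
    for s and F :: "nat \<times> nat \<times> nat \<Rightarrow> real"
  proof -
    have "(\<Sum>x\<in>level l. F (s x)) = sum F (s ` level l)"
      using that(1) by (simp add: sum.reindex)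
    also have "\<dots> = sum F (level (l + 1))"
      using that finite_level by (intro sum.mono_neutral_left) auto
    finally show ?thesis .
  qed
  have s1: "(a, b, c) \<in> (\<lambda>(a, b, c). (a + 1, b, c)) ` level l" if "(a, b, c) \<in> level (l + 1)" "a \<noteq> 0" for a b c
    using that by (intro image_eqI[of _ _ "(a - 1, b, c)"]) (auto simp: level_def)
  have s2: "(a, b, c) \<in> (\<lambda>(a, b, c). (a, b + 1, c)) ` level l" if "(a, b, c) \<in> level (l + 1)" "b \<noteq> 0" for a b c
    using that by (intro image_eqI[of _ _ "(a, b - 1, c)"]) (auto simp: level_def)
  have s3: "(a, b, c) \<in> (\<lambda>(a, b, c). (a, b, c + 1)) ` level l" if "(a, b, c) \<in> level (l + 1)" "c \<noteq> 0" for a b c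
    using that by (intro image_eqI[of _ _ "(a, b, c - 1)"]) (auto simp: level_def)
  have "(\<Sum>x\<in>level l. (\<lambda>(a, b, c). real a * \<phi> (a, b, c)) ((\<lambda>(a, b, c). (a + 1, b, c)) x)) =
      (\<Sum>x\<in>level (l + 1). (\<lambda>(a, b, c). real a * \<phi> (a, b, c)) x)"
    by (rule *) (use s1 in \<open>force simp: inj_on_def level_def\<close>)+
  then show "(\<Sum>(a, b, c)\<in>level l. real (a + 1) * \<phi> (a + 1, b, c)) = (\<Sum>(a, b, c)\<in>level (l + 1). real a * \<phi> (a, b, c))"
    by (simp add: case_prod_unfold)
  have "(\<Sum>x\<in>level l. (\<lambda>(a, b, c). real b * \<phi> (a, b, c)) ((\<lambda>(a, b, c). (a, b + 1, c)) x)) =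
      (\<Sum>x\<in>level (l + 1). (\<lambda>(a, b, c). real b * \<phi> (a, b, c)) x)"
    by (rule *) (use s2 in \<open>force simp: inj_on_def level_def\<close>)+
  then show "(\<Sum>(a, b, c)\<in>level l. real (b + 1) * \<phi> (a, b + 1, c)) = (\<Sum>(a, b, c)\<in>level (l + 1). real b * \<phi> (a, b, c))"
    by (simp add: case_prod_unfold)
  have "(\<Sum>x\<in>level l. (\<lambda>(a, b, c). real c * \<phi> (a, b, c)) ((\<lambda>(a, b, c). (a, b, c + 1)) x)) =
      (\<Sum>x\<in>level (l + 1). (\<lambda>(a, b, c). real c * \<phi> (a, b, c)) x)"
    by (rule *) (use s3 in \<open>force simp: inj_on_def level_def\<close>)+
  then show "(\<Sum>(a, b, c)\<in>level l. real (c + 1) * \<phi> (a, b, c + 1)) = (\<Sum>(a, b, c)\<in>level (l + 1). real c * \<phi> (a, b, c))"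
    by (simp add: case_prod_unfold)
qed

text \<open>The reciprocal of the number of points in \<open>level l\<close>: the uniform
  distribution on that simplex.\<close>

definition urn_prob :: "nat \<Rightarrow> real" where
  "urn_prob l = 2 / (real (l + 1) * real (l + 2))"

text \<open>Polya's urn with three colours is uniformly distributed on the simplex at every time, so
  its transition probabilities define a unit flow from the origin to infinity. The flow has finite energy,
  which is the transience of the three-dimensional lattice.\<close>

lemma urn_flow_step:
  fixes \<phi> :: "nat \<times> nat \<times> nat \<Rightarrow> real"
  shows "urn_prob l * sum \<phi> (level l) - urn_prob (l + 1) * sum \<phi> (level (l + 1)) =
    (\<Sum>(a, b, c)\<in>level l. urn_prob l * (real (a + 1) / real (l + 3)) * (\<phi> (a, b, c) - \<phi> (a + 1, b, c)))
    + (\<Sum>(a, b, c)\<in>level l. urn_prob l * (real (b + 1) / real (l + 3)) * (\<phi> (a, b, c) - \<phi> (a, b + 1, c)))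
    + (\<Sum>(a, b, c)\<in>level l. urn_prob l * (real (c + 1) / real (l + 3)) * (\<phi> (a, b, c) - \<phi> (a, b, c + 1)))"
    (is "_ = ?R")
proof -
  define k where "k = urn_prob l / real (l + 3)"
  have "?R = (\<Sum>(a, b, c)\<in>level l. k * (real (a + 1) + real (b + 1) + real (c + 1)) * \<phi> (a, b, c))
      - k * ((\<Sum>(a, b, c)\<in>level l. real (a + 1) * \<phi> (a + 1, b, c)) + (\<Sum>(a, b, c)\<in>level l. real (b + 1) * \<phi> (a, b + 1, c))
      + (\<Sum>(a, b, c)\<in>level l. real (c + 1) * \<phi> (a, b, c + 1)))"
    unfolding sum_distrib_left sum.distrib[symmetric] sum_subtractf[symmetric]
    by (intro sum.cong refl) (simp add: k_def case_prod_unfold diff_divide_distrib add_divide_distrib algebra_simps)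
  also have "(\<Sum>(a, b, c)\<in>level l. k * (real (a + 1) + real (b + 1) + real (c + 1)) * \<phi> (a, b, c)) =
      (\<Sum>x\<in>level l. urn_prob l * \<phi> x)"
  proof (intro sum.cong refl, clarify)
    fix a b c assume "(a, b, c) \<in> level l"
    then have "real (a + 1) + real (b + 1) + real (c + 1) = real (l + 3)" by (auto simp: level_def)
    then show "k * (real (a + 1) + real (b + 1) + real (c + 1)) * \<phi> (a, b, c) = urn_prob l * \<phi> (a, b, c)"
      by (simp only: k_def) simp
  qed
  also have "(\<Sum>(a, b, c)\<in>level l. real (a + 1) * \<phi> (a + 1, b, c)) + (\<Sum>(a, b, c)\<in>level l. real (b + 1) * \<phi> (a, b + 1, c))
      + (\<Sum>(a, b, c)\<in>level l. real (c + 1) * \<phi> (a, b, c + 1)) = (\<Sum>x\<in>level (l + 1). real (l + 1) * \<phi> x)"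
    unfolding level_shift_sum sum.distrib[symmetric]
  proof (intro sum.cong refl, clarify)
    fix a b c assume "(a, b, c) \<in> level (l + 1)"
    then have "real a + real b + real c = real (l + 1)" by (auto simp: level_def)
    then show "real a * \<phi> (a, b, c) + real b * \<phi> (a, b, c) + real c * \<phi> (a, b, c) = real (l + 1) * \<phi> (a, b, c)"
      by (simp only: distrib_right[symmetric])
  qed
  also have "k * (\<Sum>x\<in>level (l + 1). real (l + 1) * \<phi> x) = urn_prob (l + 1) * sum \<phi> (level (l + 1))"
  proof -
    have "2 / (A * B) / C * A = 2 / (B * C)" if "A \<noteq> 0" for A B C :: real
      using that by simp
    from this[of "real (l + 1)" "real (l + 2)" "real (l + 3)"]
    have "k * real (l + 1) = 2 / (real (l + 2) * real (l + 3))"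
      unfolding k_def urn_prob_def by simp
    moreover have "l + 1 + 1 = l + 2" "l + 1 + 2 = l + 3" by auto
    ultimately have "k * real (l + 1) = urn_prob (l + 1)"
      unfolding urn_prob_def by (simp only:)
    then show ?thesis by (simp only: sum_distrib_left[symmetric] mult.assoc[symmetric])
  qed
  finally show ?thesis by (simp only: sum_distrib_left)
qed

text \<open>Of the order of l^2 points carry mass of order l^-2 each, so the terms are of order l^-2
  and are dominated by a telescoping series. Here dimension three is decisive: in the plane the
  terms would be of order 1 / l.\<close>

lemma sum_urn_prob_square: "(\<Sum>l<L. real (card (level l)) * (urn_prob l)\<^sup>2) \<le> 4"
proof -
  have "(\<Sum>l<L. real (card (level l)) * (urn_prob l)\<^sup>2) \<le> (\<Sum>l<L. 4 * (1 / real (l + 1) - 1 / real (l + 2)))"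
  proof (intro sum_mono)
    fix l
    have "real (card (level l)) * (urn_prob l)\<^sup>2 \<le> real ((l + 1)\<^sup>2) * (urn_prob l)\<^sup>2"
      using card_level_le[of l] by (intro mult_right_mono) (simp_all only: of_nat_le_iff zero_le_power2)
    also have "\<dots> = 4 / (real (l + 2) * real (l + 2))"
    proof -
      have "A\<^sup>2 * (2 / (A * B))\<^sup>2 = 4 / (B * B)" if "A \<noteq> 0" for A B :: real
        using that by (simp add: power2_eq_square)
      from this[of "real (l + 1)" "real (l + 2)"] show ?thesis
        by (simp add: urn_prob_def del: of_nat_add)
    qed
    also have "\<dots> \<le> 4 / (real (l + 1) * real (l + 2))"
      by (intro divide_left_mono mult_right_mono) auto
    also have "\<dots> = 4 * (1 / real (l + 1) - 1 / real (l + 2))"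
      by (simp add: field_simps)
    finally show "real (card (level l)) * (urn_prob l)\<^sup>2 \<le> 4 * (1 / real (l + 1) - 1 / real (l + 2))" .
  qed
  also have "\<dots> = 4 * (\<Sum>l<L. 1 / real (l + 1) - 1 / real (l + 2))"
    by (simp only: sum_distrib_left)
  also have "(\<Sum>l<L. 1 / real (l + 1) - 1 / real (l + 2)) = 1 - 1 / real (L + 1)"
    by (induction L) (auto simp: add.commute)
  also have "4 * (1 - 1 / real (L + 1)) \<le> 4" by simp
  finally show ?thesis .
qed

text \<open>Cauchy-Schwarz on the edges of one direction: \<theta> is the flow, of square sum at
  most 4, and \<psi> the increment along the edges.\<close>

lemma urn_branch_bound:
  fixes \<phi> \<psi> \<theta> :: "nat \<times> nat \<times> nat \<Rightarrow> real"
  assumes "\<And>l x. x \<in> level l \<Longrightarrow> \<bar>\<theta> x\<bar> \<le> urn_prob l" and "\<And>B. finite B \<Longrightarrow> (\<Sum>x\<in>B. (\<psi> x)\<^sup>2) \<le> D"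
  shows "(\<Sum>l<L. \<Sum>x\<in>level l. \<theta> x * \<psi> x)\<^sup>2 \<le> 4 * D"
proof -
  define B where "B = (\<Union>l<L. level l)"
  have "finite B" using finite_level by (auto simp: B_def)
  have disj: "\<forall>i\<in>{..<L}. \<forall>j\<in>{..<L}. i \<noteq> j \<longrightarrow> level i \<inter> level j = {}"
    by (auto simp: level_def)
  have UN: "(\<Sum>x\<in>B. F x) = (\<Sum>l<L. \<Sum>x\<in>level l. F x)" for F :: "_ \<Rightarrow> real"
    unfolding B_def by (rule sum.UNION_disjoint) (use finite_level disj in auto)
  have "D \<ge> 0" using assms(2)[of "{}"] by simp
  have "(\<Sum>l<L. \<Sum>x\<in>level l. \<theta> x * \<psi> x)\<^sup>2 = (\<Sum>x\<in>B. \<theta> x * \<psi> x)\<^sup>2"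
    by (simp only: UN)
  also have "\<dots> \<le> (\<Sum>x\<in>B. (\<theta> x)\<^sup>2) * (\<Sum>x\<in>B. (\<psi> x)\<^sup>2)"
    by (rule Cauchy_Schwarz_ineq_sum)
  also have "\<dots> \<le> 4 * D"
  proof (intro mult_mono assms(2) \<open>finite B\<close>)
    have "(\<Sum>x\<in>B. (\<theta> x)\<^sup>2) = (\<Sum>l<L. \<Sum>x\<in>level l. (\<theta> x)\<^sup>2)" by (rule UN)
    also have "\<dots> \<le> (\<Sum>l<L. \<Sum>x\<in>level l. (urn_prob l)\<^sup>2)"
    proof (intro sum_mono)
      fix l x assume "x \<in> level l"
      from power_mono[OF assms(1)[OF this] abs_ge_zero, of 2]
      show "(\<theta> x)\<^sup>2 \<le> (urn_prob l)\<^sup>2" by simp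
    qed
    also have "\<dots> \<le> 4" using sum_urn_prob_square[of L] by simp
    finally show "(\<Sum>x\<in>B. (\<theta> x)\<^sup>2) \<le> 4" .
  qed (auto simp: sum_nonneg)
  finally show ?thesis .
qed

definition energy :: "pt \<Rightarrow> (pt \<Rightarrow> real) \<Rightarrow> real" where
  "energy d f = infsum (\<lambda>x. (f x - f (x + d))\<^sup>2) UNIV"

text \<open>The flow leads from the origin to a level beyond the support, so \<open>f 0\<close> is
  the sum of the increments of \<open>f\<close> weighted by the flow. The constant 12 is 3 for
  splitting into three directions times 4 from \<open>urn_branch_bound\<close>.\<close>

lemma transience_at_0:
  assumes f: "nonzeros_finite f"
  shows "(f 0)\<^sup>2 \<le> 12 * (energy e1 f + energy e2 f + energy e3 f)"
proof -
  define i where "i = (\<lambda>(a, b, c). (int a, int b, int c))"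
  define \<phi> where "\<phi> x = f (i x)" for x
  have inji: "inj i" by (auto simp: inj_def i_def)
  have fin: "finite {x. \<phi> x \<noteq> 0}"
    using finite_vimageI[OF f[unfolded nonzeros_finite_def] inji] by (simp add: \<phi>_def vimage_def)
  define L where "L = Suc (\<Sum>(a, b, c)\<in>{x. \<phi> x \<noteq> 0}. a + b + c)"
  have zero: "\<phi> x = 0" if "x \<in> level L" for x
  proof (rule ccontr)
    assume "\<phi> x \<noteq> 0"
    then have "(case x of (a, b, c) \<Rightarrow> a + b + c) \<le> (\<Sum>(a, b, c)\<in>{x. \<phi> x \<noteq> 0}. a + b + c)"
      using fin by (intro member_le_sum) auto
    then show False using that by (auto simp: level_def L_def)
  qed
  have en: "(\<Sum>x\<in>B. (\<phi> x - f (i x + d))\<^sup>2) \<le> energy d f" if "finite B" for B d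
  proof -
    have "nonzeros_finite (\<lambda>x. (f x - f (x + d))\<^sup>2)"
      by (rule nonzeros_finite_comb[OF f nonzeros_finite_shift[OF f, of d]]) simp
    then have "(\<Sum>x\<in>i ` B. (f x - f (x + d))\<^sup>2) \<le> energy d f"
      unfolding energy_def using that by (intro finite_sum_le_infsum summable_if_nonzeros_finite) auto
    then show ?thesis by (simp add: sum.reindex[OF inj_on_subset[OF inji]] \<phi>_def)
  qed
  define X1 where "X1 = (\<Sum>l<L. \<Sum>x\<in>level l. (case x of (a, b, c) \<Rightarrow> urn_prob (a + b + c) * (real (a + 1) / real (a + b + c + 3))) * (\<phi> x - f (i x + e1)))"
  define X2 where "X2 = (\<Sum>l<L. \<Sum>x\<in>level l. (case x of (a, b, c) \<Rightarrow> urn_prob (a + b + c) * (real (b + 1) / real (a + b + c + 3))) * (\<phi> x - f (i x + e2)))"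
  define X3 where "X3 = (\<Sum>l<L. \<Sum>x\<in>level l. (case x of (a, b, c) \<Rightarrow> urn_prob (a + b + c) * (real (c + 1) / real (a + b + c + 3))) * (\<phi> x - f (i x + e3)))"
  have frac: "\<bar>urn_prob l * (real (j + 1) / real (l + 3))\<bar> \<le> urn_prob l" if "j \<le> l" for j l
  proof -
    have p: "urn_prob l \<ge> 0" by (simp add: urn_prob_def)
    have "real (j + 1) / real (l + 3) \<le> 1" using that by simp
    from mult_left_mono[OF this p] have "urn_prob l * (real (j + 1) / real (l + 3)) \<le> urn_prob l"
      by (simp only: mult_1_right)
    moreover have "urn_prob l * (real (j + 1) / real (l + 3)) \<ge> 0"
      using p by (intro mult_nonneg_nonneg divide_nonneg_nonneg) auto
    ultimately show ?thesis by (simp only: abs_of_nonneg)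
  qed
  have Xb: "(\<Sum>l<L. \<Sum>x\<in>level l. \<theta> x * (\<phi> x - f (i x + d)))\<^sup>2 \<le> 4 * energy d f"
    if "\<And>a b c. \<bar>\<theta> (a, b, c)\<bar> \<le> urn_prob (a + b + c)" for \<theta> d
  proof (rule urn_branch_bound)
    show "\<bar>\<theta> x\<bar> \<le> urn_prob l" if "x \<in> level l" for l x
      using that \<open>\<And>a b c. \<bar>\<theta> (a, b, c)\<bar> \<le> urn_prob (a + b + c)\<close> by (auto simp: level_def)
  qed (rule en)
  have X: "X1\<^sup>2 \<le> 4 * energy e1 f" "X2\<^sup>2 \<le> 4 * energy e2 f" "X3\<^sup>2 \<le> 4 * energy e3 f"
    unfolding X1_def X2_def X3_def by (rule Xb; simp only: prod.case; rule frac; simp)+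
  have "(\<Sum>l<L. urn_prob l * sum \<phi> (level l) - urn_prob (l + 1) * sum \<phi> (level (l + 1))) = X1 + X2 + X3"
    unfolding X1_def X2_def X3_def sum.distrib[symmetric]
  proof (rule sum.cong[OF refl])
    fix l
    show "urn_prob l * sum \<phi> (level l) - urn_prob (l + 1) * sum \<phi> (level (l + 1)) =
      (\<Sum>x\<in>level l. (case x of (a, b, c) \<Rightarrow> urn_prob (a + b + c) * (real (a + 1) / real (a + b + c + 3))) * (\<phi> x - f (i x + e1))
       + (case x of (a, b, c) \<Rightarrow> urn_prob (a + b + c) * (real (b + 1) / real (a + b + c + 3))) * (\<phi> x - f (i x + e2))
       + (case x of (a, b, c) \<Rightarrow> urn_prob (a + b + c) * (real (c + 1) / real (a + b + c + 3))) * (\<phi> x - f (i x + e3)))"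
      unfolding urn_flow_step sum.distrib[symmetric]
      by (intro sum.cong refl) (auto simp: level_def \<phi>_def i_def e1_def e2_def e3_def add_ac)
  qed
  also have "(\<Sum>l<L. urn_prob l * sum \<phi> (level l) - urn_prob (l + 1) * sum \<phi> (level (l + 1))) =
      urn_prob 0 * sum \<phi> (level 0) - urn_prob L * sum \<phi> (level L)"
    by (induction L) auto
  also have "level 0 = {(0, 0, 0)}" by (auto simp: level_def)
  also have "sum \<phi> (level L) = 0" using zero by simp
  finally have "f 0 = X1 + X2 + X3"
    by (simp add: urn_prob_def \<phi>_def i_def zero_prod_def)
  then have "(f 0)\<^sup>2 \<le> 3 * (X1\<^sup>2 + X2\<^sup>2 + X3\<^sup>2)"
    using sum_squares_bound[of X1 X2] sum_squares_bound[of X1 X3] sum_squares_bound[of X2 X3]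
    by (simp add: power2_eq_square algebra_simps)
  then show ?thesis using X by simp
qed

lemma transience:
  assumes "nonzeros_finite f"
  shows "(f x)\<^sup>2 \<le> 12 * (energy e1 f + energy e2 f + energy e3 f)"
proof -
  have "energy d (\<lambda>y. f (y + x)) = energy d f" for d
    unfolding energy_def using infsum_translate[of "\<lambda>y. (f y - f (y + d))\<^sup>2" x] by (simp add: add_ac)
  then show ?thesis using transience_at_0[OF nonzeros_finite_shift[OF assms, of x]] by simp
qed

lemma infsum_add_nz:
  fixes f g :: "pt \<Rightarrow> real"
  assumes "nonzeros_finite f" "nonzeros_finite g"
  shows "infsum (\<lambda>x. f x + g x) UNIV = infsum f UNIV + infsum g UNIV"
  using assms by (intro infsum_add summable_if_nonzeros_finite)

lemma energy_eq:
  assumes f: "nonzeros_finite f"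
  shows "energy d f = 2 * infsum (\<lambda>x. f x * f x) UNIV - infsum (\<lambda>x. f x * f (x + d)) UNIV - infsum (\<lambda>x. f x * f (x - d)) UNIV"
proof -
  have nz: "nonzeros_finite (\<lambda>x. f x * g x)" for g by (rule nonzeros_finite_mono[OF f]) simp
  have nzd: "nonzeros_finite (\<lambda>x. f (x + d) * g x)" for g
    by (rule nonzeros_finite_mono[OF nonzeros_finite_shift[OF f, of d]]) simp
  have nzm: "nonzeros_finite h \<Longrightarrow> nonzeros_finite (\<lambda>x. c * h x)" for c and h :: "pt \<Rightarrow> real"
    by (erule nonzeros_finite_mono) simp
  have "energy d f = infsum (\<lambda>x. (f x * f x + f (x + d) * f (x + d)) + (-2) * (f x * f (x + d))) UNIV"
    unfolding energy_def by (intro infsum_cong) (simp add: power2_eq_square algebra_simps)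
  also have "\<dots> = infsum (\<lambda>x. f x * f x + f (x + d) * f (x + d)) UNIV + infsum (\<lambda>x. (-2) * (f x * f (x + d))) UNIV"
    by (intro infsum_add_nz nzm nz nonzeros_finite_comb[OF nz nzd]) (auto)
  also have "infsum (\<lambda>x. f x * f x + f (x + d) * f (x + d)) UNIV = infsum (\<lambda>x. f x * f x) UNIV + infsum (\<lambda>x. f (x + d) * f (x + d)) UNIV"
    by (intro infsum_add_nz nz nzd)
  also have "infsum (\<lambda>x. f (x + d) * f (x + d)) UNIV = infsum (\<lambda>x. f x * f x) UNIV"
    by (rule infsum_translate)
  also have "infsum (\<lambda>x. (-2) * (f x * f (x + d))) UNIV = (-2) * infsum (\<lambda>x. f x * f (x + d)) UNIV"
    by (rule infsum_cmult_right')
  finally have "energy d f = 2 * infsum (\<lambda>x. f x * f x) UNIV - 2 * infsum (\<lambda>x. f x * f (x + d)) UNIV" by simp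
  moreover have "infsum (\<lambda>x. f x * f (x - d)) UNIV = infsum (\<lambda>x. f x * f (x + d)) UNIV"
    using infsum_translate[of "\<lambda>x. f x * f (x - d)" d] by (simp add: mult.commute)
  ultimately show ?thesis by simp
qed

section \<open>The random walk with conductances 1, p, q and its Green function\<close>

locale lattice_walk =
  fixes p q :: real
  assumes pos: "p > 0" "q > 0"
begin

definition total :: real where
  "total = 2 * (1 + p + q)"

definition nbsum :: "(pt \<Rightarrow> 'b::real_vector) \<Rightarrow> pt \<Rightarrow> 'b" where
  "nbsum f x = (f (x + e1) + f (x - e1)) + p *\<^sub>R (f (x + e2) + f (x - e2)) + q *\<^sub>R (f (x + e3) + f (x - e3))"

lemma total_pos: "total > 0"
  using pos by (simp add: total_def)

text \<open>The distribution after \<open>m\<close> steps of the walk started at the origin.\<close>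

fun heat :: "nat \<Rightarrow> pt \<Rightarrow> real" where
  "heat 0 x = (if x = 0 then 1 else 0)"
| "heat (Suc m) x = nbsum (heat m) x / total"

lemma nonzeros_finite_nbsum:
  fixes f :: "pt \<Rightarrow> real"
  assumes "nonzeros_finite f"
  shows "nonzeros_finite (nbsum f)"
proof -
  have s: "nonzeros_finite (\<lambda>x. f (x + d))" "nonzeros_finite (\<lambda>x. f (x - d))" for d
    using nonzeros_finite_shift[OF assms, of d] nonzeros_finite_shift[OF assms, of "- d"] by simp_all
  have pair: "nonzeros_finite (\<lambda>x. c * (f (x + d) + f (x - d)))" for c d
    by (rule nonzeros_finite_comb[OF s(1)[of d] s(2)[of d]]) simp
  have "nonzeros_finite (\<lambda>x. 1 * (f (x + e1) + f (x - e1)) + p * (f (x + e2) + f (x - e2)))"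
    by (rule nonzeros_finite_comb[OF pair[of 1 e1] pair[of p e2]]) simp
  from nonzeros_finite_comb[OF this pair[of q e3], of "nbsum f"] show ?thesis
    by (simp add: nbsum_def)
qed

lemma nonzeros_finite_heat: "nonzeros_finite (heat m)"
proof (induction m)
  case 0
  have "{x. heat 0 x \<noteq> 0} \<subseteq> {0}" by auto
  then show ?case unfolding nonzeros_finite_def by (rule finite_subset) simp
next
  case (Suc m)
  from nonzeros_finite_nbsum[OF this] show ?case
    by (rule nonzeros_finite_mono) simp
qed

lemma heat_nonneg: "heat m x \<ge> 0"
proof (induction m arbitrary: x)
  case (Suc m)
  then show ?case using pos total_pos by (simp add: nbsum_def)
qed simp

text \<open>The expected number of visits to \<open>x\<close> before time \<open>M\<close>.
  Truncation preserves finite support, as \<open>transience\<close> demands.\<close>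

definition green_upto :: "nat \<Rightarrow> pt \<Rightarrow> real" where
  "green_upto M x = (\<Sum>m<M. heat m x)"

lemma nonzeros_finite_green_upto: "nonzeros_finite (green_upto M)"
proof (induction M)
  case 0
  then show ?case by (simp add: nonzeros_finite_def green_upto_def)
next
  case (Suc M)
  show ?case
    by (rule nonzeros_finite_comb[OF Suc nonzeros_finite_heat[of M]]) (simp add: green_upto_def)
qed

lemma green_upto_nonneg: "green_upto M x \<ge> 0"
  unfolding green_upto_def by (intro sum_nonneg heat_nonneg)

lemma nbsum_green_upto: "nbsum (green_upto M) x / total = green_upto M x + heat M x - heat 0 x"
proof (induction M)
  case 0
  then show ?case by (simp add: green_upto_def nbsum_def)
next
  case (Suc M)
  have "nbsum (green_upto (Suc M)) x = nbsum (green_upto M) x + nbsum (heat M) x"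
    by (simp add: nbsum_def green_upto_def algebra_simps)
  moreover have "green_upto (Suc M) x = green_upto M x + heat M x" by (simp add: green_upto_def)
  moreover have "heat (Suc M) x = nbsum (heat M) x / total" by simp
  ultimately show ?case using Suc by (simp only: add_divide_distrib)
qed

text \<open>Summation by parts turns the weighted energy into the pairing of \<open>f\<close> with
  \<open>total * (heat 0 - heat M)\<close>. The part with \<open>heat M\<close> has a favourable
  sign, and \<open>heat 0\<close> is the point mass at the origin.\<close>

lemma energy_green_upto:
  "energy e1 (green_upto M) + p * energy e2 (green_upto M) + q * energy e3 (green_upto M) \<le> total * green_upto M 0"
proof -
  define f where "f = green_upto M"
  have f: "nonzeros_finite f" unfolding f_def by (rule nonzeros_finite_green_upto)
  have nz: "nonzeros_finite (\<lambda>x. f x * g x)" for g :: "pt \<Rightarrow> real" by (rule nonzeros_finite_mono[OF f]) simp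
  have I: "infsum (\<lambda>x. f x * (a * g x + h x)) UNIV = a * infsum (\<lambda>x. f x * g x) UNIV + infsum (\<lambda>x. f x * h x) UNIV" for a and g h :: "pt \<Rightarrow> real"
  proof -
    have "infsum (\<lambda>x. f x * (a * g x + h x)) UNIV = infsum (\<lambda>x. f x * (a * g x) + f x * h x) UNIV"
      by (simp add: distrib_left)
    also have "\<dots> = infsum (\<lambda>x. f x * (a * g x)) UNIV + infsum (\<lambda>x. f x * h x) UNIV"
      by (rule infsum_add_nz[OF nz nz])
    also have "infsum (\<lambda>x. f x * (a * g x)) UNIV = infsum (\<lambda>x. a * (f x * g x)) UNIV"
      by (simp add: mult_ac)
    also have "\<dots> = a * infsum (\<lambda>x. f x * g x) UNIV" by (rule infsum_cmult_right')
    finally show ?thesis .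
  qed
  \<comment> \<open>The nesting and the final 0 give the summand the shape to which \<open>I\<close>
    applies repeatedly.\<close>
  have "energy e1 f + p * energy e2 f + q * energy e3 f = infsum (\<lambda>x. f x * (total * f x +
      ((-1) * f (x + e1) + ((-1) * f (x - e1) + ((-p) * f (x + e2) + ((-p) * f (x - e2) + ((-q) * f (x + e3) + ((-q) * f (x - e3) + 0)))))))) UNIV"
    unfolding I energy_eq[OF f] by (simp add: total_def algebra_simps)
  also have "\<dots> = infsum (\<lambda>x. f x * (total * (heat 0 x - heat M x))) UNIV"
  proof (intro infsum_cong arg_cong[where f = "\<lambda>z. _ * z"])
    fix x
    have "nbsum f x = total * (f x + heat M x - heat 0 x)"
      using nbsum_green_upto[of M x] total_pos by (simp add: f_def field_simps)
    then show "total * f x + ((-1) * f (x + e1) + ((-1) * f (x - e1) + ((-p) * f (x + e2) + ((-p) * f (x - e2) + ((-q) * f (x + e3) + ((-q) * f (x - e3) + 0)))))) = total * (heat 0 x - heat M x)"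
      by (simp add: nbsum_def algebra_simps)
  qed
  also have "\<dots> \<le> infsum (\<lambda>x :: pt. if x = 0 then total * f 0 else 0) UNIV"
  proof (intro infsum_mono summable_if_nonzeros_finite nz)
    show "nonzeros_finite (\<lambda>x. if x = 0 then total * f 0 else 0)"
      unfolding nonzeros_finite_def by (rule finite_subset[of _ "{0}"]) auto
    show "f x * (total * (heat 0 x - heat M x)) \<le> (if x = 0 then total * f 0 else 0)" for x
    proof -
      have "0 \<le> f x * (total * heat M x)"
        using green_upto_nonneg heat_nonneg total_pos by (simp add: f_def)
      then show ?thesis by (auto simp: algebra_simps)
    qed
  qed
  also have "\<dots> = infsum (\<lambda>x. total * f 0) {0 :: pt}"
    by (rule infsum_cong_neutral) auto
  also have "\<dots> = total * f 0" by simp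
  finally show ?thesis by (simp add: f_def)
qed

text \<open>The 12 is that of \<open>transience\<close>; the sum \<open>1 + 1 / p + 1 / q\<close> is
  the price of passing from the energy with conductances to the plain one.\<close>

definition kconst :: real where
  "kconst = 12 * total * (1 + 1 / p + 1 / q)"

lemma energy_green_le:
  assumes "d \<in> {e1, e2, e3}"
  shows "energy d (green_upto M) \<le> total * (1 + 1 / p + 1 / q) * green_upto M 0"
    and "12 * (energy e1 (green_upto M) + energy e2 (green_upto M) + energy e3 (green_upto M)) \<le> kconst * green_upto M 0"
proof -
  define t where "t = total * green_upto M 0"
  have e0: "energy d (green_upto M) \<ge> 0" for d
    unfolding energy_def by (intro infsum_nonneg) auto
  have le: "energy e1 (green_upto M) + p * energy e2 (green_upto M) + q * energy e3 (green_upto M) \<le> t"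
    unfolding t_def by (rule energy_green_upto)
  have m: "p * energy e2 (green_upto M) \<ge> 0" "q * energy e3 (green_upto M) \<ge> 0"
    using e0 pos by auto
  have b: "energy e1 (green_upto M) \<le> t" "energy e2 (green_upto M) \<le> t / p" "energy e3 (green_upto M) \<le> t / q"
    using le m e0[of e1] pos by (auto simp: field_simps)
  have sum: "energy e1 (green_upto M) + energy e2 (green_upto M) + energy e3 (green_upto M) \<le> total * (1 + 1 / p + 1 / q) * green_upto M 0"
    using b by (simp add: t_def algebra_simps)
  then show "12 * (energy e1 (green_upto M) + energy e2 (green_upto M) + energy e3 (green_upto M)) \<le> kconst * green_upto M 0"
    by (simp add: kconst_def)
  show "energy d (green_upto M) \<le> total * (1 + 1 / p + 1 / q) * green_upto M 0"
    using assms sum e0[of e1] e0[of e2] e0[of e3] by auto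
qed

lemma kconst_pos: "kconst > 0"
  using pos total_pos by (simp add: kconst_def add_pos_pos)

text \<open>At the origin the estimate reads G^2 \<le> K G, which bounds G by K independently of
  \<open>M\<close>. At other points the square is then at most K G(0) \<le> K^2.\<close>

lemma green_upto_bounded: "green_upto M x \<le> kconst"
proof -
  have sq: "(green_upto M x)\<^sup>2 \<le> kconst * green_upto M 0" for x
    using transience[OF nonzeros_finite_green_upto[of M], of x] energy_green_le(2)[of e1 M] by simp
  have 0: "green_upto M 0 \<le> kconst"
  proof (cases "green_upto M 0 = 0")
    case True
    then show ?thesis using kconst_pos by simp
  next
    case False
    then have "green_upto M 0 > 0" using green_upto_nonneg[of M 0] by simp
    then show ?thesis using sq[of 0] by (simp add: power2_eq_square)
  qed
  have "(green_upto M x)\<^sup>2 \<le> kconst * kconst"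
    by (rule order_trans[OF sq mult_left_mono[OF 0 less_imp_le[OF kconst_pos]]])
  then have "(green_upto M x)\<^sup>2 \<le> kconst\<^sup>2"
    by (simp only: power2_eq_square[of kconst])
  then show ?thesis
    by (rule power2_le_imp_le) (rule less_imp_le[OF kconst_pos])
qed

definition green :: "pt \<Rightarrow> real" where
  "green x = (SUP M. green_upto M x)"

lemma green_limit: "(\<lambda>M. green_upto M x) \<longlonglongrightarrow> green x"
  unfolding green_def
proof (rule LIMSEQ_incseq_SUP)
  show "bdd_above (range (\<lambda>M. green_upto M x))"
    by (rule bdd_aboveI2[where M = kconst]) (rule green_upto_bounded)
  show "incseq (\<lambda>M. green_upto M x)"
    by (rule incseq_SucI) (simp add: green_upto_def heat_nonneg)
qed

lemma heat_limit: "(\<lambda>M. heat M x) \<longlonglongrightarrow> 0"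
proof -
  have "(\<lambda>M. green_upto (Suc M) x - green_upto M x) \<longlonglongrightarrow> green x - green x"
    by (intro tendsto_diff green_limit LIMSEQ_Suc)
  then show ?thesis by (simp add: green_upto_def)
qed

lemma nbsum_green: "nbsum green x = total * (green x - heat 0 x)"
proof -
  have "(\<lambda>M. nbsum (green_upto M) x) \<longlonglongrightarrow> nbsum green x"
    unfolding nbsum_def by (intro tendsto_intros green_limit)
  moreover have "(\<lambda>M. nbsum (green_upto M) x) \<longlonglongrightarrow> total * (green x + 0 - heat 0 x)"
  proof -
    have "nbsum (green_upto M) x = total * (green_upto M x + heat M x - heat 0 x)" for M
      using nbsum_green_upto[of M x] total_pos by (simp add: field_simps)
    moreover have "(\<lambda>M. total * (green_upto M x + heat M x - heat 0 x)) \<longlonglongrightarrow> total * (green x + 0 - heat 0 x)"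
      by (intro tendsto_mult tendsto_diff tendsto_add tendsto_const green_limit heat_limit)
    ultimately show ?thesis by presburger
  qed
  ultimately have "nbsum green x = total * (green x + 0 - heat 0 x)" by (rule LIMSEQ_unique)
  then show ?thesis by simp
qed

text \<open>The energies of the truncations are bounded independently of \<open>M\<close>, and on
  finite sets the bound survives the limit.\<close>

lemma green_difference_square_summable:
  assumes d: "d \<in> {e1, e2, e3}"
  shows "square_summable (\<lambda>x. of_real (green (x + d) - green x))"
proof -
  define C where "C = total * (1 + 1 / p + 1 / q) * kconst"
  have bound: "(\<Sum>x\<in>F. (green x - green (x + d))\<^sup>2) \<le> C" if "finite F" for F
  proof (rule LIMSEQ_le_const2)
    show "(\<lambda>M. \<Sum>x\<in>F. (green_upto M x - green_upto M (x + d))\<^sup>2) \<longlonglongrightarrow> (\<Sum>x\<in>F. (green x - green (x + d))\<^sup>2)"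
      by (intro tendsto_intros green_limit)
    show "\<exists>N. \<forall>M\<ge>N. (\<Sum>x\<in>F. (green_upto M x - green_upto M (x + d))\<^sup>2) \<le> C"
    proof (intro exI allI impI)
      fix M
      have "nonzeros_finite (\<lambda>x. (green_upto M x - green_upto M (x + d))\<^sup>2)"
        by (rule nonzeros_finite_comb[OF nonzeros_finite_green_upto nonzeros_finite_shift[OF nonzeros_finite_green_upto, of M d]]) simp
      then have "(\<Sum>x\<in>F. (green_upto M x - green_upto M (x + d))\<^sup>2) \<le> energy d (green_upto M)"
        unfolding energy_def using that by (intro finite_sum_le_infsum summable_if_nonzeros_finite) auto
      also have "\<dots> \<le> total * (1 + 1 / p + 1 / q) * green_upto M 0" by (rule energy_green_le(1)[OF d])
      also have "\<dots> \<le> C"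
        unfolding C_def using pos total_pos by (intro mult_left_mono green_upto_bounded) (auto intro!: mult_nonneg_nonneg add_nonneg_nonneg)
      finally show "(\<Sum>x\<in>F. (green_upto M x - green_upto M (x + d))\<^sup>2) \<le> C" .
    qed
  qed
  show ?thesis
    unfolding square_summable_def
  proof (rule nonneg_bdd_above_summable_on)
    show "bdd_above (sum (\<lambda>x. (norm (complex_of_real (green (x + d) - green x)))\<^sup>2) ` {F. F \<subseteq> UNIV \<and> finite F})"
    proof (rule bdd_aboveI2[where M = C])
      fix F :: "pt set" assume "F \<in> {F. F \<subseteq> UNIV \<and> finite F}"
      then have "finite F" by simp
      have "(norm (complex_of_real (green (x + d) - green x)))\<^sup>2 = (green x - green (x + d))\<^sup>2" for x
        by (simp only: norm_of_real power2_abs power2_commute[of "green x"])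
      then show "(\<Sum>x\<in>F. (norm (complex_of_real (green (x + d) - green x)))\<^sup>2) \<le> C"
        using bound[OF \<open>finite F\<close>] by (simp only:)
    qed
  qed auto
qed

text \<open>The admissible translations form a subgroup of the lattice, and it contains the three
  generators.\<close>

lemma green_translate_square_summable: "square_summable (\<lambda>x. of_real (green (x + d) - green x))"
proof -
  define H where "H = {d. square_summable (\<lambda>x. complex_of_real (green (x + d) - green x))}"
  have add: "m + n \<in> H" if "m \<in> H" "n \<in> H" for m n
  proof -
    have "square_summable (\<lambda>x. complex_of_real (green ((x + n) + m) - green (x + n)) + complex_of_real (green (x + n) - green x))"
      using that unfolding H_def mem_Collect_eq by (intro square_summable_add square_summable_shift)
    then show ?thesis by (simp add: H_def add_ac)
  qed
  have minus: "- m \<in> H" if "m \<in> H" for m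
  proof -
    have "square_summable (\<lambda>x. (-1) * complex_of_real (green ((x + - m) + m) - green (x + - m)))"
      using that unfolding H_def mem_Collect_eq by (intro square_summable_mult square_summable_shift)
    then show ?thesis by (simp add: H_def)
  qed
  have zero: "0 \<in> H" by (simp add: H_def square_summable_def)
  have e: "e1 \<in> H" "e2 \<in> H" "e3 \<in> H"
    using green_difference_square_summable by (auto simp: H_def)
  have nat: "(int a, int b, int c) \<in> H" for a b c
  proof -
    have 1: "(int a, 0, 0) \<in> H"
    proof (induction a)
      case (Suc a)
      from add[OF e(1) this] show ?case by (simp add: e1_def)
    qed (use zero in \<open>simp add: zero_prod_def\<close>)
    have 2: "(0, int b, 0) \<in> H"
    proof (induction b)
      case (Suc b)
      from add[OF e(2) this] show ?case by (simp add: e2_def)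
    qed (use zero in \<open>simp add: zero_prod_def\<close>)
    have 3: "(0, 0, int c) \<in> H"
    proof (induction c)
      case (Suc c)
      from add[OF e(3) this] show ?case by (simp add: e3_def)
    qed (use zero in \<open>simp add: zero_prod_def\<close>)
    from add[OF add[OF 1 2] 3] show ?thesis by simp
  qed
  have "d \<in> H"
  proof (cases d)
    case (fields a b c)
    have "(int (nat a), int (nat b), int (nat c)) + - (int (nat (- a)), int (nat (- b)), int (nat (- c))) \<in> H"
      by (intro add minus nat)
    moreover have "int (nat a) - int (nat (- a)) = a" for a by simp
    ultimately show ?thesis by (simp add: fields)
  qed
  then show ?thesis by (simp add: H_def)
qed

end

section \<open>Energies at the edge of the spectrum\<close>

text \<open>The squared positive part is differentiable at the ends of its support, so second
  differences are of order 1 / R^2 everywhere; a tent would have second differences of order 1 / R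
  at its kinks.\<close>

definition hat :: "nat \<Rightarrow> int \<Rightarrow> real" where
  "hat R k = (max 0 (1 - (of_int k / real R)\<^sup>2))\<^sup>2"

lemma hat_bounds: "0 \<le> hat R k" "hat R k \<le> 1"
  by (auto simp: hat_def intro!: power_le_one)

lemma hat_outside:
  assumes "R \<ge> 1" "\<bar>k\<bar> \<ge> int R"
  shows "hat R k = 0"
proof -
  have "1 \<le> \<bar>of_int k / real R\<bar>" using assms by simp
  from one_le_power[OF this, of 2] have "1 \<le> (of_int k / real R)\<^sup>2" by (simp only: power2_abs)
  then show ?thesis by (simp add: hat_def)
qed

text \<open>The derivative of the squared positive part has Lipschitz constant 2, so the first order
  remainder is at most the square of the increment.\<close>

lemma positive_part_square_taylor:
  fixes u \<alpha> :: real
  shows "\<bar>(max 0 (u + \<alpha>))\<^sup>2 - (max 0 u)\<^sup>2 - 2 * \<alpha> * max 0 u\<bar> \<le> \<alpha>\<^sup>2"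
proof -
  consider "u \<ge> 0" "u + \<alpha> \<ge> 0" | "u \<ge> 0" "u + \<alpha> < 0" | "u < 0" "u + \<alpha> \<ge> 0" | "u < 0" "u + \<alpha> < 0" by linarith
  then show ?thesis
  proof cases
    case 1
    then show ?thesis by (simp add: max_def power2_eq_square algebra_simps)
  next
    case 2
    then have "\<alpha> \<le> - u" by simp
    have "- u\<^sup>2 - 2 * \<alpha> * u = \<alpha>\<^sup>2 - (u + \<alpha>)\<^sup>2" by (simp add: power2_eq_square algebra_simps)
    moreover have "(u + \<alpha>)\<^sup>2 \<le> \<alpha>\<^sup>2" using 2 abs_le_square_iff[of "u + \<alpha>" \<alpha>] by simp
    ultimately have "\<bar>- u\<^sup>2 - 2 * \<alpha> * u\<bar> \<le> \<alpha>\<^sup>2" by simp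
    then show ?thesis using 2 by (simp add: max_def)
  next
    case 3
    then have "(u + \<alpha>)\<^sup>2 \<le> \<alpha>\<^sup>2" by (intro power_mono) auto
    then show ?thesis using 3 by (simp add: max_def)
  next
    case 4
    then show ?thesis by (simp add: max_def)
  qed
qed

text \<open>The increments \<alpha> and \<beta> of the argument add up to -2 / r^2, so the linear
  Taylor terms give at most 4 / r^2. The remainders give (8 x^2 + 2) / r^4, at most 34 / r^2 because
  \<open>\<bar>x\<bar> \<le> 2 * r\<close>; hence 38.\<close>

lemma hat_second_difference:
  assumes R: "R \<ge> 1"
  shows "\<bar>hat R (k + 1) + hat R (k - 1) - 2 * hat R k\<bar> \<le> 38 / (real R)\<^sup>2"
proof (cases "\<bar>k\<bar> \<le> int R + 1")
  case False
  then have "\<bar>k + 1\<bar> \<ge> int R" "\<bar>k - 1\<bar> \<ge> int R" "\<bar>k\<bar> \<ge> int R" by auto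
  then show ?thesis using hat_outside[OF R] by simp
next
  case True
  define r where "r = real R"
  define x where "x = real_of_int k"
  define u where "u = 1 - (x / r)\<^sup>2"
  define \<alpha> where "\<alpha> = (- 2 * x - 1) / r\<^sup>2"
  define \<beta> where "\<beta> = (2 * x - 1) / r\<^sup>2"
  have "r \<ge> 1" using R by (simp add: r_def)
  have "\<bar>x\<bar> \<le> r + 1" using True unfolding x_def r_def by linarith
  also have "r + 1 \<le> 2 * r" using \<open>r \<ge> 1\<close> by simp
  finally have "x\<^sup>2 \<le> (2 * r)\<^sup>2" using power_mono[of "\<bar>x\<bar>" "2 * r" 2] by simp
  then have x2: "x\<^sup>2 \<le> 4 * r\<^sup>2" by (simp add: power_mult_distrib)
  have r2: "1 \<le> r\<^sup>2" using \<open>r \<ge> 1\<close> by simp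
  have "1 - ((x + 1) / r)\<^sup>2 = u + \<alpha>" "1 - ((x - 1) / r)\<^sup>2 = u + \<beta>"
    using \<open>r \<ge> 1\<close> by (simp_all add: u_def \<alpha>_def \<beta>_def power2_eq_square field_simps)
  then have h: "hat R (k + 1) = (max 0 (u + \<alpha>))\<^sup>2" "hat R (k - 1) = (max 0 (u + \<beta>))\<^sup>2" "hat R k = (max 0 u)\<^sup>2"
    by (simp_all add: hat_def r_def x_def u_def)
  have "\<alpha> + \<beta> = - 2 / r\<^sup>2" by (simp add: \<alpha>_def \<beta>_def add_divide_distrib[symmetric])
  have 1: "\<bar>hat R (k + 1) + hat R (k - 1) - 2 * hat R k\<bar> \<le> \<alpha>\<^sup>2 + \<beta>\<^sup>2 + \<bar>2 * (\<alpha> + \<beta>) * max 0 u\<bar>"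
  proof -
    have tri: "\<bar>A + B - 2 * C\<bar> \<le> a + b + \<bar>m + n\<bar>" if "\<bar>A - C - m\<bar> \<le> a" "\<bar>B - C - n\<bar> \<le> b" for A B C a b m n :: real
      using that by linarith
    have eq: "2 * (\<alpha> + \<beta>) * max 0 u = 2 * \<alpha> * max 0 u + 2 * \<beta> * max 0 u"
      by (simp only: distrib_left distrib_right)
    show ?thesis
      unfolding h eq by (rule tri[OF positive_part_square_taylor positive_part_square_taylor])
  qed
  have 2: "\<bar>2 * (\<alpha> + \<beta>) * max 0 u\<bar> \<le> 4 / r\<^sup>2"
  proof -
    have "\<bar>2 * (\<alpha> + \<beta>) * max 0 u\<bar> = 4 / r\<^sup>2 * max 0 u"
      unfolding \<open>\<alpha> + \<beta> = - 2 / r\<^sup>2\<close> by (simp add: abs_mult)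
    also have "\<dots> \<le> 4 / r\<^sup>2 * 1" by (intro mult_left_mono) (auto simp: u_def)
    finally show ?thesis by simp
  qed
  have 3: "\<alpha>\<^sup>2 + \<beta>\<^sup>2 \<le> 34 / r\<^sup>2"
  proof -
    have eq: "(- 2 * x - 1)\<^sup>2 + (2 * x - 1)\<^sup>2 = 8 * x\<^sup>2 + 2"
      by (simp add: power2_eq_square algebra_simps)
    have a: "\<alpha>\<^sup>2 + \<beta>\<^sup>2 = (8 * x\<^sup>2 + 2) / (r\<^sup>2)\<^sup>2"
      unfolding \<alpha>_def \<beta>_def power_divide add_divide_distrib[symmetric] eq ..
    have b: "(8 * x\<^sup>2 + 2) / (r\<^sup>2)\<^sup>2 \<le> (34 * r\<^sup>2) / (r\<^sup>2)\<^sup>2"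
      using x2 r2 by (intro divide_right_mono) auto
    have c: "(34 * s) / s\<^sup>2 = 34 / s" if "s \<ge> 1" for s :: real
      using that by (simp add: power2_eq_square)
    show ?thesis
      unfolding a using b unfolding c[OF r2] .
  qed
  have "\<bar>hat R (k + 1) + hat R (k - 1) - 2 * hat R k\<bar> \<le> 34 / r\<^sup>2 + 4 / r\<^sup>2"
    using 1 2 3 by linarith
  then show ?thesis by (simp add: r_def add_divide_distrib[symmetric])
qed

lemma hat_tendsto_1: "(\<lambda>R. hat R k) \<longlonglongrightarrow> 1"
proof -
  have "(\<lambda>R. (max 0 (1 - (of_int k * inverse (real R))\<^sup>2))\<^sup>2) \<longlonglongrightarrow> (max 0 (1 - (of_int k * 0)\<^sup>2))\<^sup>2"
    by (intro tendsto_intros tendsto_inverse_0_at_top filterlim_real_sequentially)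
  then show ?thesis by (simp add: hat_def divide_inverse)
qed

definition box3 :: "nat \<Rightarrow> pt set" where
  "box3 R = {-int R..int R} \<times> {-int R..int R} \<times> {-int R..int R}"

lemma finite_box3: "finite (box3 R)"
  by (simp add: box3_def)

lemma card_box3: "card (box3 R) = (2 * R + 1) ^ 3"
  by (simp add: box3_def card_cartesian_product power3_eq_cube nat_add_distrib nat_mult_distrib)

section \<open>Cut-offs and the total mass of the source\<close>

context lattice_walk
begin

definition cutoff :: "nat \<Rightarrow> pt \<Rightarrow> real" where
  "cutoff R x = hat R (fst x) * hat R (fst (snd x)) * hat R (snd (snd x))"

lemma cutoff_outside:
  assumes "R \<ge> 1" "x \<notin> box3 R"
  shows "cutoff R x = 0"
  using assms hat_outside[of R "fst x"] hat_outside[of R "fst (snd x)"] hat_outside[of R "snd (snd x)"]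
  by (cases x) (auto simp: cutoff_def box3_def abs_if split: if_splits)

lemma cutoff_nbsum_le:
  assumes R: "R \<ge> 1"
  shows "\<bar>nbsum (cutoff R) x - total * cutoff R x\<bar> \<le> (1 + p + q) * (38 / (real R)\<^sup>2)"
proof -
  obtain k a b where x: "x = (k, a, b)" by (cases x)
  define D where "D j = hat R (j + 1) + hat R (j - 1) - 2 * hat R j" for j
  have D: "\<bar>D j\<bar> \<le> 38 / (real R)\<^sup>2" for j unfolding D_def by (rule hat_second_difference[OF R])
  have prod: "\<bar>D j * (hat R i * hat R m)\<bar> \<le> 38 / (real R)\<^sup>2" for j i m
  proof -
    have "\<bar>D j\<bar> * (hat R i * hat R m) \<le> 38 / (real R)\<^sup>2 * (1 * 1)"
      using hat_bounds D by (intro mult_mono) (auto intro: mult_nonneg_nonneg)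
    then show ?thesis using hat_bounds by (simp add: abs_mult)
  qed
  have "nbsum (cutoff R) x - total * cutoff R x =
      D k * (hat R a * hat R b) + p * (D a * (hat R k * hat R b)) + q * (D b * (hat R k * hat R a))"
    by (simp add: nbsum_def cutoff_def x e1_def e2_def e3_def D_def total_def algebra_simps)
  also have "\<bar>\<dots>\<bar> \<le> \<bar>D k * (hat R a * hat R b)\<bar> + p * \<bar>D a * (hat R k * hat R b)\<bar> + q * \<bar>D b * (hat R k * hat R a)\<bar>"
  proof -
    have "\<bar>A + p * B + q * C\<bar> \<le> \<bar>A\<bar> + p * \<bar>B\<bar> + q * \<bar>C\<bar>" for A B C :: real
      using abs_triangle_ineq[of "A + p * B" "q * C"] abs_triangle_ineq[of A "p * B"] pos by (simp add: abs_mult)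
    then show ?thesis .
  qed
  also have "\<dots> \<le> 38 / (real R)\<^sup>2 + p * (38 / (real R)\<^sup>2) + q * (38 / (real R)\<^sup>2)"
    using pos by (intro add_mono mult_left_mono prod) auto
  finally show ?thesis by (simp only: distrib_right mult_1)
qed

lemma infsum_eq_sum:
  fixes f :: "pt \<Rightarrow> complex"
  assumes "finite B" "\<And>x. x \<notin> B \<Longrightarrow> f x = 0"
  shows "infsum f UNIV = sum f B"
proof -
  have "infsum f UNIV = infsum f B" by (rule infsum_cong_neutral) (use assms in auto)
  then show ?thesis using assms by simp
qed

text \<open>The neighbour sum is symmetric, and the box leaves room for unit shifts of the cut-off,
  so no boundary terms arise.\<close>

lemma cutoff_summation_by_parts:
  assumes R: "R \<ge> 1"
  shows "(\<Sum>x\<in>box3 (R + 2). cutoff R x *\<^sub>R (nbsum Y x - total *\<^sub>R Y x)) =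
    (\<Sum>x\<in>box3 (R + 2). (nbsum (cutoff R) x - total * cutoff R x) *\<^sub>R (Y x :: complex))"
proof -
  have shift: "(\<Sum>x\<in>box3 (R + 2). cutoff R x *\<^sub>R Y (x + d)) = (\<Sum>x\<in>box3 (R + 2). cutoff R (x - d) *\<^sub>R Y x)"
    if d: "d \<in> {e1, e2, e3, - e1, - e2, - e3}" for d
  proof -
    have out: "cutoff R x = 0" "cutoff R (x - d) = 0" if "x \<notin> box3 (R + 2)" for x
    proof -
      have "x \<notin> box3 R" using that by (auto simp: box3_def)
      moreover have "x - d \<notin> box3 R"
        using that d by (cases x) (auto simp: box3_def e1_def e2_def e3_def)
      ultimately show "cutoff R x = 0" "cutoff R (x - d) = 0"
        using cutoff_outside[OF R] by blast+
    qed
    have "(\<Sum>x\<in>box3 (R + 2). cutoff R x *\<^sub>R Y (x + d)) = infsum (\<lambda>x. cutoff R x *\<^sub>R Y (x + d)) UNIV"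
      by (rule infsum_eq_sum[symmetric]) (auto simp: finite_box3 out)
    also have "\<dots> = infsum (\<lambda>x. cutoff R (x - d) *\<^sub>R Y x) UNIV"
      using infsum_translate[of "\<lambda>x. cutoff R (x - d) *\<^sub>R Y x" d] by simp
    also have "\<dots> = (\<Sum>x\<in>box3 (R + 2). cutoff R (x - d) *\<^sub>R Y x)"
      by (rule infsum_eq_sum) (auto simp: finite_box3 out)
    finally show ?thesis .
  qed
  have s: "(\<Sum>x\<in>box3 (R + 2). cutoff R x *\<^sub>R Y (x + e)) = (\<Sum>x\<in>box3 (R + 2). cutoff R (x - e) *\<^sub>R Y x)"
    "(\<Sum>x\<in>box3 (R + 2). cutoff R x *\<^sub>R Y (x - e)) = (\<Sum>x\<in>box3 (R + 2). cutoff R (x + e) *\<^sub>R Y x)"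
    if "e \<in> {e1, e2, e3}" for e
    using shift[of e] shift[of "- e"] that by auto
  have l: "cutoff R x *\<^sub>R (nbsum Y x - total *\<^sub>R Y x) = (cutoff R x *\<^sub>R Y (x + e1) + cutoff R x *\<^sub>R Y (x - e1))
      + p *\<^sub>R (cutoff R x *\<^sub>R Y (x + e2) + cutoff R x *\<^sub>R Y (x - e2))
      + q *\<^sub>R (cutoff R x *\<^sub>R Y (x + e3) + cutoff R x *\<^sub>R Y (x - e3)) - total *\<^sub>R (cutoff R x *\<^sub>R Y x)" for x
    by (simp add: nbsum_def algebra_simps)
  have r: "(nbsum (cutoff R) x - total * cutoff R x) *\<^sub>R Y x = (cutoff R (x - e1) *\<^sub>R Y x + cutoff R (x + e1) *\<^sub>R Y x)
      + p *\<^sub>R (cutoff R (x - e2) *\<^sub>R Y x + cutoff R (x + e2) *\<^sub>R Y x)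
      + q *\<^sub>R (cutoff R (x - e3) *\<^sub>R Y x + cutoff R (x + e3) *\<^sub>R Y x) - total *\<^sub>R (cutoff R x *\<^sub>R Y x)" for x
    by (simp add: nbsum_def algebra_simps)
  show ?thesis
    unfolding l r sum_subtractf sum.distrib scaleR_sum_right[symmetric]
    by (simp only: s insertI1 insertI2)
qed

text \<open>Testing against the cut-off gives the total mass in the limit. After summation by parts
  the cut-off contributes O(R^-2) on a box of order R^3 points; with the average condition on
  \<open>Y\<close>, Cauchy-Schwarz bounds the sum by R^(3/2) R^-2 o(R^(1/2)), which tends to
  0.\<close>

lemma threshold_source_sum_zero:
  assumes eq: "\<And>x. nbsum Y x = total *\<^sub>R Y x + g x" and g: "nonzeros_finite g"
    and avg: "vanishing_average (\<lambda>k n. Y (k, n))"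
  shows "(\<Sum>x | g x \<noteq> 0. g x) = 0"
proof -
  define S where "S = {x. g x \<noteq> 0}"
  have "finite S" using g by (simp add: S_def nonzeros_finite_def)
  define s where "s R = (\<Sum>x\<in>S. cutoff R x *\<^sub>R g x)" for R
  define C where "C = (1 + p + q) * 38"
  have lim: "s \<longlonglongrightarrow> (\<Sum>x\<in>S. (1 * 1 * 1) *\<^sub>R g x)"
    unfolding s_def cutoff_def by (intro tendsto_intros hat_tendsto_1)
  have bound: "(norm (\<Sum>x\<in>S. g x))\<^sup>2 \<le> 0 + \<epsilon>" if "\<epsilon> > 0" for \<epsilon> :: real
  proof -
    have "C > 0" using pos by (simp add: C_def)
    \<comment> \<open>1029 = 7^3 * 3: the box has at most \<open>(7 * R) ^ 3\<close> points, and
      \<open>R + 2 \<le> 3 * R\<close>.\<close>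
    define \<epsilon>' where "\<epsilon>' = \<epsilon> / (1029 * C\<^sup>2)"
    have "\<epsilon>' > 0" using that \<open>C > 0\<close> by (simp add: \<epsilon>'_def)
    then obtain R0 where R0: "\<And>R. R \<ge> R0 \<Longrightarrow> (\<Sum>k\<in>{-int R..int R}. \<Sum>n\<in>{-int R..int R} \<times> {-int R..int R}. (norm (Y (k, n)))\<^sup>2) \<le> \<epsilon>' * real R"
      using avg unfolding vanishing_average_def by blast
    define R1 where "R1 = (\<Sum>(a, b, c)\<in>S. nat \<bar>a\<bar> + nat \<bar>b\<bar> + nat \<bar>c\<bar>)"
    have SB: "S \<subseteq> box3 R" if "R \<ge> R1" for R
    proof
      fix x assume "x \<in> S"
      then have "(case x of (a, b, c) \<Rightarrow> nat \<bar>a\<bar> + nat \<bar>b\<bar> + nat \<bar>c\<bar>) \<le> R1"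
        unfolding R1_def using \<open>finite S\<close> by (intro member_le_sum) auto
      then show "x \<in> box3 R" using that by (cases x) (auto simp: box3_def)
    qed
    have sq: "(norm (s R))\<^sup>2 \<le> \<epsilon>" if R: "R \<ge> max 1 (max R0 R1)" for R
    proof -
      have "R \<ge> 1" using R by simp
      have "s R = (\<Sum>x\<in>box3 (R + 2). cutoff R x *\<^sub>R g x)"
        unfolding s_def using SB[of "R + 2"] R
        by (intro sum.mono_neutral_left finite_box3) (auto simp: S_def)
      also have "\<dots> = (\<Sum>x\<in>box3 (R + 2). cutoff R x *\<^sub>R (nbsum Y x - total *\<^sub>R Y x))"
        by (simp add: eq)
      also have "\<dots> = (\<Sum>x\<in>box3 (R + 2). (nbsum (cutoff R) x - total * cutoff R x) *\<^sub>R Y x)"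
        by (rule cutoff_summation_by_parts[OF \<open>R \<ge> 1\<close>])
      finally have sR: "s R = (\<Sum>x\<in>box3 (R + 2). (nbsum (cutoff R) x - total * cutoff R x) *\<^sub>R Y x)" .
      have "norm (s R) \<le> (\<Sum>x\<in>box3 (R + 2). (C / (real R)\<^sup>2) * norm (Y x))"
        unfolding sR
      proof (rule sum_norm_le)
        fix x
        show "norm ((nbsum (cutoff R) x - total * cutoff R x) *\<^sub>R Y x) \<le> C / (real R)\<^sup>2 * norm (Y x)"
          unfolding norm_scaleR
        proof (rule mult_right_mono)
          show "\<bar>nbsum (cutoff R) x - total * cutoff R x\<bar> \<le> C / (real R)\<^sup>2"
            using cutoff_nbsum_le[OF \<open>R \<ge> 1\<close>, of x] by (simp only: C_def times_divide_eq_right)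
        qed simp
      qed
      then have "(norm (s R))\<^sup>2 \<le> (\<Sum>x\<in>box3 (R + 2). (C / (real R)\<^sup>2) * norm (Y x))\<^sup>2"
        by (intro power_mono) auto
      also have "\<dots> \<le> (\<Sum>x\<in>box3 (R + 2). (C / (real R)\<^sup>2)\<^sup>2) * (\<Sum>x\<in>box3 (R + 2). (norm (Y x))\<^sup>2)"
        by (rule Cauchy_Schwarz_ineq_sum)
      also have "(\<Sum>x\<in>box3 (R + 2). (norm (Y x))\<^sup>2) =
          (\<Sum>k\<in>{-int (R + 2)..int (R + 2)}. \<Sum>n\<in>{-int (R + 2)..int (R + 2)} \<times> {-int (R + 2)..int (R + 2)}. (norm (Y (k, n)))\<^sup>2)"
        unfolding box3_def sum.cartesian_product by (intro sum.cong) auto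
      also have "(\<Sum>x\<in>box3 (R + 2). (C / (real R)\<^sup>2)\<^sup>2) = real ((2 * R + 5) ^ 3) * (C / (real R)\<^sup>2)\<^sup>2"
        by (simp add: card_box3 add.commute)
      also have "real ((2 * R + 5) ^ 3) * (C / (real R)\<^sup>2)\<^sup>2 * (\<Sum>k\<in>{-int (R + 2)..int (R + 2)}. \<Sum>n\<in>{-int (R + 2)..int (R + 2)} \<times> {-int (R + 2)..int (R + 2)}. (norm (Y (k, n)))\<^sup>2)
          \<le> (7 * real R) ^ 3 * (C / (real R)\<^sup>2)\<^sup>2 * (\<epsilon>' * (3 * real R))"
      proof (intro mult_mono)
        show "real ((2 * R + 5) ^ 3) \<le> (7 * real R) ^ 3"
          unfolding of_nat_power using \<open>R \<ge> 1\<close> by (intro power_mono) auto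
        have "\<epsilon>' * real (R + 2) \<le> \<epsilon>' * (3 * real R)"
          using \<open>R \<ge> 1\<close> \<open>\<epsilon>' > 0\<close> by (intro mult_left_mono) auto
        moreover have "R + 2 \<ge> R0" using R by simp
        ultimately show "(\<Sum>k\<in>{-int (R + 2)..int (R + 2)}. \<Sum>n\<in>{-int (R + 2)..int (R + 2)} \<times> {-int (R + 2)..int (R + 2)}. (norm (Y (k, n)))\<^sup>2) \<le> \<epsilon>' * (3 * real R)"
          using R0[of "R + 2"] by linarith
      qed (auto intro!: sum_nonneg)
      also have "\<dots> = 1029 * C\<^sup>2 * \<epsilon>'"
        using \<open>R \<ge> 1\<close> by (simp add: power_divide power_mult_distrib power2_eq_square power3_eq_cube)
      also have "\<dots> = \<epsilon>" using \<open>C > 0\<close> by (simp add: \<epsilon>'_def)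
      finally show ?thesis .
    qed
    have "(\<lambda>R. (norm (s R))\<^sup>2) \<longlonglongrightarrow> (norm (\<Sum>x\<in>S. (1 * 1 * 1) *\<^sub>R g x))\<^sup>2"
      by (intro tendsto_intros lim)
    then have "(norm (\<Sum>x\<in>S. (1 * 1 * 1) *\<^sub>R g x))\<^sup>2 \<le> \<epsilon>"
      by (rule LIMSEQ_le_const2) (use sq in blast)
    then show ?thesis by simp
  qed
  then have "(norm (\<Sum>x\<in>S. g x))\<^sup>2 \<le> 0" by (rule field_le_epsilon)
  then show ?thesis by (simp add: S_def)
qed

lemma square_summable_sum:
  "(\<And>i. i \<in> I \<Longrightarrow> square_summable (f i)) \<Longrightarrow> square_summable (\<lambda>x. \<Sum>i\<in>I. f i x)"
proof (induction I rule: infinite_finite_induct)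
  case (insert i I)
  have "square_summable (\<lambda>x. f i x + (\<Sum>i\<in>I. f i x))"
    by (intro square_summable_add insert) auto
  then show ?case using insert.hyps by simp
qed (simp_all add: square_summable_def)

text \<open>At \<open>E = total\<close> the recurrence is the Poisson equation of the walk, with
  \<open>nbsum Y - total Y\<close> equal to the source.\<close>

theorem threshold_energy_summable:
  fixes y g :: "int \<Rightarrow> int \<times> int \<Rightarrow> complex"
  assumes y: "\<And>k n. y (k + 1) n + y (k - 1) n = lattice_symbol.hop total p q (y k) n + g k n"
    and g: "finite {(k, n). g k n \<noteq> 0}"
    and avg: "vanishing_average y"
  shows "(\<lambda>(k, n). (norm (y k n))\<^sup>2) summable_on UNIV"
proof -
  define Y where "Y = (\<lambda>(k, n). y k n)"
  define G where "G = (\<lambda>(k, n). g k n)"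
  have hop: "nbsum (\<lambda>(k, n). v k n) (k, n) = total *\<^sub>R v k n + (v (k + 1) n + v (k - 1) n - lattice_symbol.hop total p q (v k) n)"
    for v :: "int \<Rightarrow> int \<times> int \<Rightarrow> complex" and k n
    by (cases n) (simp add: nbsum_def lattice_symbol.hop_def e1_def e2_def e3_def scaleR_conv_of_real algebra_simps)
  have eq: "nbsum Y x = total *\<^sub>R Y x + G x" for x
    using hop[of y "fst x" "snd x"] y[of "fst x" "snd x"] by (simp add: Y_def G_def case_prod_unfold)
  have Gfin: "nonzeros_finite G" using g by (simp add: G_def nonzeros_finite_def case_prod_unfold)
  define S where "S = {x. G x \<noteq> 0}"
  have "finite S" using Gfin by (simp add: S_def nonzeros_finite_def)
  have G0: "(\<Sum>m\<in>S. G m) = 0"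
    unfolding S_def by (rule threshold_source_sum_zero[OF eq Gfin]) (use avg in \<open>simp add: Y_def\<close>)
  \<comment> \<open>Convolution of the source with the Green function. As the source has mass zero,
    \<open>green x\<close> may be subtracted, so that only square summable differences occur. The
    sign is that of \<open>nbsum_green\<close>.\<close>
  define w where "w x = (\<Sum>m\<in>S. (- G m / of_real total) * of_real (green (x + - m) - green x))" for x
  have ws: "square_summable w"
    unfolding w_def by (intro square_summable_sum square_summable_mult green_translate_square_summable)
  have w_alt: "w x = (\<Sum>m\<in>S. (- G m / of_real total) * of_real (green (x + - m)))" for x
  proof -
    have "(\<Sum>m\<in>S. (- G m / of_real total) * of_real (green x)) = - of_real (green x) / of_real total * (\<Sum>m\<in>S. G m)"
      unfolding sum_distrib_left by (intro sum.cong refl) (simp add: mult.commute)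
    also have "\<dots> = 0" by (simp add: G0)
    finally have z: "(\<Sum>m\<in>S. (- G m / of_real total) * of_real (green x)) = 0" .
    have "w x = (\<Sum>m\<in>S. (- G m / of_real total) * of_real (green (x + - m))) - (\<Sum>m\<in>S. (- G m / of_real total) * of_real (green x))"
      by (simp only: w_def of_real_diff right_diff_distrib sum_subtractf)
    then show ?thesis unfolding z by simp
  qed
  have nbw: "nbsum w x = total *\<^sub>R w x + G x" for x
  proof -
    have "nbsum w x = (\<Sum>m\<in>S. (- G m / of_real total) * of_real (nbsum green (x + - m)))"
      unfolding w_alt nbsum_def
      by (simp add: scaleR_conv_of_real sum_distrib_left sum.distrib[symmetric] algebra_simps)
    also have "\<dots> = (\<Sum>m\<in>S. total *\<^sub>R ((- G m / of_real total) * of_real (green (x + - m))) + (if m = x then G m else 0))"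
    proof (rule sum.cong[OF refl])
      fix m
      show "(- G m / of_real total) * of_real (nbsum green (x + - m)) =
          total *\<^sub>R ((- G m / of_real total) * of_real (green (x + - m))) + (if m = x then G m else 0)"
        unfolding nbsum_green using total_pos by (simp add: scaleR_conv_of_real algebra_simps)
    qed
    also have "\<dots> = total *\<^sub>R w x + (if x \<in> S then G x else 0)"
      unfolding sum.distrib w_alt scaleR_sum_right using \<open>finite S\<close> by simp
    finally show ?thesis by (simp add: S_def)
  qed
  interpret lattice_symbol total p q .
  have "y k n = (\<lambda>k n. w (k, n)) k n" for k n
  proof (rule solution_unique[where g = g, OF y avg])
    show "w (k + 1, n) + w (k - 1, n) = hop (\<lambda>n. w (k, n)) n + g k n" for k n
      using hop[of "\<lambda>k n. w (k, n)" k n] nbw[of "(k, n)"] by (simp add: G_def algebra_simps)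
    show "vanishing_average (\<lambda>k n. w (k, n))"
      by (rule vanishing_average_if_summable) (use ws in \<open>simp add: square_summable_def case_prod_unfold\<close>)
  qed
  then show ?thesis
    using ws by (simp add: square_summable_def case_prod_unfold)
qed

end

section \<open>Scalar equations\<close>

definition sublattice :: "lattice \<Rightarrow> pt \<Rightarrow> lattice" where
  "sublattice a x = (case x of (k, m1, m2) \<Rightarrow> vector [2 * k + a $ 1, 2 * m1 + a $ 2, 2 * m2 + a $ 3])"

lemma inj_sublattice: "inj (sublattice a)"
  by (auto simp: inj_def sublattice_def vec_eq_iff forall_3)

lemma sublattice_shift:
  "sublattice a (k + s, m1, m2) = sublattice a (k, m1, m2) + axis 1 (2 * s)"
  "sublattice a (k, m1 + s, m2) = sublattice a (k, m1, m2) + axis 2 (2 * s)"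
  "sublattice a (k, m1, m2 + s) = sublattice a (k, m1, m2) + axis 3 (2 * s)"
  by (simp_all add: sublattice_def vec_eq_iff forall_3 axis_def)

lemma l1norm_sublattice_le: "l1norm (sublattice a (k, m1, m2)) \<le> 2 * (\<bar>k\<bar> + \<bar>m1\<bar> + \<bar>m2\<bar>) + l1norm a"
proof -
  have h: "\<bar>2 * i + j\<bar> \<le> 2 * \<bar>i\<bar> + \<bar>j\<bar>" for i j :: int by linarith
  have "l1norm (sublattice a (k, m1, m2)) = \<bar>2 * k + a $ 1\<bar> + \<bar>2 * m1 + a $ 2\<bar> + \<bar>2 * m2 + a $ 3\<bar>"
    "l1norm a = \<bar>a $ 1\<bar> + \<bar>a $ 2\<bar> + \<bar>a $ 3\<bar>"
    by (simp_all add: l1norm_def sum_3 sublattice_def)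
  then show ?thesis
    using h[of k "a $ 1"] h[of m1 "a $ 2"] h[of m2 "a $ 3"] by simp
qed

lemma vanishing_average_sublattice:
  assumes v: "averages_vanish v"
  shows "vanishing_average (\<lambda>k n. v (sublattice a (k, n)))"
  unfolding vanishing_average_def
proof (intro allI impI)
  fix \<epsilon> :: real assume "\<epsilon> > 0"
  then have e7: "\<epsilon> / 7 > 0" by simp
  define S where "S R = (\<Sum>n | real_of_int (l1norm n) < R. (norm (v n))\<^sup>2)" for R :: real
  have "\<forall>\<^sub>F R in at_top. 1 / R * S R < \<epsilon> / 7"
    using v e7 unfolding averages_vanish_def S_def by (rule order_tendstoD)
  then obtain R1 where R1: "\<And>R. R \<ge> R1 \<Longrightarrow> 1 / R * S R < \<epsilon> / 7"
    unfolding eventually_at_top_linorder by blast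
  define L where "L = nat (l1norm a)"
  define R0 where "R0 = nat \<lceil>R1\<rceil> + L + 1"
  show "\<exists>R0. \<forall>R\<ge>R0. (\<Sum>k\<in>{-int R..int R}. \<Sum>n\<in>{-int R..int R} \<times> {-int R..int R}. (norm (v (sublattice a (k, n))))\<^sup>2) \<le> \<epsilon> * real R"
  proof (intro exI[of _ R0] allI impI)
    fix R assume R: "R \<ge> R0"
    \<comment> \<open>A point of the cube of radius \<open>R\<close> is mapped into
      \<open>l1norm\<close> at most \<open>2 * 3 * R + L\<close>; the 1 makes the inequality
      strict.\<close>
    define R' where "R' = real (6 * R + L + 1)"
    have "R' \<ge> R1" using R unfolding R'_def R0_def by linarith
    have "R' > 0" "R' \<le> 7 * real R" using R by (simp_all add: R'_def R0_def)
    have "(\<Sum>k\<in>{-int R..int R}. \<Sum>n\<in>{-int R..int R} \<times> {-int R..int R}. (norm (v (sublattice a (k, n))))\<^sup>2) =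
        (\<Sum>x\<in>box3 R. (norm (v (sublattice a x)))\<^sup>2)"
      unfolding box3_def sum.cartesian_product by (intro sum.cong) auto
    also have "\<dots> = (\<Sum>n\<in>sublattice a ` box3 R. (norm (v n))\<^sup>2)"
      by (simp add: sum.reindex inj_on_subset[OF inj_sublattice])
    also have "\<dots> \<le> S R'"
      unfolding S_def
    proof (rule sum_mono2[OF finite_l1ball])
      show "sublattice a ` box3 R \<subseteq> {n. real_of_int (l1norm n) < R'}"
      proof (intro image_subsetI)
        fix x assume "x \<in> box3 R"
        then obtain k m1 m2 where x: "x = (k, m1, m2)" "\<bar>k\<bar> \<le> int R" "\<bar>m1\<bar> \<le> int R" "\<bar>m2\<bar> \<le> int R"
          by (cases x) (auto simp: box3_def abs_le_iff)
        have "l1norm (sublattice a x) < int (6 * R + L + 1)"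
          using l1norm_sublattice_le[of a k m1 m2] x l1norm_nonneg[of a] by (simp add: L_def)
        then have "real_of_int (l1norm (sublattice a x)) < real_of_int (int (6 * R + L + 1))"
          by (simp only: of_int_less_iff)
        then show "sublattice a x \<in> {n. real_of_int (l1norm n) < R'}" by (simp add: R'_def)
      qed
    qed auto
    also have "\<dots> \<le> \<epsilon> / 7 * R'" using R1[OF \<open>R' \<ge> R1\<close>] \<open>R' > 0\<close> by (simp add: field_simps)
    also have "\<dots> \<le> \<epsilon> / 7 * (7 * real R)" using e7 \<open>R' \<le> 7 * real R\<close> by (intro mult_left_mono) auto
    finally show "(\<Sum>k\<in>{-int R..int R}. \<Sum>n\<in>{-int R..int R} \<times> {-int R..int R}. (norm (v (sublattice a (k, n))))\<^sup>2) \<le> \<epsilon> * real R"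
      by simp
  qed
qed

lemma square_summable_if_sublattices:
  assumes "\<And>a. (\<lambda>x. (norm (v (sublattice a x)))\<^sup>2) summable_on UNIV"
  shows "square_summable v"
proof -
  have r: "(\<lambda>n. (norm (v n))\<^sup>2) summable_on range (sublattice a)" for a
    using assms[of a] summable_on_reindex[OF inj_sublattice, of "\<lambda>n. (norm (v n))\<^sup>2" a] by (simp add: o_def)
  define A where "A = (\<lambda>(i, j, k). vector [i, j, k] :: lattice) ` ({0, 1} \<times> {0, 1} \<times> {0, 1})"
  have "finite A" by (simp add: A_def)
  have "(\<lambda>n. (norm (v n))\<^sup>2) summable_on (\<Union>a\<in>B. range (sublattice a))" if "finite B" for B
    using that
  proof induction
    case (insert b B)
    then show ?case unfolding UN_insert by (intro summable_on_union r)
  qed simp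
  from this[OF \<open>finite A\<close>] have "(\<lambda>n. (norm (v n))\<^sup>2) summable_on (\<Union>a\<in>A. range (sublattice a))" .
  moreover have "(\<Union>a\<in>A. range (sublattice a)) = UNIV"
  proof (intro set_eqI iffI UNIV_I)
    fix n :: lattice
    define a :: lattice where "a = vector [n $ 1 mod 2, n $ 2 mod 2, n $ 3 mod 2]"
    have m: "i mod 2 \<in> {0, 1}" for i :: int by simp presburger
    have "a \<in> A"
      unfolding A_def
    proof (rule image_eqI[of _ _ "(n $ 1 mod 2, n $ 2 mod 2, n $ 3 mod 2)"])
      show "(n $ 1 mod 2, n $ 2 mod 2, n $ 3 mod 2) \<in> {0, 1} \<times> {0, 1} \<times> {0, 1}"
        using m by (intro SigmaI)
    qed (simp add: a_def)
    moreover have "n = sublattice a (n $ 1 div 2, n $ 2 div 2, n $ 3 div 2)"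
    proof -
      have "2 * (n $ i div 2) + n $ i mod 2 = n $ i" for i by (rule mult_div_mod_eq)
      then show ?thesis
        by (simp only: sublattice_def a_def vec_eq_iff forall_3 vector_3 prod.case)
    qed
    then have "n \<in> range (sublattice a)" by (rule range_eqI)
    ultimately show "n \<in> (\<Union>a\<in>A. range (sublattice a))" by (rule UN_I)
  qed
  ultimately show ?thesis by (simp add: square_summable_def)
qed

context lattice_walk
begin

text \<open>If both angles have cosine \<open>c = E / total\<close>, then the symbol equals
  \<open>E - 2 * (p + q) * c = 2 * c\<close>, which has modulus below 2.\<close>

lemma below_threshold_summable:
  fixes y g :: "int \<Rightarrow> int \<times> int \<Rightarrow> complex"
  assumes y: "\<And>k n. y (k + 1) n + y (k - 1) n = lattice_symbol.hop E p q (y k) n + g k n"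
    and g: "finite {(k, n). g k n \<noteq> 0}"
    and avg: "vanishing_average y"
    and E: "\<bar>E\<bar> < total"
  shows "(\<lambda>(k, n). (norm (y k n))\<^sup>2) summable_on UNIV"
proof -
  interpret lattice_symbol E p q .
  define c where "c = E / total"
  have c: "\<bar>c\<bar> < 1" using E total_pos by (simp add: c_def)
  define x0 where "x0 = (arccos c, arccos c)"
  have "0 < arccos c" "arccos c < pi" using c arccos_lt_bounded[of c] by (auto simp: abs_less_iff)
  then have "arccos c < 2 * pi" using pi_gt_zero by linarith
  then have x0: "x0 \<in> box (0, 0) (2 * pi, 2 * pi)"
    using \<open>0 < arccos c\<close> by (auto simp: x0_def mem_box Basis_prod_def)
  have "c * total = E" using total_pos by (simp add: c_def)
  then have "symb x0 = 2 * c" using c by (simp add: symb_def x0_def cos_arccos_abs total_def algebra_simps)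
  then have "\<bar>symb x0\<bar> < 2" using c by simp
  from inner_energy_summable[OF y g avg x0 this] show ?thesis .
qed

text \<open>A staggered sign exchanges the two edges of the spectrum.\<close>

lemma lower_threshold_summable:
  fixes y g :: "int \<Rightarrow> int \<times> int \<Rightarrow> complex"
  assumes y: "\<And>k n. y (k + 1) n + y (k - 1) n = lattice_symbol.hop (- total) p q (y k) n + g k n"
    and g: "finite {(k, n). g k n \<noteq> 0}"
    and avg: "vanishing_average y"
  shows "(\<lambda>(k, n). (norm (y k n))\<^sup>2) summable_on UNIV"
proof -
  define \<sigma> where "\<sigma> k n = (if even (k + fst n + snd n) then 1 else - 1 :: complex)" for k :: int and n :: "int \<times> int"
  have \<sigma>: "norm (\<sigma> k n) = 1" "\<sigma> (k + 1) n = - \<sigma> k n" "\<sigma> (k - 1) n = - \<sigma> k n"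
    "\<sigma> k ((1, 0) + n) = - \<sigma> k n" "\<sigma> k ((-1, 0) + n) = - \<sigma> k n"
    "\<sigma> k ((0, 1) + n) = - \<sigma> k n" "\<sigma> k ((0, -1) + n) = - \<sigma> k n" for k n
    by (auto simp: \<sigma>_def)
  define z where "z k n = \<sigma> k n * y k n" for k n
  have nz: "norm (z k n) = norm (y k n)" for k n by (simp add: z_def norm_mult \<sigma>)
  have eq: "z (k + 1) n + z (k - 1) n = lattice_symbol.hop total p q (z k) n + (- \<sigma> k n * g k n)" for k n
  proof -
    have "z (k + 1) n + z (k - 1) n = - \<sigma> k n * (y (k + 1) n + y (k - 1) n)"
      unfolding z_def \<sigma> by (simp add: algebra_simps)
    also have "\<dots> = - \<sigma> k n * lattice_symbol.hop (- total) p q (y k) n + (- \<sigma> k n * g k n)"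
      unfolding y by (simp add: algebra_simps)
    also have "- \<sigma> k n * lattice_symbol.hop (- total) p q (y k) n = lattice_symbol.hop total p q (z k) n"
      unfolding lattice_symbol.hop_def z_def \<sigma> by (simp add: algebra_simps)
    finally show ?thesis .
  qed
  have "finite {(k, n). - \<sigma> k n * g k n \<noteq> 0}"
    by (rule finite_subset[OF _ g]) auto
  moreover have "vanishing_average z" using avg by (simp add: vanishing_average_def nz)
  ultimately show ?thesis
    using threshold_energy_summable[where y = z, OF eq] by (simp add: nz)
qed

end

text \<open>Division by \<open>c 1 / 4\<close> makes the first coordinate the time and turns the
  energy into \<open>E' = total - 4 * E / c 1\<close>. The energies from 0 (excluded) to the sum of
  the \<open>c j\<close> (included) correspond to \<open>- total \<le> E' < total\<close>, so the
  top of the spectrum is \<open>E' = - total\<close>.\<close>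

theorem square_summable_scalar_solution:
  fixes v :: "lattice \<Rightarrow> complex" and c :: "3 \<Rightarrow> real"
  assumes v: "averages_vanish v" and c: "\<And>j. c j > 0" and E: "E > 0" and g: "finite_support g"
    and eq: "\<And>n. of_real E * v n - (\<Sum>j\<in>UNIV. of_real (c j) * yhat j (yhat j v) n) = g n"
  shows "square_summable v"
proof (cases "E > (\<Sum>j\<in>UNIV. c j)")
  case True
  show ?thesis
    by (rule square_summable_outside_spectrum[OF v square_summable_if_finite_support[OF g] _ True eq])
      (use c in \<open>auto intro: less_imp_le\<close>)
next
  case False
  define p where "p = c 2 / c 1"
  define q where "q = c 3 / c 1"
  interpret lattice_walk p q by unfold_locales (use c in \<open>auto simp: p_def q_def\<close>)
  have c1: "c 1 > 0" by (rule c)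
  have sum_c: "(\<Sum>j\<in>UNIV. c j) = c 1 * total / 2"
    unfolding total_def unfolding p_def q_def using c1 by (simp add: sum_3 field_simps)
  define E' where "E' = total - 4 * E / c 1"
  have E': "E' < total" "- total \<le> E'"
    using False E c1 unfolding sum_c E'_def by (auto simp: field_simps)
  show ?thesis
  proof (rule square_summable_if_sublattices)
    fix a
    define y where "y k n = v (sublattice a (k, n))" for k n
    define G where "G k n = of_real (4 / c 1) * g (sublattice a (k, n))" for k n
    have y: "y (k + 1) n + y (k - 1) n = lattice_symbol.hop E' p q (y k) n + G k n" for k n
    proof -
      obtain m1 m2 where n: "n = (m1, m2)" by (cases n)
      define x where "x = sublattice a (k, m1, m2)"
      have sh: "y (k + 1) n = v (x + axis 1 2)" "y (k - 1) n = v (x + axis 1 (- 2))"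
        "y k ((1, 0) + n) = v (x + axis 2 2)" "y k ((-1, 0) + n) = v (x + axis 2 (- 2))"
        "y k ((0, 1) + n) = v (x + axis 3 2)" "y k ((0, -1) + n) = v (x + axis 3 (- 2))" "y k n = v x"
        using sublattice_shift(1)[of a k 1 m1 m2] sublattice_shift(1)[of a k "-1" m1 m2]
          sublattice_shift(2)[of a k m1 1 m2] sublattice_shift(2)[of a k m1 "-1" m2]
          sublattice_shift(3)[of a k m1 m2 1] sublattice_shift(3)[of a k m1 m2 "-1"]
        by (simp_all add: y_def n x_def add.commute)
      have e: "of_real E * v x - (of_real (c 1) * ((2 * v x - v (x + axis 1 2) - v (x + axis 1 (- 2))) / 4)
          + of_real (c 2) * ((2 * v x - v (x + axis 2 2) - v (x + axis 2 (- 2))) / 4)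
          + of_real (c 3) * ((2 * v x - v (x + axis 3 2) - v (x + axis 3 (- 2))) / 4)) = g x"
        using eq[of x] unfolding yhat_yhat sum_3 .
      have "of_real (c 1) * (v (x + axis 1 2) + v (x + axis 1 (- 2))) =
          of_real (2 * (c 1 + c 2 + c 3) - 4 * E) * v x - of_real (c 2) * (v (x + axis 2 2) + v (x + axis 2 (- 2)))
          - of_real (c 3) * (v (x + axis 3 2) + v (x + axis 3 (- 2))) + 4 * g x"
        unfolding e[symmetric] by (simp add: field_simps)
      note scaled = this
      have div: "X = (r / a) * w - (b / a) * Y - (d / a) * Z + (4 / a) * G"
        if "a * X = r * w - b * Y - d * Z + 4 * G" "a \<noteq> 0" for a X r w b Y d Z G :: complex
      proof -
        have "X = (r * w - b * Y - d * Z + 4 * G) / a" using that by (simp add: eq_divide_eq mult.commute)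
        then show ?thesis by (simp add: diff_divide_distrib add_divide_distrib)
      qed
      have "v (x + axis 1 2) + v (x + axis 1 (- 2)) =
          of_real ((2 * (c 1 + c 2 + c 3) - 4 * E) / c 1) * v x - of_real p * (v (x + axis 2 2) + v (x + axis 2 (- 2)))
          - of_real q * (v (x + axis 3 2) + v (x + axis 3 (- 2))) + of_real (4 / c 1) * g x"
        using div[OF scaled] c1 by (simp only: p_def q_def of_real_divide of_real_numeral) simp
      moreover have "(2 * (c 1 + c 2 + c 3) - 4 * E) / c 1 = E'"
        unfolding E'_def total_def unfolding p_def q_def using c1 by (simp add: field_simps)
      ultimately have "v (x + axis 1 2) + v (x + axis 1 (- 2)) =
          of_real E' * v x - of_real p * (v (x + axis 2 2) + v (x + axis 2 (- 2)))
          - of_real q * (v (x + axis 3 2) + v (x + axis 3 (- 2))) + of_real (4 / c 1) * g x"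
        by (simp only:)
      moreover have "G k n = of_real (4 / c 1) * g x" by (simp add: G_def n x_def)
      ultimately show ?thesis
        unfolding lattice_symbol.hop_def sh by (simp only:)
    qed
    have Gfin: "finite {(k, n). G k n \<noteq> 0}"
    proof -
      have "{(k, n). G k n \<noteq> 0} = sublattice a -` {n. g n \<noteq> 0}"
        using c1 by (auto simp: G_def)
      then show ?thesis
        using finite_vimageI[OF g[unfolded finite_support_def] inj_sublattice] by simp
    qed
    have avg: "vanishing_average y"
      using vanishing_average_sublattice[OF v, of a] by (simp add: y_def[abs_def])
    have "(\<lambda>(k, n). (norm (y k n))\<^sup>2) summable_on UNIV"
    proof (cases "E' = - total")
      case True
      show ?thesis by (rule lower_threshold_summable[OF y[unfolded True] Gfin avg])
    next
      case False
      show ?thesis by (rule below_threshold_summable[OF y Gfin avg]) (use E' False in auto)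
    qed
    then show "(\<lambda>x. (norm (v (sublattice a x)))\<^sup>2) summable_on UNIV"
      by (simp add: y_def case_prod_unfold)
  qed
qed

section \<open>Maxwell operators\<close>

text \<open>Since \<open>\<epsilon>1 \<mu>2 = \<epsilon>2 \<mu>1\<close>, the weighted divergence \<open>X\<close> of the field \<open>e\<close> vanishes up to a finitely supported
  error, which removes the mixed second differences.\<close>

lemma maxwell_axis_component:
  fixes e1 e2 e3 h1 h2 h3 :: "lattice \<Rightarrow> complex" and \<epsilon>1 \<epsilon>2 \<epsilon>3 \<mu>1 \<mu>2 \<mu>3 l :: complex
  assumes E1: "\<And>n. \<epsilon>1 * (yhat j2 h3 n - yhat j3 h2 n) - l * e1 n = f1 n"
    and E2: "\<And>n. \<epsilon>2 * (yhat j3 h1 n - yhat j1 h3 n) - l * e2 n = f2 n"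
    and E3: "\<And>n. \<epsilon>3 * (yhat j1 h2 n - yhat j2 h1 n) - l * e3 n = f3 n"
    and H1: "\<And>n. - \<mu>1 * (yhat j2 e3 n - yhat j3 e2 n) - l * h1 n = k1 n"
    and H2: "\<And>n. - \<mu>2 * (yhat j3 e1 n - yhat j1 e3 n) - l * h2 n = k2 n"
    and \<kappa>: "\<epsilon>1 * \<mu>2 = \<kappa>" "\<epsilon>2 * \<mu>1 = \<kappa>" and "l \<noteq> 0"
    and fin: "finite_support f1" "finite_support f2" "finite_support f3" "finite_support k1" "finite_support k2"
  shows "finite_support (\<lambda>n. l * l * e3 n - (\<kappa> * yhat j3 (yhat j3 e3) n + \<epsilon>3 * \<mu>2 * yhat j1 (yhat j1 e3) n + \<epsilon>3 * \<mu>1 * yhat j2 (yhat j2 e3) n))"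
proof -
  have le: "(\<lambda>n. l * e1 n) = (\<lambda>n. \<epsilon>1 * (yhat j2 h3 n - yhat j3 h2 n) - f1 n)"
    "(\<lambda>n. l * e2 n) = (\<lambda>n. \<epsilon>2 * (yhat j3 h1 n - yhat j1 h3 n) - f2 n)"
    "(\<lambda>n. l * e3 n) = (\<lambda>n. \<epsilon>3 * (yhat j1 h2 n - yhat j2 h1 n) - f3 n)"
    using E1 E2 E3 by (auto simp: fun_eq_iff algebra_simps)
  have lh: "(\<lambda>n. l * h1 n) = (\<lambda>n. - \<mu>1 * (yhat j2 e3 n - yhat j3 e2 n) - k1 n)"
    "(\<lambda>n. l * h2 n) = (\<lambda>n. - \<mu>2 * (yhat j3 e1 n - yhat j1 e3 n) - k2 n)"
    using H1 H2 by (auto simp: fun_eq_iff algebra_simps)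
  have ye: "l * yhat j e1 n = \<epsilon>1 * (yhat j (yhat j2 h3) n - yhat j (yhat j3 h2) n) - yhat j f1 n"
    "l * yhat j e2 n = \<epsilon>2 * (yhat j (yhat j3 h1) n - yhat j (yhat j1 h3) n) - yhat j f2 n"
    "l * yhat j e3 n = \<epsilon>3 * (yhat j (yhat j1 h2) n - yhat j (yhat j2 h1) n) - yhat j f3 n" for j n
    unfolding yhat_mult[symmetric] le by (simp_all only: yhat_diff yhat_mult)
  have yh: "l * yhat j h1 n = - \<mu>1 * (yhat j (yhat j2 e3) n - yhat j (yhat j3 e2) n) - yhat j k1 n"
    "l * yhat j h2 n = - \<mu>2 * (yhat j (yhat j3 e1) n - yhat j (yhat j1 e3) n) - yhat j k2 n" for j n
    unfolding yhat_mult[symmetric] lh by (simp_all only: yhat_diff yhat_mult)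
  \<comment> \<open>The weights give all second differences of \<open>h1\<close>, \<open>h2\<close>,
    \<open>h3\<close> in \<open>l * X\<close> the common coefficient
    \<open>\<epsilon>3 * \<kappa>\<close>, so they cancel pairwise because the \<open>yhat\<close>
    commute.\<close>
  define X where "X n = \<epsilon>3 * \<mu>2 * yhat j1 e1 n + \<epsilon>3 * \<mu>1 * yhat j2 e2 n + \<kappa> * yhat j3 e3 n" for n
  define W where "W n = \<epsilon>3 * \<mu>2 * yhat j1 f1 n + \<epsilon>3 * \<mu>1 * yhat j2 f2 n + \<kappa> * yhat j3 f3 n" for n
  have lX: "l * X n = - 1 * W n" for n
  proof -
    have "l * X n = \<epsilon>3 * \<mu>2 * (l * yhat j1 e1 n) + \<epsilon>3 * \<mu>1 * (l * yhat j2 e2 n) + \<kappa> * (l * yhat j3 e3 n)"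
      by (simp add: X_def algebra_simps)
    also have "\<dots> = \<epsilon>3 * (\<epsilon>1 * \<mu>2) * (yhat j1 (yhat j2 h3) n - yhat j1 (yhat j3 h2) n)
        + \<epsilon>3 * (\<epsilon>2 * \<mu>1) * (yhat j2 (yhat j3 h1) n - yhat j2 (yhat j1 h3) n)
        + \<epsilon>3 * \<kappa> * (yhat j3 (yhat j1 h2) n - yhat j3 (yhat j2 h1) n) - W n"
      unfolding ye by (simp add: W_def algebra_simps)
    also have "\<dots> = - 1 * W n"
      unfolding \<kappa> yhat_commute[of j2 j1] yhat_commute[of j3 j1] yhat_commute[of j3 j2] by (simp add: algebra_simps)
    finally show ?thesis .
  qed
  have "l * yhat j3 X n = - 1 * yhat j3 W n" for n
    unfolding yhat_mult[symmetric] lX ..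
  then have yX: "yhat j3 X n = - (1 / l) * yhat j3 W n" for n
    using \<open>l \<noteq> 0\<close> by (simp add: field_simps)
  have yX': "yhat j3 X n = \<epsilon>3 * \<mu>2 * yhat j3 (yhat j1 e1) n + \<epsilon>3 * \<mu>1 * yhat j3 (yhat j2 e2) n + \<kappa> * yhat j3 (yhat j3 e3) n" for n
    unfolding X_def[abs_def] by (simp only: yhat_add yhat_mult)
  \<comment> \<open>Inserting the equations for \<open>h1\<close> and \<open>h2\<close> produces
    mixed differences of \<open>e1\<close> and \<open>e2\<close>; these are the first two terms of
    \<open>yhat j3 X\<close>, and the third supplies \<kappa> times the second difference of
    \<open>e3\<close>.\<close>
  have main: "l * l * e3 n - (\<kappa> * yhat j3 (yhat j3 e3) n + \<epsilon>3 * \<mu>2 * yhat j1 (yhat j1 e3) n + \<epsilon>3 * \<mu>1 * yhat j2 (yhat j2 e3) n)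
      = (1 / l) * yhat j3 W n + \<epsilon>3 * (yhat j2 k1 n - yhat j1 k2 n) - l * f3 n" for n
  proof -
    have e3: "l * e3 n = \<epsilon>3 * (yhat j1 h2 n - yhat j2 h1 n) - f3 n"
      using E3[of n] by (simp add: algebra_simps)
    have "l * l * e3 n = \<epsilon>3 * (l * yhat j1 h2 n - l * yhat j2 h1 n) - l * f3 n"
      unfolding mult.assoc[of l l] e3 by (simp add: algebra_simps)
    also have "\<dots> = \<epsilon>3 * (- \<mu>2 * (yhat j3 (yhat j1 e1) n - yhat j1 (yhat j1 e3) n) - yhat j1 k2 n
        - (- \<mu>1 * (yhat j2 (yhat j2 e3) n - yhat j3 (yhat j2 e2) n) - yhat j2 k1 n)) - l * f3 n"
      unfolding yh yhat_commute[of j1 j3] yhat_commute[of j2 j3] ..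
    finally have "l * l * e3 n - (\<kappa> * yhat j3 (yhat j3 e3) n + \<epsilon>3 * \<mu>2 * yhat j1 (yhat j1 e3) n + \<epsilon>3 * \<mu>1 * yhat j2 (yhat j2 e3) n)
        = - yhat j3 X n + \<epsilon>3 * (yhat j2 k1 n - yhat j1 k2 n) - l * f3 n"
      unfolding yX' by (simp add: algebra_simps)
    then show ?thesis unfolding yX by simp
  qed
  show ?thesis
    unfolding main W_def[abs_def]
    by (intro finite_support_add finite_support_diff finite_support_mult finite_support_yhat fin)
qed

text \<open>Eliminating \<open>h2\<close> from the equation for \<open>e1\<close>, and
  \<open>h1\<close> from that for \<open>e2\<close>, leaves second differences along
  \<open>j3\<close> only. All other terms contain \<open>e3\<close>, \<open>h3\<close> or the
  sources, which are square summable.\<close>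

lemma maxwell_transverse_components:
  fixes e1 e2 e3 h1 h2 h3 :: "lattice \<Rightarrow> complex" and \<epsilon>1 \<epsilon>2 \<mu>1 \<mu>2 l :: complex
  assumes E1: "\<And>n. \<epsilon>1 * (yhat j2 h3 n - yhat j3 h2 n) - l * e1 n = f1 n"
    and E2: "\<And>n. \<epsilon>2 * (yhat j3 h1 n - yhat j1 h3 n) - l * e2 n = f2 n"
    and H1: "\<And>n. - \<mu>1 * (yhat j2 e3 n - yhat j3 e2 n) - l * h1 n = k1 n"
    and H2: "\<And>n. - \<mu>2 * (yhat j3 e1 n - yhat j1 e3 n) - l * h2 n = k2 n"
    and \<kappa>: "\<epsilon>1 * \<mu>2 = \<kappa>" "\<epsilon>2 * \<mu>1 = \<kappa>"
    and fin: "finite_support f1" "finite_support f2" "finite_support k1" "finite_support k2"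
    and e3: "square_summable e3" and h3: "square_summable h3"
  shows "square_summable (\<lambda>n. l * l * e1 n - \<kappa> * yhat j3 (yhat j3 e1) n)"
    and "square_summable (\<lambda>n. l * l * e2 n - \<kappa> * yhat j3 (yhat j3 e2) n)"
proof -
  have lh: "(\<lambda>n. l * h1 n) = (\<lambda>n. - \<mu>1 * (yhat j2 e3 n - yhat j3 e2 n) - k1 n)"
    "(\<lambda>n. l * h2 n) = (\<lambda>n. - \<mu>2 * (yhat j3 e1 n - yhat j1 e3 n) - k2 n)"
    using H1 H2 by (auto simp: fun_eq_iff algebra_simps)
  have yh: "l * yhat j h1 n = - \<mu>1 * (yhat j (yhat j2 e3) n - yhat j (yhat j3 e2) n) - yhat j k1 n"
    "l * yhat j h2 n = - \<mu>2 * (yhat j (yhat j3 e1) n - yhat j (yhat j1 e3) n) - yhat j k2 n" for j n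
    unfolding yhat_mult[symmetric] lh by (simp_all only: yhat_diff yhat_mult)
  note sq = square_summable_add square_summable_diff square_summable_mult square_summable_yhat
    fin[THEN square_summable_if_finite_support] e3 h3
  have "l * l * e1 n - \<kappa> * yhat j3 (yhat j3 e1) n = (\<epsilon>1 * l) * yhat j2 h3 n - \<kappa> * yhat j3 (yhat j1 e3) n + \<epsilon>1 * yhat j3 k2 n - l * f1 n" for n
  proof -
    have e1: "l * e1 n = \<epsilon>1 * (yhat j2 h3 n - yhat j3 h2 n) - f1 n"
      using E1[of n] by (simp add: algebra_simps)
    have "l * l * e1 n = \<epsilon>1 * l * yhat j2 h3 n - \<epsilon>1 * (l * yhat j3 h2 n) - l * f1 n"
      unfolding mult.assoc[of l l] e1 by (simp add: algebra_simps)
    then show ?thesis unfolding yh \<kappa>(1)[symmetric] by (simp add: algebra_simps)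
  qed
  then show "square_summable (\<lambda>n. l * l * e1 n - \<kappa> * yhat j3 (yhat j3 e1) n)"
    by (simp only:) (intro sq)
  have "l * l * e2 n - \<kappa> * yhat j3 (yhat j3 e2) n = - (\<epsilon>2 * l) * yhat j1 h3 n - \<kappa> * yhat j3 (yhat j2 e3) n - \<epsilon>2 * yhat j3 k1 n - l * f2 n" for n
  proof -
    have e2: "l * e2 n = \<epsilon>2 * (yhat j3 h1 n - yhat j1 h3 n) - f2 n"
      using E2[of n] by (simp add: algebra_simps)
    have "l * l * e2 n = \<epsilon>2 * (l * yhat j3 h1 n) - \<epsilon>2 * l * yhat j1 h3 n - l * f2 n"
      unfolding mult.assoc[of l l] e2 by (simp add: algebra_simps)
    then show ?thesis unfolding yh \<kappa>(2)[symmetric] by (simp add: algebra_simps)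
  qed
  then show "square_summable (\<lambda>n. l * l * e2 n - \<kappa> * yhat j3 (yhat j3 e2) n)"
    by (simp only:) (intro sq)
qed

lemma square_summable_one_axis:
  assumes "averages_vanish u" "\<kappa> \<ge> 0" "\<kappa> < l\<^sup>2"
    and "square_summable (\<lambda>n. of_real l * of_real l * u n - of_real \<kappa> * yhat j (yhat j u) n)"
  shows "square_summable u"
proof (rule square_summable_outside_spectrum[OF assms(1,4), where c = "\<lambda>i. if i = j then \<kappa> else 0" and E = "l\<^sup>2"])
  show "of_real (l\<^sup>2) * u n - (\<Sum>i\<in>UNIV. of_real (if i = j then \<kappa> else 0) * yhat i (yhat i u) n) =
      of_real l * of_real l * u n - of_real \<kappa> * yhat j (yhat j u) n" for n
  proof -
    have "(\<Sum>i\<in>UNIV. of_real (if i = j then \<kappa> else 0) * yhat i (yhat i u) n) =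
        (\<Sum>i\<in>UNIV. if i = j then of_real \<kappa> * yhat i (yhat i u) n else 0)"
      by (intro sum.cong) auto
    then show ?thesis by (simp add: power2_eq_square)
  qed
qed (use assms in auto)

text \<open>The system is invariant under (e, h) to (h, -e) with \<open>eps\<close> and
  \<open>mu\<close> exchanged, so the results for the electric components apply to the magnetic
  ones. The axis \<open>j3\<close> is the one whose \<beta> vanishes.\<close>

lemma maxwell_square_summable:
  fixes e h f k :: "3 \<Rightarrow> lattice \<Rightarrow> complex" and eps mu :: "3 \<Rightarrow> real" and l :: real
  assumes pos: "\<And>j. eps j > 0" "\<And>j. mu j > 0"
    and E: "\<And>n. eps j1 * (yhat j2 (h j3) n - yhat j3 (h j2) n) - l * e j1 n = f j1 n"
      "\<And>n. eps j2 * (yhat j3 (h j1) n - yhat j1 (h j3) n) - l * e j2 n = f j2 n"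
      "\<And>n. eps j3 * (yhat j1 (h j2) n - yhat j2 (h j1) n) - l * e j3 n = f j3 n"
    and H: "\<And>n. - of_real (mu j1) * (yhat j2 (e j3) n - yhat j3 (e j2) n) - l * h j1 n = k j1 n"
      "\<And>n. - of_real (mu j2) * (yhat j3 (e j1) n - yhat j1 (e j3) n) - l * h j2 n = k j2 n"
      "\<And>n. - of_real (mu j3) * (yhat j1 (e j2) n - yhat j2 (e j1) n) - l * h j3 n = k j3 n"
    and fin: "\<And>j. finite_support (f j)" "\<And>j. finite_support (k j)"
    and avg: "\<And>j. averages_vanish (e j)" "\<And>j. averages_vanish (h j)"
    and axes: "UNIV = {j1, j2, j3}" "j1 \<noteq> j2" "j1 \<noteq> j3" "j2 \<noteq> j3"
    and \<kappa>: "eps j1 * mu j2 = \<kappa>" "eps j2 * mu j1 = \<kappa>" "\<kappa> < l\<^sup>2"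
  shows "square_summable (e j)" and "square_summable (h j)"
proof -
  have "\<kappa> > 0" using \<kappa>(1) pos[of j1] pos(2)[of j2] by (metis mult_pos_pos)
  then have l2: "l\<^sup>2 > 0" using \<kappa>(3) by linarith
  then have "l \<noteq> 0" by auto
  have \<kappa>c: "complex_of_real (eps j1) * of_real (mu j2) = of_real \<kappa>" "complex_of_real (eps j2) * of_real (mu j1) = of_real \<kappa>"
    "complex_of_real (mu j1) * of_real (eps j2) = of_real \<kappa>" "complex_of_real (mu j2) * of_real (eps j1) = of_real \<kappa>"
    using \<kappa> by (simp_all flip: of_real_mult add: mult.commute)
  have scalar: "square_summable v"
    if v: "averages_vanish v" and c: "c1 > 0" "c2 > 0"
      and g: "finite_support (\<lambda>n. of_real l * of_real l * v n - (of_real \<kappa> * yhat j3 (yhat j3 v) n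
        + of_real c1 * yhat j1 (yhat j1 v) n + of_real c2 * yhat j2 (yhat j2 v) n))" for v and c1 c2 :: real
  proof -
    define c where "c j = (if j = j3 then \<kappa> else if j = j1 then c1 else c2)" for j
    have "(\<Sum>j\<in>UNIV. of_real (c j) * yhat j (yhat j v) n) = of_real \<kappa> * yhat j3 (yhat j3 v) n
        + of_real c1 * yhat j1 (yhat j1 v) n + of_real c2 * yhat j2 (yhat j2 v) n" for n
      using axes(2-4) unfolding axes(1) by (simp add: c_def)
    then show ?thesis
      by (intro square_summable_scalar_solution[OF v _ l2 g, of c])
        (use c \<open>\<kappa> > 0\<close> in \<open>auto simp: c_def power2_eq_square\<close>)
  qed
  \<comment> \<open>The sign change that the exchange of the two fields requires.\<close>
  define e' where "e' j n = (-1) * e j n" for j n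
  define f' where "f' j n = (-1) * f j n" for j n
  have ye': "yhat i (e' j) n = - yhat i (e j) n" for i j n
    unfolding e'_def[abs_def] yhat_mult by simp
  have fin': "finite_support (f' j)" for j
    unfolding f'_def[abs_def] by (intro finite_support_mult fin)
  have E': "mu j1 * (yhat j2 (e' j3) n - yhat j3 (e' j2) n) - l * h j1 n = k j1 n"
    "mu j2 * (yhat j3 (e' j1) n - yhat j1 (e' j3) n) - l * h j2 n = k j2 n"
    "mu j3 * (yhat j1 (e' j2) n - yhat j2 (e' j1) n) - l * h j3 n = k j3 n" for n
    using H[of n] by (simp_all add: ye' algebra_simps)
  have H': "- of_real (eps j1) * (yhat j2 (h j3) n - yhat j3 (h j2) n) - l * e' j1 n = f' j1 n"
    "- of_real (eps j2) * (yhat j3 (h j1) n - yhat j1 (h j3) n) - l * e' j2 n = f' j2 n" for n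
    unfolding f'_def e'_def E(1,2)[symmetric] by (simp_all add: algebra_simps)
  have e3: "square_summable (e j3)"
    by (rule scalar[OF avg(1), where ?c1.0 = "eps j3 * mu j2" and ?c2.0 = "eps j3 * mu j1"])
      (use maxwell_axis_component[OF E H(1,2) \<kappa>c(1,2) _ fin(1) fin(1) fin(1) fin(2) fin(2)] pos \<open>l \<noteq> 0\<close> in simp_all)
  have h3: "square_summable (h j3)"
    by (rule scalar[OF avg(2), where ?c1.0 = "mu j3 * eps j2" and ?c2.0 = "mu j3 * eps j1"])
      (use maxwell_axis_component[OF E' H' \<kappa>c(3,4) _ fin(2) fin(2) fin(2) fin' fin'] pos \<open>l \<noteq> 0\<close> in simp_all)
  have e'3: "square_summable (e' j3)"
    unfolding e'_def[abs_def] by (intro square_summable_mult e3)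
  note et = maxwell_transverse_components[OF E(1,2) H(1,2) \<kappa>c(1,2) fin(1) fin(1) fin(2) fin(2) e3 h3]
  note ht = maxwell_transverse_components[OF E'(1,2) H' \<kappa>c(3,4) fin(2) fin(2) fin' fin' h3 e'3]
  note one = square_summable_one_axis[OF _ less_imp_le[OF \<open>\<kappa> > 0\<close>] \<kappa>(3)]
  have "j = j1 \<or> j = j2 \<or> j = j3" using axes(1) UNIV_I[of j] by auto
  then show "square_summable (e j)" "square_summable (h j)"
    using e3 h3 one[OF avg(1) et(1)] one[OF avg(1) et(2)] one[OF avg(2) ht(1)] one[OF avg(2) ht(2)] by auto
qed

text \<open>The maximum defining \<open>lambda_minus\<close> is bounded below by its value at the
  unit vector of axis \<open>i\<close>. There only the square of \<beta>_i survives in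
  \<open>K0\<close>, and it vanishes.\<close>

lemma kappa_less_energy:
  assumes i: "beta eps mu $ i = 0" and "\<And>j. eps $ j > 0" "\<And>j. mu $ j > 0" and l: "\<bar>l\<bar> > lambda_minus eps mu"
  shows "alpha eps mu $ i < l\<^sup>2"
proof -
  have "axis i 1 \<in> unit_cube" by (auto simp: unit_cube_def axis_def)
  moreover have "tau_minus eps mu (axis i 1) = alpha eps mu $ i"
  proof -
    have "Psi0 eps mu (axis i 1) = alpha eps mu $ i"
      unfolding Psi0_def using inner_axis[of "alpha eps mu" i 1] by (simp add: inner_vec_def)
    moreover have "K0 eps mu (axis i 1) = 0"
      using i exhaust_3[of i] by (auto simp: K0_def Let_def sum_3 axis_def)
    ultimately show ?thesis by (simp add: tau_minus_def)
  qed
  ultimately have "sqrt (alpha eps mu $ i) \<le> lambda_minus eps mu"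
    using lambda_minus_attained(2) by metis
  then have "sqrt (alpha eps mu $ i) < \<bar>l\<bar>" using l by linarith
  then have "sqrt (alpha eps mu $ i) < sqrt (l\<^sup>2)" by simp
  then show ?thesis by (simp only: real_sqrt_less_iff)
qed

lemma norm_field6: "(norm (u :: field6))\<^sup>2 = (\<Sum>j\<in>UNIV. (norm (fst u $ j))\<^sup>2) + (\<Sum>j\<in>UNIV. (norm (snd u $ j))\<^sup>2)"
  by (cases u) (simp add: norm_Pair norm_vec_def L2_set_def sum_nonneg)

theorem proposition1p3:
  fixes eps mu :: "real ^ 3"
    and epsp mup :: "int ^ 3 \<Rightarrow> real ^ 3"
    and l :: real
    and u :: "int ^ 3 \<Rightarrow> (complex ^ 3) \<times> (complex ^ 3)"
  assumes eps_pos: "\<And>j. eps $ j > 0"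
    and mu_pos: "\<And>j. mu $ j > 0"
    and epsp_pos: "\<And>n j. epsp n $ j > 0"
    and mup_pos: "\<And>n j. mup n $ j > 0"
    and finite_perturbation: "finite {n. epsp n \<noteq> eps \<or> mup n \<noteq> mu}"
    and beta: "beta eps mu \<in> B12"
    and lambda: "\<bar>l\<bar> > lambda_minus eps mu"
    and u_B0star: "u \<in> B0star"
    and equation: "\<And>n. HDp epsp mup u n - l *\<^sub>R u n = 0"
    and u_nonzero: "u \<noteq> (\<lambda>n. 0)"
  shows "ell2_eigenvector (HDp epsp mup) l u"
proof -
  define e where "e j n = fst (u n) $ j" for j n
  define h where "h j n = snd (u n) $ j" for j n
  \<comment> \<open>The deviation of the coefficients from their constant values is moved to the
    right as a source; it lives on the finite set where they differ.\<close>
  define f where "f j n = of_real (eps $ j - epsp n $ j) * Mtilde (\<lambda>m. snd (u m)) n $ j" for j n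
  define k where "k j n = - of_real (mu $ j - mup n $ j) * Mtilde (\<lambda>m. fst (u m)) n $ j" for j n
  have eq: "fst (HDp epsp mup u n) = l *\<^sub>R fst (u n)" "snd (HDp epsp mup u n) = l *\<^sub>R snd (u n)" for n
    using equation[of n] by (simp_all add: prod_eq_iff)
  have eqE: "of_real (epsp n $ j) * Mtilde (\<lambda>m. snd (u m)) n $ j = of_real l * e j n" for n j
    using arg_cong[OF eq(1)[of n], of "\<lambda>v. v $ j"]
    by (simp add: HDp_def H0_def diag_mult_def e_def scaleR_conv_of_real[where 'a = complex])
  have eqH: "- of_real (mup n $ j) * Mtilde (\<lambda>m. fst (u m)) n $ j = of_real l * h j n" for n j
    using arg_cong[OF eq(2)[of n], of "\<lambda>v. v $ j"]
    by (simp add: HDp_def H0_def diag_mult_def h_def scaleR_conv_of_real[where 'a = complex])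
  have ME: "of_real (eps $ j) * Mtilde (\<lambda>m. snd (u m)) n $ j - of_real l * e j n = f j n" for j n
    unfolding eqE[symmetric] f_def by (simp add: algebra_simps)
  have MH: "- of_real (mu $ j) * Mtilde (\<lambda>m. fst (u m)) n $ j - of_real l * h j n = k j n" for j n
    unfolding eqH[symmetric] k_def by (simp add: algebra_simps)
  have Mh: "Mtilde (\<lambda>m. snd (u m)) n $ 1 = yhat 2 (h 3) n - yhat 3 (h 2) n"
    "Mtilde (\<lambda>m. snd (u m)) n $ 2 = yhat 3 (h 1) n - yhat 1 (h 3) n"
    "Mtilde (\<lambda>m. snd (u m)) n $ 3 = yhat 1 (h 2) n - yhat 2 (h 1) n" for n
    by (simp_all add: Mtilde_def h_def[abs_def] Let_def)
  have Me: "Mtilde (\<lambda>m. fst (u m)) n $ 1 = yhat 2 (e 3) n - yhat 3 (e 2) n"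
    "Mtilde (\<lambda>m. fst (u m)) n $ 2 = yhat 3 (e 1) n - yhat 1 (e 3) n"
    "Mtilde (\<lambda>m. fst (u m)) n $ 3 = yhat 1 (e 2) n - yhat 2 (e 1) n" for n
    by (simp_all add: Mtilde_def e_def[abs_def] Let_def)
  have fin: "finite_support (f j)" "finite_support (k j)" for j
    unfolding finite_support_def
    by (rule finite_subset[OF _ finite_perturbation]; force simp: f_def k_def)+
  have avg: "averages_vanish (e j)" "averages_vanish (h j)" for j
  proof -
    have "norm (e j n) \<le> norm (u n)" for n
      unfolding e_def using norm_fst_le[of "fst (u n)" "snd (u n)"] Finite_Cartesian_Product.norm_nth_le[of "fst (u n)" j]
      by simp
    moreover have "norm (h j n) \<le> norm (u n)" for n
      unfolding h_def using norm_snd_le[of "snd (u n)" "fst (u n)"] Finite_Cartesian_Product.norm_nth_le[of "snd (u n)" j]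
      by simp
    ultimately show "averages_vanish (e j)" "averages_vanish (h j)"
      using averages_vanish_mono[OF u_B0star] by blast+
  qed
  note E = ME[of 1, unfolded Mh] ME[of 2, unfolded Mh] ME[of 3, unfolded Mh]
  note H = MH[of 1, unfolded Me] MH[of 2, unfolded Me] MH[of 3, unfolded Me]
  have b: "beta eps mu $ 1 = eps $ 2 * mu $ 3 - eps $ 3 * mu $ 2"
    "beta eps mu $ 2 = eps $ 3 * mu $ 1 - eps $ 1 * mu $ 3"
    "beta eps mu $ 3 = eps $ 1 * mu $ 2 - eps $ 2 * mu $ 1"
    by (simp_all add: beta_def cross3_def)
  have "beta eps mu $ 1 * beta eps mu $ 2 * beta eps mu $ 3 = 0"
    using beta by (simp add: B12_def)
  \<comment> \<open>Each \<beta>_i is a difference of two products whose mean is \<alpha>_i, so its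
    vanishing makes both products equal to \<alpha>_i. A cyclic rotation brings the axis to the
    third place.\<close>
  then consider "beta eps mu $ 1 = 0" | "beta eps mu $ 2 = 0" | "beta eps mu $ 3 = 0" by auto
  then have sq: "square_summable (e j) \<and> square_summable (h j)" for j
  proof cases
    case 1
    then have \<kappa>: "eps $ 2 * mu $ 3 = alpha eps mu $ 1" "eps $ 3 * mu $ 2 = alpha eps mu $ 1"
      unfolding b alpha_components by simp_all
    have axes: "UNIV = {2, 3, 1 :: 3}" "(2 :: 3) \<noteq> 3" "(2 :: 3) \<noteq> 1" "(3 :: 3) \<noteq> 1"
      unfolding UNIV_3 by auto
    note sq = maxwell_square_summable[where e = e and h = h and f = f and k = k and eps = "\<lambda>j. eps $ j" and mu = "\<lambda>j. mu $ j",
        OF eps_pos mu_pos E(2,3,1) H(2,3,1) fin avg axes \<kappa> kappa_less_energy[OF 1 eps_pos mu_pos lambda]]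
    show ?thesis using sq by blast
  next
    case 2
    then have \<kappa>: "eps $ 3 * mu $ 1 = alpha eps mu $ 2" "eps $ 1 * mu $ 3 = alpha eps mu $ 2"
      unfolding b alpha_components by simp_all
    have axes: "UNIV = {3, 1, 2 :: 3}" "(3 :: 3) \<noteq> 1" "(3 :: 3) \<noteq> 2" "(1 :: 3) \<noteq> 2"
      unfolding UNIV_3 by auto
    note sq = maxwell_square_summable[where e = e and h = h and f = f and k = k and eps = "\<lambda>j. eps $ j" and mu = "\<lambda>j. mu $ j",
        OF eps_pos mu_pos E(3,1,2) H(3,1,2) fin avg axes \<kappa> kappa_less_energy[OF 2 eps_pos mu_pos lambda]]
    show ?thesis using sq by blast
  next
    case 3
    then have \<kappa>: "eps $ 1 * mu $ 2 = alpha eps mu $ 3" "eps $ 2 * mu $ 1 = alpha eps mu $ 3"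
      unfolding b alpha_components by simp_all
    have axes: "UNIV = {1, 2, 3 :: 3}" "(1 :: 3) \<noteq> 2" "(1 :: 3) \<noteq> 3" "(2 :: 3) \<noteq> 3"
      unfolding UNIV_3 by auto
    note sq = maxwell_square_summable[where e = e and h = h and f = f and k = k and eps = "\<lambda>j. eps $ j" and mu = "\<lambda>j. mu $ j",
        OF eps_pos mu_pos E H fin avg axes \<kappa> kappa_less_energy[OF 3 eps_pos mu_pos lambda]]
    show ?thesis using sq by blast
  qed
  have "(\<lambda>n. (\<Sum>j\<in>UNIV. (norm (e j n))\<^sup>2) + (\<Sum>j\<in>UNIV. (norm (h j n))\<^sup>2)) summable_on UNIV"
    unfolding sum_3 by (intro summable_on_add) (use sq in \<open>auto simp: square_summable_def\<close>)
  then have "u \<in> ell2"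
    by (simp add: ell2_def norm_field6 e_def h_def)
  moreover have "HDp epsp mup u n = l *\<^sub>R u n" for n
    using equation[of n] by simp
  ultimately show ?thesis
    using u_nonzero by (simp add: ell2_eigenvector_def)
qed

end
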